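(* There is a one-to-one correspondence (up to isomorphism) between $2$-Segal cosymmetric sets and commutative Frobenius pseudomonoids in the bicategory $\mathbf{Span}$ of spans of sets. The correspondence is the one induced by the assignment $X_\bullet\mapsto(X_1,X_2,X_0,\dots)$ described in the context.
   Context: **Cosymmetric sets.** $\Phi$ is the full subcategory of $\mathbf{Set}$ on the objects $[n]=\{0,\dots,n\}$, $n\ge0$. A cosymmetric set is a functor $X_\bullet:\Phi\to\mathbf{Set}$, with $X_n$ the value at $[n]$; isomorphisms are natural isomorphisms. Its structure maps are the images of the following maps in $\Phi$: for $0\le i<n$, $d_i^n:[n]\to[n-1]$ with $k\mapsto k$ for $k\le i$, $k\mapsto k-1$ for $k>i$; $d_n^n:[n]\to[n-1]$ with $k\mapsto k$ for $k<n$, $n\mapsto0$; for $0\le i\le n$, $s_i^n:[n]\to[n+1]$ with $k\mapsto k$ for $k\le i$, $k\mapsto k+1$ for $k>i$; $\theta_i^n:[n]\to[n]$ ($1\le i\le n-1$) the transposition of $i$ and $i+1$; $\tau^n:[n]\to[n]$ with $0\mapsto n$, $k\mapsto k-1$ for $k\ge1$; and $s_{n+1}^n=\tau^{n+1}s_0^n$. The $d_i^n,s_i^n$ ($0\le i\le n$) make $X_\bullet$ a simplicial set. It is *$2$-Segal* if for all $0<i<n$ the maps $(d_{i+1},d_0):X_{n+1}\to X_n\times_{d_0,X_{n-1},d_i}X_n$ and $(d_i,d_{n+1}):X_{n+1}\to X_n\times_{d_n,X_{n-1},d_i}X_n$ are bijections. **Commutative Frobenius pseudomonoids in $\mathbf{Span}$.**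 $\mathbf{Span}$ is the symmetric monoidal bicategory with sets as objects, spans as morphisms (composed by pullback), maps of spans as $2$-morphisms, and cartesian product as monoidal product. Written out explicitly, a pseudomonoid in $\mathbf{Span}$ consists of a set $X$, a multiplication span $X\times X\xleftarrow{(\lambda,\rho)}M\xrightarrow{\pi}X$, a unit span $\mathrm{pt}\leftarrow U\xrightarrow{e}X$, and invertible $2$-morphisms as follows. - Associator: a bijection $a:\{(\alpha,\beta)\in M^2:\pi\alpha=\lambda\beta\}\to\{(\alpha',\beta')\in M^2:\pi\alpha'=\rho\beta'\}$ such that if $a(\alpha,\beta)=(\alpha',\beta')$ then $\lambda\alpha=\lambda\beta'$, $\rho\alpha=\lambda\alpha'$, $\rho\beta=\rho\alpha'$, $\pi\beta=\pi\beta'$. - Unitors: isomorphisms from the composite spans $\mu\circ(\eta\times\mathrm{id})$ and $\mu\circ(\mathrm{id}\times\eta)$ to the identity span. Concretely: $\rho\alpha=\pi\alpha$ whenever $\lambda\alpha=e(u)$, and $(u,\alpha)\mapsto\rho\alpha$ is a bijection $\{(u,\alpha)\in U\times M:\lambda\alpha=e(u)\}\to X$; likewise $\lambda\alpha=\pi\alpha$ whenever $\rho\alpha=e(u)$, and $(\alpha,u)\mapsto\lambda\alpha$ is a bijection $\{(\alpha,u)\in M\times U:\rho\alpha=e(u)\}\to X$. - Pentagon: for all $(\alpha,\beta,\gamma)\in M^3$ with $\pi\alpha=\lambda\beta$ and $\pi\beta=\lambda\gamma$, if $a(\alpha,\beta)=(\alpha',\beta')$, $a(\beta',\gamma)=(\gamma'',\delta)$,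 $a(\alpha',\gamma'')=(\varepsilon,\zeta)$, and $a(\beta,\gamma)=(\tilde\varepsilon,\tilde\beta)$, $a(\alpha,\tilde\beta)=(\tilde\zeta,\tilde\delta)$, then $(\varepsilon,\zeta,\delta)=(\tilde\varepsilon,\tilde\zeta,\tilde\delta)$. - Triangle: if $\rho\alpha=e(u)$ for some $u\in U$, $\pi\alpha=\lambda\beta$, and $a(\alpha,\beta)=(\alpha',\beta')$, then $\beta'=\beta$. A *commutative* structure is a bijection $\sigma:M\to M$ with $\lambda\sigma=\rho$, $\rho\sigma=\lambda$, $\pi\sigma=\pi$, $\sigma^2=\mathrm{id}$, satisfying the hexagon condition: whenever $\pi\alpha=\lambda\beta$, $a(\alpha,\beta)=(\alpha',\beta')$, $a(\alpha',\sigma\beta')=(\alpha'',\beta'')$ and $a(\sigma\alpha,\beta)=(\alpha''',\beta''')$, one has $(\alpha'',\beta'')=(\sigma\alpha''',\beta''')$. A *Frobenius* structure is a counit span $X\xleftarrow{c}E\to\mathrm{pt}$ such that the pairing obtained by composing multiplication with the counit is nondegenerate (exhibits $X$ as its own dual in $\mathbf{Span}$). Concretely, with $B=\{(\alpha,v)\in M\times E:\pi\alpha=c(v)\}$, the maps $B\to X$, $(\alpha,v)\mapsto\lambda\alpha$ and $(\alpha,v)\mapsto\rho\alpha$ are both bijections. A *commutative Frobenius pseudomonoid* is a pseudomonoid equipped with both a commutative structure and a Frobenius structure. An isomorphism of two such consists of bijections $X\to X'$, $M\to M'$, $U\to U'$, $E\to E'$ compatible with $\lambda,\rho,\pi,e,c$,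 the associators and $\sigma$. **The assignment.** To a $2$-Segal cosymmetric set $X_\bullet$ assign $X=X_1$, $M=X_2$ with $\lambda=d_2$, $\rho=d_0$, $\pi=d_1$; $U=X_0$ with $e=s_0^0$; $a(d_3\omega,d_1\omega)=(d_0\omega,d_2\omega)$ for $\omega\in X_3$; $\sigma=\theta_1^2$; $E=X_0$ with $c=s_1^0=\tau^1s_0^0$. "One-to-one correspondence up to isomorphism" means that this is well defined and induces a bijection between isomorphism classes of $2$-Segal cosymmetric sets and isomorphism classes of commutative Frobenius pseudomonoids in $\mathbf{Span}$. *)

theory Defs
  imports "HOL-Library.FuncSet" "HOL-Combinatorics.Transposition"
begin

section \<open>The category of the sets {0, ..., n} and its structure maps\<close>

text \<open>Morphisms from \<open>m\<close> to \<open>n\<close>: all functions, in extensional form so that equal functions on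
  \<open>{..m}\<close> are equal as terms. Composition is \<^const>\<open>compose\<close>.\<close>

definition Phi :: "nat \<Rightarrow> nat \<Rightarrow> (nat \<Rightarrow> nat) set" where
  "Phi m n = {..m} \<rightarrow>\<^sub>E {..n}"

text \<open>Only used for \<open>n \<ge> 1\<close> and \<open>i \<le> n\<close>, as a morphism from \<open>n\<close> to \<open>n - 1\<close>.\<close>

definition face_map :: "nat \<Rightarrow> nat \<Rightarrow> nat \<Rightarrow> nat" where
  "face_map n i = restrict
     (\<lambda>k. if i < n then (if k \<le> i then k else k - 1) else (if k < n then k else 0)) {..n}"

definition cyc_map :: "nat \<Rightarrow> nat \<Rightarrow> nat" where
  "cyc_map n = restrict (\<lambda>k. if k = 0 then n else k - 1) {..n}"

definition degen_map :: "nat \<Rightarrow> nat \<Rightarrow> nat \<Rightarrow> nat" where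
  "degen_map n i = restrict (\<lambda>k. if k \<le> i then k else k + 1) {..n}"

text \<open>The extra degeneracy, with index \<open>n + 1\<close>; \<^const>\<open>degen_map\<close> is only used for \<open>i \<le> n\<close>.\<close>

definition extra_degen_map :: "nat \<Rightarrow> nat \<Rightarrow> nat" where
  "extra_degen_map n = compose {..n} (cyc_map (n + 1)) (degen_map n 0)"

definition transp_map :: "nat \<Rightarrow> nat \<Rightarrow> nat \<Rightarrow> nat" where
  "transp_map n i = restrict (transpose i (i + 1)) {..n}"


section \<open>Cosymmetric sets\<close>

text \<open>The type \<^typ>\<open>'a\<close> is the universe of sets: a set is a subset of it. It has to be infinite for a
  pseudomonoid on finite subsets to come from a cosymmetric set with all levels in \<^typ>\<open>'a\<close>. Source and target are arguments of \<open>act\<close>; values of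
  \<open>act X m n f\<close> for \<open>f\<close> outside \<^term>\<open>Phi m n\<close>, or off \<open>lev X m\<close>, are irrelevant, and the notion of
  isomorphism below ignores them.\<close>

record 'a cosym =
  lev :: "nat \<Rightarrow> 'a set"
  act :: "nat \<Rightarrow> nat \<Rightarrow> (nat \<Rightarrow> nat) \<Rightarrow> 'a \<Rightarrow> 'a"

definition cosymmetric_set :: "'a cosym \<Rightarrow> bool" where
  "cosymmetric_set X \<longleftrightarrow>
     (\<forall>m n. \<forall>f\<in>Phi m n. act X m n f \<in> lev X m \<rightarrow> lev X n) \<and>
     (\<forall>n. \<forall>x\<in>lev X n. act X n n (restrict (\<lambda>k. k) {..n}) x = x) \<and>
     (\<forall>l m n. \<forall>f\<in>Phi l m. \<forall>g\<in>Phi m n. \<forall>x\<in>lev X l.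
        act X l n (compose {..l} g f) x = act X m n g (act X l m f x))"

definition iso_cosym :: "'a cosym \<Rightarrow> 'a cosym \<Rightarrow> bool" where
  "iso_cosym X Y \<longleftrightarrow>
     (\<exists>h. (\<forall>n. bij_betw (h n) (lev X n) (lev Y n)) \<and>
          (\<forall>m n. \<forall>f\<in>Phi m n. \<forall>x\<in>lev X m. h n (act X m n f x) = act Y m n f (h m x)))"

definition dface :: "'a cosym \<Rightarrow> nat \<Rightarrow> nat \<Rightarrow> 'a \<Rightarrow> 'a" where
  "dface X n i = act X n (n - 1) (face_map n i)"

definition sdegen :: "'a cosym \<Rightarrow> nat \<Rightarrow> nat \<Rightarrow> 'a \<Rightarrow> 'a" where
  "sdegen X n i = act X n (n + 1) (if i \<le> n then degen_map n i else extra_degen_map n)"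

definition theta :: "'a cosym \<Rightarrow> nat \<Rightarrow> nat \<Rightarrow> 'a \<Rightarrow> 'a" where
  "theta X n i = act X n n (transp_map n i)"

definition two_segal :: "'a cosym \<Rightarrow> bool" where
  "two_segal X \<longleftrightarrow>
     (\<forall>n i. 0 < i \<and> i < n \<longrightarrow>
        bij_betw (\<lambda>w. (dface X (n + 1) (i + 1) w, dface X (n + 1) 0 w)) (lev X (n + 1))
          {(x, y) \<in> lev X n \<times> lev X n. dface X n 0 x = dface X n i y} \<and>
        bij_betw (\<lambda>w. (dface X (n + 1) i w, dface X (n + 1) (n + 1) w)) (lev X (n + 1))
          {(x, y) \<in> lev X n \<times> lev X n. dface X n n x = dface X n i y})"

definition two_segal_cosyms :: "'a cosym set" where
  "two_segal_cosyms = {X. cosymmetric_set X \<and> two_segal X}"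

definition cosym_iso_rel :: "('a cosym \<times> 'a cosym) set" where
  "cosym_iso_rel = {(X, Y). X \<in> two_segal_cosyms \<and> Y \<in> two_segal_cosyms \<and> iso_cosym X Y}"


section \<open>Commutative Frobenius pseudomonoids in spans of sets\<close>

record 'a span_pseudomonoid =
  Ob :: "'a set"
  Mul :: "'a set"
  Unt :: "'a set"
  lleg :: "'a \<Rightarrow> 'a"
  rleg :: "'a \<Rightarrow> 'a"
  pleg :: "'a \<Rightarrow> 'a"
  uleg :: "'a \<Rightarrow> 'a"
  assoc :: "'a \<times> 'a \<Rightarrow> 'a \<times> 'a"

record 'a cf_pseudomonoid = "'a span_pseudomonoid" +
  braid :: "'a \<Rightarrow> 'a"
  Cou :: "'a set"
  cleg :: "'a \<Rightarrow> 'a"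

definition well_typed_spans :: "('a, 'b) span_pseudomonoid_scheme \<Rightarrow> bool" where
  "well_typed_spans P \<longleftrightarrow>
     lleg P \<in> Mul P \<rightarrow> Ob P \<and> rleg P \<in> Mul P \<rightarrow> Ob P \<and> pleg P \<in> Mul P \<rightarrow> Ob P \<and>
     uleg P \<in> Unt P \<rightarrow> Ob P"

text \<open>The apexes of the two composite spans from the threefold product of \<open>X\<close> to \<open>X\<close>.\<close>

definition left_comps :: "('a, 'b) span_pseudomonoid_scheme \<Rightarrow> ('a \<times> 'a) set" where
  "left_comps P = {(\<alpha>, \<beta>) \<in> Mul P \<times> Mul P. pleg P \<alpha> = lleg P \<beta>}"

definition right_comps :: "('a, 'b) span_pseudomonoid_scheme \<Rightarrow> ('a \<times> 'a) set" where
  "right_comps P = {(\<alpha>, \<beta>) \<in> Mul P \<times> Mul P. pleg P \<alpha> = rleg P \<beta>}"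

definition associator :: "('a, 'b) span_pseudomonoid_scheme \<Rightarrow> bool" where
  "associator P \<longleftrightarrow>
     bij_betw (assoc P) (left_comps P) (right_comps P) \<and>
     (\<forall>\<alpha> \<beta> \<alpha>' \<beta>'. (\<alpha>, \<beta>) \<in> left_comps P \<and> assoc P (\<alpha>, \<beta>) = (\<alpha>', \<beta>') \<longrightarrow>
        lleg P \<alpha> = lleg P \<beta>' \<and> rleg P \<alpha> = lleg P \<alpha>' \<and> rleg P \<beta> = rleg P \<alpha>' \<and> pleg P \<beta> = pleg P \<beta>')"

text \<open>A map of spans into an identity span is determined by either leg, so the unitors are
  properties rather than data.\<close>

definition unitors :: "('a, 'b) span_pseudomonoid_scheme \<Rightarrow> bool" where
  "unitors P \<longleftrightarrow>
     (\<forall>\<alpha>\<in>Mul P. \<forall>u\<in>Unt P. lleg P \<alpha> = uleg P u \<longrightarrow> rleg P \<alpha> = pleg P \<alpha>) \<and>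
     bij_betw (\<lambda>(u, \<alpha>). rleg P \<alpha>) {(u, \<alpha>) \<in> Unt P \<times> Mul P. lleg P \<alpha> = uleg P u} (Ob P) \<and>
     (\<forall>\<alpha>\<in>Mul P. \<forall>u\<in>Unt P. rleg P \<alpha> = uleg P u \<longrightarrow> lleg P \<alpha> = pleg P \<alpha>) \<and>
     bij_betw (\<lambda>(\<alpha>, u). lleg P \<alpha>) {(\<alpha>, u) \<in> Mul P \<times> Unt P. rleg P \<alpha> = uleg P u} (Ob P)"

definition pentagon :: "('a, 'b) span_pseudomonoid_scheme \<Rightarrow> bool" where
  "pentagon P \<longleftrightarrow>
     (\<forall>\<alpha>\<in>Mul P. \<forall>\<beta>\<in>Mul P. \<forall>\<gamma>\<in>Mul P. \<forall>\<alpha>' \<beta>' \<gamma>2 \<delta> \<epsilon> \<zeta> \<epsilon>t \<beta>t \<zeta>t \<delta>t.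
        pleg P \<alpha> = lleg P \<beta> \<and> pleg P \<beta> = lleg P \<gamma> \<and>
        assoc P (\<alpha>, \<beta>) = (\<alpha>', \<beta>') \<and> assoc P (\<beta>', \<gamma>) = (\<gamma>2, \<delta>) \<and> assoc P (\<alpha>', \<gamma>2) = (\<epsilon>, \<zeta>) \<and>
        assoc P (\<beta>, \<gamma>) = (\<epsilon>t, \<beta>t) \<and> assoc P (\<alpha>, \<beta>t) = (\<zeta>t, \<delta>t)
        \<longrightarrow> (\<epsilon>, \<zeta>, \<delta>) = (\<epsilon>t, \<zeta>t, \<delta>t))"

definition triangle :: "('a, 'b) span_pseudomonoid_scheme \<Rightarrow> bool" where
  "triangle P \<longleftrightarrow>
     (\<forall>\<alpha>\<in>Mul P. \<forall>\<beta>\<in>Mul P. \<forall>\<alpha>' \<beta>'.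
        (\<exists>u\<in>Unt P. rleg P \<alpha> = uleg P u) \<and> pleg P \<alpha> = lleg P \<beta> \<and> assoc P (\<alpha>, \<beta>) = (\<alpha>', \<beta>')
        \<longrightarrow> \<beta>' = \<beta>)"

definition pseudomonoid :: "('a, 'b) span_pseudomonoid_scheme \<Rightarrow> bool" where
  "pseudomonoid P \<longleftrightarrow>
     well_typed_spans P \<and> associator P \<and> unitors P \<and> pentagon P \<and> triangle P"

definition commutative_structure :: "('a, 'b) cf_pseudomonoid_scheme \<Rightarrow> bool" where
  "commutative_structure P \<longleftrightarrow>
     bij_betw (braid P) (Mul P) (Mul P) \<and>
     (\<forall>\<alpha>\<in>Mul P. lleg P (braid P \<alpha>) = rleg P \<alpha> \<and> rleg P (braid P \<alpha>) = lleg P \<alpha> \<and>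
        pleg P (braid P \<alpha>) = pleg P \<alpha> \<and> braid P (braid P \<alpha>) = \<alpha>) \<and>
     (\<forall>\<alpha>\<in>Mul P. \<forall>\<beta>\<in>Mul P. \<forall>\<alpha>' \<beta>' \<alpha>2 \<beta>2 \<alpha>3 \<beta>3.
        pleg P \<alpha> = lleg P \<beta> \<and> assoc P (\<alpha>, \<beta>) = (\<alpha>', \<beta>') \<and>
        assoc P (\<alpha>', braid P \<beta>') = (\<alpha>2, \<beta>2) \<and> assoc P (braid P \<alpha>, \<beta>) = (\<alpha>3, \<beta>3)
        \<longrightarrow> (\<alpha>2, \<beta>2) = (braid P \<alpha>3, \<beta>3))"

definition frobenius_structure :: "('a, 'b) cf_pseudomonoid_scheme \<Rightarrow> bool" where
  "frobenius_structure P \<longleftrightarrow>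
     cleg P \<in> Cou P \<rightarrow> Ob P \<and>
     (let B = {(\<alpha>, v) \<in> Mul P \<times> Cou P. pleg P \<alpha> = cleg P v} in
        bij_betw (\<lambda>(\<alpha>, v). lleg P \<alpha>) B (Ob P) \<and> bij_betw (\<lambda>(\<alpha>, v). rleg P \<alpha>) B (Ob P))"

definition comm_frob_pseudomonoids :: "'a cf_pseudomonoid set" where
  "comm_frob_pseudomonoids = {P. pseudomonoid P \<and> commutative_structure P \<and> frobenius_structure P}"

definition iso_cf :: "'a cf_pseudomonoid \<Rightarrow> 'a cf_pseudomonoid \<Rightarrow> bool" where
  "iso_cf P Q \<longleftrightarrow>
     (\<exists>f g h k. bij_betw f (Ob P) (Ob Q) \<and> bij_betw g (Mul P) (Mul Q) \<and>
        bij_betw h (Unt P) (Unt Q) \<and> bij_betw k (Cou P) (Cou Q) \<and>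
        (\<forall>\<alpha>\<in>Mul P. lleg Q (g \<alpha>) = f (lleg P \<alpha>) \<and> rleg Q (g \<alpha>) = f (rleg P \<alpha>) \<and>
           pleg Q (g \<alpha>) = f (pleg P \<alpha>) \<and> braid Q (g \<alpha>) = g (braid P \<alpha>)) \<and>
        (\<forall>u\<in>Unt P. uleg Q (h u) = f (uleg P u)) \<and>
        (\<forall>v\<in>Cou P. cleg Q (k v) = f (cleg P v)) \<and>
        (\<forall>(\<alpha>, \<beta>)\<in>left_comps P. assoc Q (g \<alpha>, g \<beta>) = map_prod g g (assoc P (\<alpha>, \<beta>))))"

definition cf_iso_rel :: "('a cf_pseudomonoid \<times> 'a cf_pseudomonoid) set" where
  "cf_iso_rel =
     {(P, Q). P \<in> comm_frob_pseudomonoids \<and> Q \<in> comm_frob_pseudomonoids \<and> iso_cf P Q}"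


section \<open>The assignment\<close>

text \<open>The associator sends \<open>(d3 w, d1 w)\<close> to \<open>(d0 w, d2 w)\<close>, which determines it because
  \<open>w \<mapsto> (d1 w, d3 w)\<close> is a bijection by the 2-Segal condition; see \<open>assoc_cf_of_cosym\<close>.\<close>

definition cf_of_cosym :: "'a cosym \<Rightarrow> 'a cf_pseudomonoid" where
  "cf_of_cosym X =
     \<lparr> Ob = lev X 1, Mul = lev X 2, Unt = lev X 0,
       lleg = dface X 2 2, rleg = dface X 2 0, pleg = dface X 2 1,
       uleg = sdegen X 0 0,
       assoc = (\<lambda>p. let w = the_inv_into (lev X 3) (\<lambda>w. (dface X 3 3 w, dface X 3 1 w)) p
                    in (dface X 3 0 w, dface X 3 2 w)),
       braid = theta X 2 1, Cou = lev X 0, cleg = sdegen X 0 1 \<rparr>"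

lemma assoc_cf_of_cosym:
  assumes "two_segal X" "w \<in> lev X 3"
  shows "assoc (cf_of_cosym X) (dface X 3 3 w, dface X 3 1 w) = (dface X 3 0 w, dface X 3 2 w)"
proof -
  have "bij_betw (\<lambda>w. (dface X (2 + 1) 1 w, dface X (2 + 1) (2 + 1) w)) (lev X (2 + 1))
          {(x, y) \<in> lev X 2 \<times> lev X 2. dface X 2 2 x = dface X 2 1 y}"
    using assms(1)[unfolded two_segal_def, rule_format, of 1 2] by simp
  then have "inj_on (\<lambda>w. (dface X 3 3 w, dface X 3 1 w)) (lev X 3)"
    by (auto simp: bij_betw_def inj_on_def)
  from the_inv_into_f_f[OF this assms(2)] show ?thesis
    by (simp add: cf_of_cosym_def)
qed

lemma iso_cosym_refl: "iso_cosym X X"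
  unfolding iso_cosym_def by (intro exI[of _ "\<lambda>_ x. x"]) (auto simp: bij_betw_def)

lemma iso_cosym_trans:
  assumes "cosymmetric_set X" "iso_cosym X Y" "iso_cosym Y Z"
  shows "iso_cosym X Z"
proof -
  obtain h where h: "\<And>n. bij_betw (h n) (lev X n) (lev Y n)"
    "\<And>m n f x. f \<in> Phi m n \<Longrightarrow> x \<in> lev X m \<Longrightarrow> h n (act X m n f x) = act Y m n f (h m x)"
    using assms(2) unfolding iso_cosym_def by blast
  obtain k where k: "\<And>n. bij_betw (k n) (lev Y n) (lev Z n)"
    "\<And>m n f x. f \<in> Phi m n \<Longrightarrow> x \<in> lev Y m \<Longrightarrow> k n (act Y m n f x) = act Z m n f (k m x)"
    using assms(3) unfolding iso_cosym_def by blast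
  show ?thesis
    unfolding iso_cosym_def
    by (intro exI[of _ "\<lambda>n. k n \<circ> h n"])
      (auto intro: bij_betw_trans h k simp: h k bij_betwE[OF h(1)])
qed

lemma iso_cosym_sym:
  assumes "cosymmetric_set X" "iso_cosym X Y"
  shows "iso_cosym Y X"
proof -
  obtain h where h: "\<And>n. bij_betw (h n) (lev X n) (lev Y n)"
    "\<And>m n f x. f \<in> Phi m n \<Longrightarrow> x \<in> lev X m \<Longrightarrow> h n (act X m n f x) = act Y m n f (h m x)"
    using assms(2) unfolding iso_cosym_def by blast
  let ?k = "\<lambda>n. inv_into (lev X n) (h n)"
  have "?k n (act Y m n f y) = act X m n f (?k m y)" if f: "f \<in> Phi m n" and y: "y \<in> lev Y m" for m n f y
  proof -
    have x: "?k m y \<in> lev X m" "h m (?k m y) = y"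
      using bij_betwE[OF bij_betw_inv_into[OF h(1)]] y bij_betw_inv_into_right[OF h(1)] by auto
    have "act X m n f (?k m y) \<in> lev X n"
      using assms(1) f x(1) by (auto simp: cosymmetric_set_def)
    then show ?thesis
      using h(2)[OF f x(1)] x(2) bij_betw_inv_into_left[OF h(1)] by metis
  qed
  then show ?thesis
    unfolding iso_cosym_def by (intro exI[of _ ?k]) (auto intro: bij_betw_inv_into h)
qed

lemma equiv_cosym_iso_rel: "equiv two_segal_cosyms cosym_iso_rel"
  by (rule equivI)
    (auto simp: refl_on_def sym_def trans_def cosym_iso_rel_def two_segal_cosyms_def
      intro: iso_cosym_refl iso_cosym_sym iso_cosym_trans)

lemma iso_cf_refl: "iso_cf P P"
  unfolding iso_cf_def
  by (intro exI[of _ "\<lambda>x. x"]) (auto simp: bij_betw_def map_prod_def split: prod.splits)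

lemma iso_cfI:
  assumes "\<And>\<alpha> \<beta>. (\<alpha>, \<beta>) \<in> left_comps P \<Longrightarrow> assoc Q (g \<alpha>, g \<beta>) = map_prod g g (assoc P (\<alpha>, \<beta>))"
    and "\<forall>\<alpha>\<in>Mul P. lleg Q (g \<alpha>) = f (lleg P \<alpha>) \<and> rleg Q (g \<alpha>) = f (rleg P \<alpha>) \<and>
           pleg Q (g \<alpha>) = f (pleg P \<alpha>) \<and> braid Q (g \<alpha>) = g (braid P \<alpha>)"
    and "\<forall>u\<in>Unt P. uleg Q (h u) = f (uleg P u)"
    and "\<forall>v\<in>Cou P. cleg Q (k v) = f (cleg P v)"
    and "bij_betw f (Ob P) (Ob Q)" "bij_betw g (Mul P) (Mul Q)"
        "bij_betw h (Unt P) (Unt Q)" "bij_betw k (Cou P) (Cou Q)"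
  shows "iso_cf P Q"
  unfolding iso_cf_def
  by (rule exI[of _ f], rule exI[of _ g], rule exI[of _ h], rule exI[of _ k])
    (use assms in \<open>simp add: split_beta\<close>)

lemma iso_cf_trans:
  assumes PQ: "iso_cf P Q" and QR: "iso_cf Q R"
  shows "iso_cf P R"
proof -
  obtain f g h k where b: "bij_betw f (Ob P) (Ob Q)" "bij_betw g (Mul P) (Mul Q)"
      "bij_betw h (Unt P) (Unt Q)" "bij_betw k (Cou P) (Cou Q)"
    and l: "\<And>\<alpha>. \<alpha> \<in> Mul P \<Longrightarrow> lleg Q (g \<alpha>) = f (lleg P \<alpha>) \<and> rleg Q (g \<alpha>) = f (rleg P \<alpha>) \<and>
           pleg Q (g \<alpha>) = f (pleg P \<alpha>) \<and> braid Q (g \<alpha>) = g (braid P \<alpha>)"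
      "\<And>u. u \<in> Unt P \<Longrightarrow> uleg Q (h u) = f (uleg P u)"
      "\<And>v. v \<in> Cou P \<Longrightarrow> cleg Q (k v) = f (cleg P v)"
      "\<And>\<alpha> \<beta>. (\<alpha>, \<beta>) \<in> left_comps P \<Longrightarrow> assoc Q (g \<alpha>, g \<beta>) = map_prod g g (assoc P (\<alpha>, \<beta>))"
    using PQ unfolding iso_cf_def by blast
  obtain f' g' h' k' where b': "bij_betw f' (Ob Q) (Ob R)" "bij_betw g' (Mul Q) (Mul R)"
      "bij_betw h' (Unt Q) (Unt R)" "bij_betw k' (Cou Q) (Cou R)"
    and l': "\<And>\<alpha>. \<alpha> \<in> Mul Q \<Longrightarrow> lleg R (g' \<alpha>) = f' (lleg Q \<alpha>) \<and> rleg R (g' \<alpha>) = f' (rleg Q \<alpha>) \<and>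
           pleg R (g' \<alpha>) = f' (pleg Q \<alpha>) \<and> braid R (g' \<alpha>) = g' (braid Q \<alpha>)"
      "\<And>u. u \<in> Unt Q \<Longrightarrow> uleg R (h' u) = f' (uleg Q u)"
      "\<And>v. v \<in> Cou Q \<Longrightarrow> cleg R (k' v) = f' (cleg Q v)"
      "\<And>\<alpha> \<beta>. (\<alpha>, \<beta>) \<in> left_comps Q \<Longrightarrow> assoc R (g' \<alpha>, g' \<beta>) = map_prod g' g' (assoc Q (\<alpha>, \<beta>))"
    using QR unfolding iso_cf_def by blast
  have lc: "(g \<alpha>, g \<beta>) \<in> left_comps Q" if "(\<alpha>, \<beta>) \<in> left_comps P" for \<alpha> \<beta>
    using that l(1) bij_betwE[OF b(2)] by (auto simp: left_comps_def)
  have gM: "g \<alpha> \<in> Mul Q" if "\<alpha> \<in> Mul P" for \<alpha>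
    using that bij_betwE[OF b(2)] by blast
  have hU: "h u \<in> Unt Q" if "u \<in> Unt P" for u
    using that bij_betwE[OF b(3)] by blast
  have kC: "k v \<in> Cou Q" if "v \<in> Cou P" for v
    using that bij_betwE[OF b(4)] by blast
  have "assoc R ((g' \<circ> g) \<alpha>, (g' \<circ> g) \<beta>) = map_prod (g' \<circ> g) (g' \<circ> g) (assoc P (\<alpha>, \<beta>))"
    if "(\<alpha>, \<beta>) \<in> left_comps P" for \<alpha> \<beta>
    using l(4)[OF that] l'(4)[OF lc[OF that]] by (simp add: prod.map_comp)
  moreover have "\<forall>\<alpha>\<in>Mul P. lleg R ((g' \<circ> g) \<alpha>) = (f' \<circ> f) (lleg P \<alpha>) \<and>
      rleg R ((g' \<circ> g) \<alpha>) = (f' \<circ> f) (rleg P \<alpha>) \<and>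
      pleg R ((g' \<circ> g) \<alpha>) = (f' \<circ> f) (pleg P \<alpha>) \<and>
      braid R ((g' \<circ> g) \<alpha>) = (g' \<circ> g) (braid P \<alpha>)"
    using l(1) l'(1) gM by simp
  moreover have "\<forall>u\<in>Unt P. uleg R ((h' \<circ> h) u) = (f' \<circ> f) (uleg P u)"
    using l(2) l'(2) hU by simp
  moreover have "\<forall>v\<in>Cou P. cleg R ((k' \<circ> k) v) = (f' \<circ> f) (cleg P v)"
    using l(3) l'(3) kC by simp
  moreover note b(1)[THEN bij_betw_trans, OF b'(1)] b(2)[THEN bij_betw_trans, OF b'(2)]
    b(3)[THEN bij_betw_trans, OF b'(3)] b(4)[THEN bij_betw_trans, OF b'(4)]
  ultimately show ?thesis
    by (rule iso_cfI)
qed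

lemma iso_cf_sym:
  assumes P: "P \<in> comm_frob_pseudomonoids" and PQ: "iso_cf P Q"
  shows "iso_cf Q P"
proof -
  obtain f g h k where b: "bij_betw f (Ob P) (Ob Q)" "bij_betw g (Mul P) (Mul Q)"
      "bij_betw h (Unt P) (Unt Q)" "bij_betw k (Cou P) (Cou Q)"
    and l: "\<And>\<alpha>. \<alpha> \<in> Mul P \<Longrightarrow> lleg Q (g \<alpha>) = f (lleg P \<alpha>) \<and> rleg Q (g \<alpha>) = f (rleg P \<alpha>) \<and>
           pleg Q (g \<alpha>) = f (pleg P \<alpha>) \<and> braid Q (g \<alpha>) = g (braid P \<alpha>)"
      "\<And>u. u \<in> Unt P \<Longrightarrow> uleg Q (h u) = f (uleg P u)"
      "\<And>v. v \<in> Cou P \<Longrightarrow> cleg Q (k v) = f (cleg P v)"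
      "\<And>\<alpha> \<beta>. (\<alpha>, \<beta>) \<in> left_comps P \<Longrightarrow> assoc Q (g \<alpha>, g \<beta>) = map_prod g g (assoc P (\<alpha>, \<beta>))"
    using PQ unfolding iso_cf_def by blast
  have typd: "\<And>\<alpha>. \<alpha> \<in> Mul P \<Longrightarrow> lleg P \<alpha> \<in> Ob P" "\<And>\<alpha>. \<alpha> \<in> Mul P \<Longrightarrow> rleg P \<alpha> \<in> Ob P"
      "\<And>\<alpha>. \<alpha> \<in> Mul P \<Longrightarrow> pleg P \<alpha> \<in> Ob P" "\<And>\<alpha>. \<alpha> \<in> Mul P \<Longrightarrow> braid P \<alpha> \<in> Mul P"
      "\<And>u. u \<in> Unt P \<Longrightarrow> uleg P u \<in> Ob P" "\<And>v. v \<in> Cou P \<Longrightarrow> cleg P v \<in> Ob P"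
      "\<And>p. p \<in> left_comps P \<Longrightarrow> assoc P p \<in> right_comps P"
    using P unfolding comm_frob_pseudomonoids_def pseudomonoid_def well_typed_spans_def
        associator_def commutative_structure_def frobenius_structure_def mem_Collect_eq
    by (blast dest: bij_betwE)+
  let ?f = "inv_into (Ob P) f" and ?g = "inv_into (Mul P) g"
  let ?h = "inv_into (Unt P) h" and ?k = "inv_into (Cou P) k"
  have inv: "\<And>x. x \<in> Ob P \<Longrightarrow> ?f (f x) = x" "\<And>x. x \<in> Mul P \<Longrightarrow> ?g (g x) = x"
      "\<And>x. x \<in> Unt P \<Longrightarrow> ?h (h x) = x" "\<And>x. x \<in> Cou P \<Longrightarrow> ?k (k x) = x"
    using b by (auto intro: bij_betw_inv_into_left)
  have im: "Mul Q = g ` Mul P" "Unt Q = h ` Unt P" "Cou Q = k ` Cou P"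
    using b by (auto simp: bij_betw_def)
  have fin: "f x = f y \<longleftrightarrow> x = y" if "x \<in> Ob P" "y \<in> Ob P" for x y
    using b(1) that by (auto simp: bij_betw_def inj_on_def)
  have as: "map_prod ?g ?g (assoc Q (g \<alpha>, g \<beta>)) = assoc P (\<alpha>, \<beta>)" if "(\<alpha>, \<beta>) \<in> left_comps P" for \<alpha> \<beta>
    using typd(7)[OF that] l(4)[OF that] by (auto simp: right_comps_def inv)
  have lc: "\<exists>\<alpha>' \<beta>'. (\<alpha>', \<beta>') \<in> left_comps P \<and> \<alpha> = g \<alpha>' \<and> \<beta> = g \<beta>'"
    if q: "(\<alpha>, \<beta>) \<in> left_comps Q" for \<alpha> \<beta>
    proof -
    obtain x y where "x \<in> Mul P" "y \<in> Mul P" "\<alpha> = g x" "\<beta> = g y" "pleg Q \<alpha> = lleg Q \<beta>"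
      using q unfolding left_comps_def im by blast
    then have "(x, y) \<in> left_comps P \<and> \<alpha> = g x \<and> \<beta> = g y"
      using l(1) fin typd by (simp add: left_comps_def)
    then show ?thesis by blast
  qed
  have "assoc P (?g \<alpha>, ?g \<beta>) = map_prod ?g ?g (assoc Q (\<alpha>, \<beta>))"
    if q: "(\<alpha>, \<beta>) \<in> left_comps Q" for \<alpha> \<beta>
  proof -
    obtain \<alpha>' \<beta>' where ab: "(\<alpha>', \<beta>') \<in> left_comps P" "\<alpha> = g \<alpha>'" "\<beta> = g \<beta>'"
      using lc[OF q] by blast
    then have "\<alpha>' \<in> Mul P" "\<beta>' \<in> Mul P" by (auto simp: left_comps_def)
    with as[OF ab(1)] ab show ?thesis by (simp add: inv)
  qed
  moreover have "\<forall>\<alpha>\<in>Mul Q. lleg P (?g \<alpha>) = ?f (lleg Q \<alpha>) \<and> rleg P (?g \<alpha>) = ?f (rleg Q \<alpha>) \<and>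
      pleg P (?g \<alpha>) = ?f (pleg Q \<alpha>) \<and> braid P (?g \<alpha>) = ?g (braid Q \<alpha>)"
    unfolding im by (simp add: l inv typd)
  moreover have "\<forall>u\<in>Unt Q. uleg P (?h u) = ?f (uleg Q u)"
    unfolding im by (simp add: l inv typd)
  moreover have "\<forall>v\<in>Cou Q. cleg P (?k v) = ?f (cleg Q v)"
    unfolding im by (simp add: l inv typd)
  moreover have "bij_betw ?f (Ob Q) (Ob P)" "bij_betw ?g (Mul Q) (Mul P)"
      "bij_betw ?h (Unt Q) (Unt P)" "bij_betw ?k (Cou Q) (Cou P)"
    using b by (simp_all add: bij_betw_inv_into)
  ultimately show ?thesis
    by (rule iso_cfI)
qed

lemma equiv_cf_iso_rel: "equiv comm_frob_pseudomonoids cf_iso_rel"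
  by (rule equivI)
    (auto simp: refl_on_def sym_def trans_def cf_iso_rel_def
      intro: iso_cf_refl iso_cf_sym iso_cf_trans)

end

theory Submission
  imports Defs
begin

text \<open>Call an element of the value of a cosymmetric set at a four-point set a tetrahedron. The 2-Segal
  condition at four points says that a tetrahedron is determined by two of its faces lying over
  disjoint pairs of points, and the other four faces are then given by the associator and the
  braiding. The counit provides an involution of \<open>X\<close> and, through the associator, an operation of
  order three on \<open>M\<close>; with the braiding it generates an action of the symmetric group, hence of the
  full transformation monoid of a three-point set, on \<open>M\<close>. The hexagon and the pentagon then
  make the relation ``is the boundary of a tetrahedron'' invariant under all relabellings.

  The cosymmetric set of a pseudomonoid is the right Kan extension of this data: its value at \<open>S\<close>
  consists of the natural families of elements of \<open>M\<close>, indexed by the maps from \<open>S\<close> to the three-point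
  set, that satisfy the tetrahedron relation for all maps from \<open>S\<close> to the four-point set. Functoriality
  is automatic, and the work lies in the 2-Segal condition. For four points it is the associator, for
  five points the pentagon, and for arbitrary \<open>S\<close> with a distinguished pair the value of the glued family
  at a map is read off from a gluing on five points. Conversely, by induction with the 2-Segal
  condition, every 2-Segal cosymmetric set is the Kan extension of its part in levels at most 3.\<close>

section \<open>Families over the three-point set\<close>

text \<open>A cosymmetric set is covariant, so a face map merges two cyclically adjacent points.
  What makes three values the right target is the pigeonhole principle: a map from four points to
  three merges some pair, so a family on four points amounts to six matching three-point families,
  one for each pair. The associator, read in two cyclic orders, produces all six from two disjoint
  pairs. The same counting explains why five points suffice for every \<open>S\<close>. Once
  \<open>a\<close> and \<open>b\<close> are chosen, a map from \<open>S\<close> to three points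
  factors through at most five points: \<open>a\<close>, \<open>b\<close> and its three fibres on
  the rest. Hence gluing over \<open>S\<close> is a collection of five-point problems, solved by the
  pentagon, without an induction on the size of \<open>S\<close>. The second obstacle is the type.
  The Kan extension consists of functions, while the levels of the cosymmetric set wanted are
  subsets of \<open>'a\<close>. By the 2-Segal condition each level above 2 embeds in the square of
  the preceding level, so an infinite \<open>'a\<close> has room for all of them.\<close>

datatype three = T0 | T1 | T2
datatype four = Q0 | Q1 | Q2 | Q3

fun tri :: "'x \<Rightarrow> 'x \<Rightarrow> 'x \<Rightarrow> three \<Rightarrow> 'x" where
  "tri i j k T0 = i" | "tri i j k T1 = j" | "tri i j k T2 = k"

fun quad :: "'x \<Rightarrow> 'x \<Rightarrow> 'x \<Rightarrow> 'x \<Rightarrow> four \<Rightarrow> 'x" where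
  "quad i j k l Q0 = i" | "quad i j k l Q1 = j" | "quad i j k l Q2 = k" | "quad i j k l Q3 = l"

lemma comp_tri [simp]: "f \<circ> tri i j k = tri (f i) (f j) (f k)"
proof
  show "(f \<circ> tri i j k) s = tri (f i) (f j) (f k) s" for s by (cases s) auto
qed

lemma tri_eta: "tri (f T0) (f T1) (f T2) = f"
proof
  show "tri (f T0) (f T1) (f T2) s = f s" for s by (cases s) auto
qed

lemma tri_id [simp]: "tri T0 T1 T2 = id"
  using tri_eta[of id] by simp

lemma comp_quad: "f (quad i j k l q) = quad (f i) (f j) (f k) (f l) q"
  by (cases q) auto

lemma comp_tri_apply: "f (tri i j k q) = tri (f i) (f j) (f k) q"
  by (cases q) auto

text \<open>Reduces a statement about all values of a four-point family to its six restrictions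
  along a merged pair.\<close>

lemma three_pigeonhole4:
  fixes i :: three
  obtains "i = j" | "i = k" | "i = l" | "j = k" | "j = l" | "k = l"
  by (cases i; cases j; cases k; cases l) auto

text \<open>\<open>M\<close> plays the role of the value at the three-point set and \<open>t\<close> is the action of its self-maps. The
  relation \<open>As \<alpha> \<beta> \<alpha>' \<beta>'\<close> stands for \<open>a(\<alpha>, \<beta>) = (\<alpha>', \<beta>')\<close>, that is, for the existence of a tetrahedron
  with faces \<open>d3 = \<alpha>\<close>, \<open>d1 = \<beta>\<close>, \<open>d0 = \<alpha>'\<close>, \<open>d2 = \<beta>'\<close>. A leg of an element of \<open>M\<close> is represented by the
  degenerate element of \<open>M\<close> that it determines.\<close>

locale seed =
  fixes M :: "'a set" and t :: "(three \<Rightarrow> three) \<Rightarrow> 'a \<Rightarrow> 'a"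
    and As :: "'a \<Rightarrow> 'a \<Rightarrow> 'a \<Rightarrow> 'a \<Rightarrow> bool"
  assumes t_closed: "m \<in> M \<Longrightarrow> t g m \<in> M"
    and t_id: "m \<in> M \<Longrightarrow> t id m = m"
    and t_comp: "m \<in> M \<Longrightarrow> t g (t h m) = t (g \<circ> h) m"
    and As_carrier: "As \<alpha> \<beta> \<alpha>' \<beta>' \<Longrightarrow> \<alpha> \<in> M \<and> \<beta> \<in> M \<and> \<alpha>' \<in> M \<and> \<beta>' \<in> M"
    and As_legs: "As \<alpha> \<beta> \<alpha>' \<beta>' \<Longrightarrow>
      t (tri T0 T1 T1) \<alpha> = t (tri T0 T1 T0) \<beta> \<and> t (tri T0 T1 T0) \<alpha> = t (tri T0 T1 T0) \<beta>' \<and>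
      t (tri T0 T0 T1) \<alpha> = t (tri T0 T1 T0) \<alpha>' \<and> t (tri T0 T0 T1) \<beta> = t (tri T0 T0 T1) \<alpha>' \<and>
      t (tri T0 T1 T1) \<beta> = t (tri T0 T1 T1) \<beta>' \<and> t (tri T0 T1 T1) \<alpha>' = t (tri T0 T0 T1) \<beta>'"
    and As_exists: "\<alpha> \<in> M \<Longrightarrow> \<beta> \<in> M \<Longrightarrow> t (tri T0 T1 T1) \<alpha> = t (tri T0 T1 T0) \<beta> \<Longrightarrow>
      \<exists>\<alpha>' \<beta>'. As \<alpha> \<beta> \<alpha>' \<beta>'"
    and As_unique: "As \<alpha> \<beta> \<alpha>' \<beta>' \<Longrightarrow> As \<alpha> \<beta> \<alpha>2 \<beta>2 \<Longrightarrow> \<alpha>2 = \<alpha>' \<and> \<beta>2 = \<beta>'"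
    and As_rotate: "As \<alpha> \<beta> \<alpha>' \<beta>' \<Longrightarrow>
      As \<alpha>' (t (tri T2 T0 T1) \<beta>') (t (tri T2 T0 T1) \<beta>) (t (tri T2 T0 T1) \<alpha>)"
    and As_reflect: "As \<alpha> \<beta> \<alpha>' \<beta>' \<Longrightarrow>
      As (t (tri T0 T2 T1) \<alpha>') (t (tri T0 T2 T1) \<beta>') (t (tri T0 T2 T1) \<alpha>) (t (tri T0 T2 T1) \<beta>)"
    and As_hexagon: "As \<alpha> \<beta> \<alpha>' \<beta>' \<Longrightarrow> As (t (tri T0 T2 T1) \<alpha>) \<beta> \<gamma> \<delta> \<Longrightarrow>
      As \<alpha>' (t (tri T0 T2 T1) \<beta>') (t (tri T0 T2 T1) \<gamma>) \<delta>"
    and As_unit: "\<beta> \<in> M \<Longrightarrow> As (t (tri T0 T1 T0) \<beta>) \<beta> (t (tri T0 T0 T2) \<beta>) \<beta>"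
    and As_pentagon: "As \<alpha> \<beta> \<alpha>' \<beta>' \<Longrightarrow> As \<beta>' \<gamma> \<gamma>2 \<delta> \<Longrightarrow> As \<alpha>' \<gamma>2 \<epsilon> \<zeta> \<Longrightarrow>
      As \<beta> \<gamma> \<epsilon>t \<beta>t \<Longrightarrow> As \<alpha> \<beta>t \<zeta>t \<delta>t \<Longrightarrow> \<epsilon>t = \<epsilon> \<and> \<zeta>t = \<zeta> \<and> \<delta>t = \<delta>"
begin

text \<open>An element of the value at an \<open>n\<close>-point set is the family of its images under all maps to the
  three-point set, as a curried function of the \<open>n\<close> values of the map. Merging two points is
  identifying two arguments. Of the three ways to order four points cyclically, the hexagon needs the
  associator for two in order to give it for the third.\<close>

definition F3 :: "(three \<Rightarrow> three \<Rightarrow> three \<Rightarrow> 'a) \<Rightarrow> bool" where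
  "F3 \<mu> \<longleftrightarrow> (\<forall>i j k. \<mu> i j k \<in> M) \<and> (\<forall>g i j k. \<mu> (g i) (g j) (g k) = t g (\<mu> i j k))"

definition natural4 :: "(three \<Rightarrow> three \<Rightarrow> three \<Rightarrow> three \<Rightarrow> 'a) \<Rightarrow> bool" where
  "natural4 \<rho> \<longleftrightarrow> (\<forall>i j k l. \<rho> i j k l \<in> M) \<and>
     (\<forall>g i j k l. \<rho> (g i) (g j) (g k) (g l) = t g (\<rho> i j k l))"

definition A4 :: "(three \<Rightarrow> three \<Rightarrow> three \<Rightarrow> three \<Rightarrow> 'a) \<Rightarrow> bool" where
  "A4 \<rho> \<longleftrightarrow> As (\<rho> T0 T1 T2 T0) (\<rho> T0 T1 T1 T2) (\<rho> T0 T0 T1 T2) (\<rho> T0 T1 T2 T2)"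

definition F4 :: "(three \<Rightarrow> three \<Rightarrow> three \<Rightarrow> three \<Rightarrow> 'a) \<Rightarrow> bool" where
  "F4 \<rho> \<longleftrightarrow> natural4 \<rho> \<and> A4 \<rho> \<and> A4 (\<lambda>i j k l. \<rho> i k j l)"

section \<open>Relabelling the points of a tetrahedron\<close>

lemma F3_nat: "F3 \<mu> \<Longrightarrow> t g (\<mu> i j k) = \<mu> (g i) (g j) (g k)"
  by (simp add: F3_def)

lemma F3_in: "F3 \<mu> \<Longrightarrow> \<mu> i j k \<in> M"
  by (simp add: F3_def)

lemma F3_eq: "F3 \<mu> \<Longrightarrow> \<mu> i j k = t (tri i j k) (\<mu> T0 T1 T2)"
  by (simp add: F3_nat)

lemma F3_of: "m \<in> M \<Longrightarrow> F3 (\<lambda>i j k. t (tri i j k) m)"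
  by (simp add: F3_def t_closed t_comp)

lemma F3_ext: "F3 \<mu> \<Longrightarrow> F3 \<nu> \<Longrightarrow> \<mu> T0 T1 T2 = \<nu> T0 T1 T2 \<Longrightarrow> \<mu> i j k = \<nu> i j k"
  using F3_eq[of \<mu> i j k] F3_eq[of \<nu> i j k] by simp

lemma natural4_nat: "natural4 \<rho> \<Longrightarrow> t g (\<rho> i j k l) = \<rho> (g i) (g j) (g k) (g l)"
  by (simp add: natural4_def)

lemma A4_rotate:
  assumes "natural4 \<rho>" "A4 \<rho>"
  shows "A4 (\<lambda>i j k l. \<rho> l i j k)"
  using As_rotate[OF assms(2)[unfolded A4_def]] by (simp add: A4_def natural4_nat[OF assms(1)])

lemma A4_reflect:
  assumes "natural4 \<rho>" "A4 \<rho>"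
  shows "A4 (\<lambda>i j k l. \<rho> i l k j)"
  using As_reflect[OF assms(2)[unfolded A4_def]] by (simp add: A4_def natural4_nat[OF assms(1)])

lemma A4_hexagon:
  assumes "natural4 \<rho>" "A4 \<rho>" "A4 (\<lambda>i j k l. \<rho> i k j l)"
  shows "A4 (\<lambda>i j k l. \<rho> i l j k)"
proof -
  have "As (t (tri T0 T2 T1) (\<rho> T0 T1 T2 T0)) (\<rho> T0 T1 T1 T2) (\<rho> T0 T1 T0 T2) (\<rho> T0 T2 T1 T2)"
    using assms(3) by (simp add: A4_def natural4_nat[OF assms(1)])
  from As_hexagon[OF assms(2)[unfolded A4_def] this] show ?thesis
    by (simp add: A4_def natural4_nat[OF assms(1)])
qed

text \<open>Rotation and reflection generate the dihedral group of order eight, so \<open>A4\<close>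
  depends only on the cyclic order of the points up to reversal. These are the seven nontrivial
  elements.\<close>

lemma A4_dihedral:
  assumes n: "natural4 \<rho>" and "A4 \<rho>"
  shows "A4 (\<lambda>i j k l. \<rho> l i j k)" "A4 (\<lambda>i j k l. \<rho> k l i j)" "A4 (\<lambda>i j k l. \<rho> j k l i)"
    "A4 (\<lambda>i j k l. \<rho> i l k j)" "A4 (\<lambda>i j k l. \<rho> j i l k)" "A4 (\<lambda>i j k l. \<rho> k j i l)"
    "A4 (\<lambda>i j k l. \<rho> l k j i)"
proof -
  have n': "natural4 (\<lambda>i j k l. \<rho> l i j k)" "natural4 (\<lambda>i j k l. \<rho> k l i j)"
    "natural4 (\<lambda>i j k l. \<rho> j k l i)"
    using n by (simp_all add: natural4_def)
  show r1: "A4 (\<lambda>i j k l. \<rho> l i j k)" by (rule A4_rotate[OF assms])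
  show r2: "A4 (\<lambda>i j k l. \<rho> k l i j)" by (rule A4_rotate[OF n'(1) r1])
  show r3: "A4 (\<lambda>i j k l. \<rho> j k l i)" by (rule A4_rotate[OF n'(2) r2])
  show "A4 (\<lambda>i j k l. \<rho> i l k j)" by (rule A4_reflect[OF assms])
  show "A4 (\<lambda>i j k l. \<rho> j i l k)" by (rule A4_reflect[OF n'(1) r1])
  show "A4 (\<lambda>i j k l. \<rho> k j i l)" by (rule A4_reflect[OF n'(2) r2])
  show "A4 (\<lambda>i j k l. \<rho> l k j i)" by (rule A4_reflect[OF n'(3) r3])
qed

text \<open>Three cyclic orders with eight dihedral relabellings each exhaust the 24 permutations of
  four points.\<close>

lemma F4_A4_all:
  assumes "F4 \<rho>" and d: "distinct [p, q, r, s]"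
  shows "A4 (\<lambda>i j k l. \<rho> (quad i j k l p) (quad i j k l q) (quad i j k l r) (quad i j k l s))"
proof -
  have n: "natural4 \<rho>" and a1: "A4 \<rho>" and a2: "A4 (\<lambda>i j k l. \<rho> i k j l)"
    using assms by (auto simp: F4_def)
  have a3: "A4 (\<lambda>i j k l. \<rho> i l j k)" by (rule A4_hexagon[OF n a1 a2])
  have n2: "natural4 (\<lambda>i j k l. \<rho> i k j l)" and n3: "natural4 (\<lambda>i j k l. \<rho> i l j k)"
    using n by (simp_all add: natural4_def)
  note all = A4_dihedral[OF n a1] A4_dihedral[OF n2 a2] A4_dihedral[OF n3 a3] a1 a2 a3
  show ?thesis using d by (cases p; cases q; cases r; cases s; simp) (rule all)+
qed

lemma F4_perm:
  assumes "F4 \<rho>" and d: "distinct [p, q, r, s]"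
  shows "F4 (\<lambda>i j k l. \<rho> (quad i j k l p) (quad i j k l q) (quad i j k l r) (quad i j k l s))"
proof -
  have n: "natural4 \<rho>" using assms by (simp add: F4_def)
  have n': "natural4 (\<lambda>i j k l. \<rho> (quad i j k l p) (quad i j k l q) (quad i j k l r) (quad i j k l s))"
    unfolding natural4_def
  proof (intro conjI allI)
    fix g and i j k l :: three
    show "\<rho> (quad i j k l p) (quad i j k l q) (quad i j k l r) (quad i j k l s) \<in> M"
      using n by (simp add: natural4_def)
    show "\<rho> (quad (g i) (g j) (g k) (g l) p) (quad (g i) (g j) (g k) (g l) q)
        (quad (g i) (g j) (g k) (g l) r) (quad (g i) (g j) (g k) (g l) s) =
      t g (\<rho> (quad i j k l p) (quad i j k l q) (quad i j k l r) (quad i j k l s))"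
      by (simp add: natural4_nat[OF n] comp_quad[of g])
  qed
  \<comment> \<open>Interchanging the middle points in the second half of \<open>F4\<close> is
    itself a permutation of the labels, so that half is another instance of
    \<open>F4_A4_all\<close>.\<close>
  have q: "quad i k j l x = quad i j k l (quad Q0 Q2 Q1 Q3 x)" for i j k l :: three and x
    by (cases x) auto
  have "distinct (map (quad Q0 Q2 Q1 Q3) [p, q, r, s])"
    using d by (cases p; cases q; cases r; cases s; simp)
  then have "distinct [quad Q0 Q2 Q1 Q3 p, quad Q0 Q2 Q1 Q3 q, quad Q0 Q2 Q1 Q3 r, quad Q0 Q2 Q1 Q3 s]"
    by (simp only: list.map)
  from F4_A4_all[OF assms(1) this] show ?thesis
    using F4_A4_all[OF assms] n' by (simp add: F4_def q[symmetric])
qed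

text \<open>A three-point element placed on four points with one point omitted is a degenerate
  tetrahedron. \<open>As_unit\<close> treats the omission of the third point, and rotation carries
  the omitted point to the other places.\<close>

lemma F3_degenerate_A4:
  assumes "F3 \<mu>"
  shows "A4 (\<lambda>i j k l. \<mu> i j l)" "A4 (\<lambda>i j k l. \<mu> i j k)" "A4 (\<lambda>i j k l. \<mu> i k l)"
    "A4 (\<lambda>i j k l. \<mu> j k l)"
proof -
  have r: "A4 (\<lambda>i j k l. \<nu> i j l)" "natural4 (\<lambda>i j k l. \<nu> i j l)" if "F3 \<nu>" for \<nu>
  proof -
    have "\<nu> T0 T1 T2 \<in> M" using that by (simp add: F3_def)
    from As_unit[OF this] show "A4 (\<lambda>i j k l. \<nu> i j l)" by (simp add: A4_def F3_nat[OF that])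
    show "natural4 (\<lambda>i j k l. \<nu> i j l)" using that by (simp add: natural4_def F3_def)
  qed
  have \<mu>: "F3 (\<lambda>i j k. \<mu> j k i)" "F3 (\<lambda>i j k. \<mu> k i j)"
    using assms by (simp_all add: F3_def)
  show "A4 (\<lambda>i j k l. \<mu> i j l)" by (rule r(1)[OF assms])
  show "A4 (\<lambda>i j k l. \<mu> i k l)"
    by (rule A4_dihedral(1)[OF r(2)[OF \<mu>(1)] r(1)[OF \<mu>(1)]])
  show "A4 (\<lambda>i j k l. \<mu> j k l)"
    by (rule A4_dihedral(2)[OF r(2)[OF \<mu>(2)] r(1)[OF \<mu>(2)]])
  show "A4 (\<lambda>i j k l. \<mu> i j k)"
    by (rule A4_dihedral(3)[OF r(2)[OF \<mu>(2)] r(1)[OF \<mu>(2)]])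
qed

text \<open>A map from three points to four misses a point, so it factors through one of the four
  inclusions in \<open>F3_degenerate_A4\<close>.\<close>

lemma F3_degenerate_F4:
  assumes "F3 \<mu>"
  shows "F4 (\<lambda>i j k l. \<mu> (quad i j k l p) (quad i j k l q) (quad i j k l r))"
proof -
  have A: "A4 (\<lambda>i j k l. \<mu> (quad i j k l p) (quad i j k l q) (quad i j k l r))" for p q r
  proof -
    have s: "F3 (\<lambda>i j k. \<mu> (tri i j k a) (tri i j k b) (tri i j k c))" for a b c
      unfolding F3_def
    proof (intro conjI allI)
      fix g and i j k :: three
      show "\<mu> (tri i j k a) (tri i j k b) (tri i j k c) \<in> M"
        by (rule F3_in[OF assms])
      show "\<mu> (tri (g i) (g j) (g k) a) (tri (g i) (g j) (g k) b) (tri (g i) (g j) (g k) c) =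
        t g (\<mu> (tri i j k a) (tri i j k b) (tri i j k c))"
        by (simp add: F3_nat[OF assms] comp_tri_apply[of g])
    qed
    consider "{p, q, r} \<subseteq> {Q0, Q1, Q3}" | "{p, q, r} \<subseteq> {Q0, Q1, Q2}"
      | "{p, q, r} \<subseteq> {Q0, Q2, Q3}" | "{p, q, r} \<subseteq> {Q1, Q2, Q3}"
      by (cases p; cases q; cases r) auto
    then show ?thesis
    proof cases
      case 1
      then obtain a b c where "p = tri Q0 Q1 Q3 a" "q = tri Q0 Q1 Q3 b" "r = tri Q0 Q1 Q3 c"
        using tri.simps[of Q0 Q1 Q3] by (metis empty_iff insert_iff insert_subset)
      moreover have "quad i j k l (tri Q0 Q1 Q3 x) = tri i j l x" for i j k l :: three and x
        by (cases x) auto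
      ultimately show ?thesis using F3_degenerate_A4(1)[OF s[of a b c]] by simp
    next
      case 2
      then obtain a b c where "p = tri Q0 Q1 Q2 a" "q = tri Q0 Q1 Q2 b" "r = tri Q0 Q1 Q2 c"
        using tri.simps[of Q0 Q1 Q2] by (metis empty_iff insert_iff insert_subset)
      moreover have "quad i j k l (tri Q0 Q1 Q2 x) = tri i j k x" for i j k l :: three and x
        by (cases x) auto
      ultimately show ?thesis using F3_degenerate_A4(2)[OF s[of a b c]] by simp
    next
      case 3
      then obtain a b c where "p = tri Q0 Q2 Q3 a" "q = tri Q0 Q2 Q3 b" "r = tri Q0 Q2 Q3 c"
        using tri.simps[of Q0 Q2 Q3] by (metis empty_iff insert_iff insert_subset)
      moreover have "quad i j k l (tri Q0 Q2 Q3 x) = tri i k l x" for i j k l :: three and x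
        by (cases x) auto
      ultimately show ?thesis using F3_degenerate_A4(3)[OF s[of a b c]] by simp
    next
      case 4
      then obtain a b c where "p = tri Q1 Q2 Q3 a" "q = tri Q1 Q2 Q3 b" "r = tri Q1 Q2 Q3 c"
        using tri.simps[of Q1 Q2 Q3] by (metis empty_iff insert_iff insert_subset)
      moreover have "quad i j k l (tri Q1 Q2 Q3 x) = tri j k l x" for i j k l :: three and x
        by (cases x) auto
      ultimately show ?thesis using F3_degenerate_A4(4)[OF s[of a b c]] by simp
    qed
  qed
  have q: "quad i k j l x = quad i j k l (quad Q0 Q2 Q1 Q3 x)" for i j k l :: three and x
    by (cases x) auto
  have "natural4 (\<lambda>i j k l. \<mu> (quad i j k l p) (quad i j k l q) (quad i j k l r))"
    unfolding natural4_def
  proof (intro conjI allI)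
    fix g and i j k l :: three
    show "\<mu> (quad i j k l p) (quad i j k l q) (quad i j k l r) \<in> M"
      by (rule F3_in[OF assms])
    show "\<mu> (quad (g i) (g j) (g k) (g l) p) (quad (g i) (g j) (g k) (g l) q)
        (quad (g i) (g j) (g k) (g l) r) =
      t g (\<mu> (quad i j k l p) (quad i j k l q) (quad i j k l r))"
      by (simp add: F3_nat[OF assms] comp_quad[of g])
  qed
  with A[of p q r] A[of "quad Q0 Q2 Q1 Q3 p" "quad Q0 Q2 Q1 Q3 q" "quad Q0 Q2 Q1 Q3 r"]
  show ?thesis by (simp add: F4_def q[symmetric])
qed

section \<open>Substitution, uniqueness and gluing on four points\<close>

lemma F4_nat: "F4 \<rho> \<Longrightarrow> t g (\<rho> i j k l) = \<rho> (g i) (g j) (g k) (g l)"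
  by (simp add: F4_def natural4_nat)

lemma F4_in: "F4 \<rho> \<Longrightarrow> \<rho> i j k l \<in> M"
  by (simp add: F4_def natural4_def)

lemma F4_F3:
  assumes "F4 \<rho>"
  shows "F3 (\<lambda>i j k. \<rho> i i j k)" "F3 (\<lambda>i j k. \<rho> i j i k)" "F3 (\<lambda>i j k. \<rho> i j k i)"
    "F3 (\<lambda>i j k. \<rho> i j j k)" "F3 (\<lambda>i j k. \<rho> i j k j)" "F3 (\<lambda>i j k. \<rho> i j k k)"
  by (auto simp: F3_def F4_in[OF assms] F4_nat[OF assms])

text \<open>A self-map of the four-point set that is not injective factors through a merged pair,
  hence through a three-point family; an injective one is a permutation.\<close>

lemma F4_subst:
  assumes \<rho>: "F4 \<rho>"
  shows "F4 (\<lambda>i j k l. \<rho> (quad i j k l p) (quad i j k l q) (quad i j k l r) (quad i j k l s))"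
proof -
  note m = F4_F3[OF \<rho>]
  consider "p = q" | "p = r" | "p = s" | "q = r" | "q = s" | "r = s" | "distinct [p, q, r, s]"
    by auto
  then show ?thesis
  proof cases
    case 1 then show ?thesis using F3_degenerate_F4[OF m(1)] by simp
  next
    case 2 then show ?thesis using F3_degenerate_F4[OF m(2)] by simp
  next
    case 3 then show ?thesis using F3_degenerate_F4[OF m(3)] by simp
  next
    case 4 then show ?thesis using F3_degenerate_F4[OF m(4)] by simp
  next
    case 5 then show ?thesis using F3_degenerate_F4[OF m(5)] by simp
  next
    case 6 then show ?thesis using F3_degenerate_F4[OF m(6)] by simp
  next
    case 7 then show ?thesis by (rule F4_perm[OF \<rho>])
  qed
qed

text \<open>Number the points 0, 1, 2, 3. The pairs 30 and 12 are opposite in the cyclic order 0123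
  and also in 0213. The associator for the first order gives the pairs 01 and 23, for the second 02
  and 13, and these are all six pairs.\<close>

lemma F4_unique_cyclic:
  assumes \<rho>: "F4 \<rho>" "F4 \<rho>'"
    and eq: "\<rho> T0 T1 T2 T0 = \<rho>' T0 T1 T2 T0" "\<rho> T0 T1 T1 T2 = \<rho>' T0 T1 T1 T2"
  shows "\<rho> i j k l = \<rho>' i j k l"
proof -
  have A: "A4 \<rho>" "A4 \<rho>'" "A4 (\<lambda>i j k l. \<rho> i k j l)" "A4 (\<lambda>i j k l. \<rho>' i k j l)"
    using \<rho> by (auto simp: F4_def)
  have e1: "\<rho>' T0 T0 T1 T2 = \<rho> T0 T0 T1 T2" "\<rho>' T0 T1 T2 T2 = \<rho> T0 T1 T2 T2"
    using As_unique[OF A(1)[unfolded A4_def] A(2)[unfolded A4_def, folded eq]] by auto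
  have e0: "\<rho> i j k i = \<rho>' i j k i" "\<rho> i j j k = \<rho>' i j j k" for i j k
    using F3_ext[OF F4_F3(3)[OF \<rho>(1)] F4_F3(3)[OF \<rho>(2)] eq(1)]
      F3_ext[OF F4_F3(4)[OF \<rho>(1)] F4_F3(4)[OF \<rho>(2)] eq(2)] by auto
  have e2: "\<rho>' T0 T1 T0 T2 = \<rho> T0 T1 T0 T2" "\<rho>' T0 T2 T1 T2 = \<rho> T0 T2 T1 T2"
    using As_unique[OF A(3)[unfolded A4_def] A(4)[unfolded A4_def, folded e0]] by auto
  have e: "\<rho> i i j k = \<rho>' i i j k" "\<rho> i j k k = \<rho>' i j k k" "\<rho> i j i k = \<rho>' i j i k"
      "\<rho> i j k j = \<rho>' i j k j" for i j k
    using F3_ext[OF F4_F3(1)[OF \<rho>(1)] F4_F3(1)[OF \<rho>(2)] e1(1)[symmetric]]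
      F3_ext[OF F4_F3(6)[OF \<rho>(1)] F4_F3(6)[OF \<rho>(2)] e1(2)[symmetric]]
      F3_ext[OF F4_F3(2)[OF \<rho>(1)] F4_F3(2)[OF \<rho>(2)] e2(1)[symmetric]]
      F4_nat[OF \<rho>(1), of "tri T0 T2 T1" T0 T2 T1 T2] F4_nat[OF \<rho>(2), of "tri T0 T2 T1" T0 T2 T1 T2]
      e2(2) F3_ext[OF F4_F3(5)[OF \<rho>(1)] F4_F3(5)[OF \<rho>(2)]] by auto
  show ?thesis
    by (rule three_pigeonhole4[where i = i and j = j and k = k and l = l]) (use e e0 in auto)
qed

lemma As_legs_nat:
  assumes "As \<alpha> \<beta> \<alpha>' \<beta>'"
  shows "t (tri i j j) \<alpha> = t (tri i j i) \<beta>" "t (tri i j i) \<alpha> = t (tri i j i) \<beta>'"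
    "t (tri i i j) \<alpha> = t (tri i j i) \<alpha>'" "t (tri i i j) \<beta> = t (tri i i j) \<alpha>'"
    "t (tri i j j) \<beta> = t (tri i j j) \<beta>'" "t (tri i j j) \<alpha>' = t (tri i i j) \<beta>'"
proof -
  note c = As_carrier[OF assms]
  have "t (tri i j i) (t f m) = t (tri i j i) (t g n)" if "t f m = t g n" for f g m n
    using that by simp
  from As_legs[OF assms, THEN conjunct1, THEN this]
    As_legs[OF assms, THEN conjunct2, THEN conjunct1, THEN this]
    As_legs[OF assms, THEN conjunct2, THEN conjunct2, THEN conjunct1, THEN this]
    As_legs[OF assms, THEN conjunct2, THEN conjunct2, THEN conjunct2, THEN conjunct1, THEN this]
    As_legs[OF assms, THEN conjunct2, THEN conjunct2, THEN conjunct2, THEN conjunct2, THEN conjunct1, THEN this]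
    As_legs[OF assms, THEN conjunct2, THEN conjunct2, THEN conjunct2, THEN conjunct2, THEN conjunct2, THEN this]
  show "t (tri i j j) \<alpha> = t (tri i j i) \<beta>" "t (tri i j i) \<alpha> = t (tri i j i) \<beta>'"
    "t (tri i i j) \<alpha> = t (tri i j i) \<alpha>'" "t (tri i i j) \<beta> = t (tri i i j) \<alpha>'"
    "t (tri i j j) \<beta> = t (tri i j j) \<beta>'" "t (tri i j j) \<alpha>' = t (tri i i j) \<beta>'"
    using c by (simp_all add: t_comp)
qed

text \<open>The two cyclic orders used for uniqueness also construct the family: \<open>a\<close>
  and \<open>b\<close> become its restrictions to the pairs 01 and 23, and \<open>c\<close> and
  \<open>d\<close> those to 02 and 13.\<close>

lemma F4_glue_cyclic:
  assumes \<alpha>: "F3 \<alpha>" and \<beta>: "F3 \<beta>" and leg: "\<And>i j. \<alpha> i j j = \<beta> i j i"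
  obtains \<rho> where "F4 \<rho>" "\<And>i j k. \<rho> i j k i = \<alpha> i j k" "\<And>i j l. \<rho> i j j l = \<beta> i j l"
proof -
  obtain a b where as1: "As (\<alpha> T0 T1 T2) (\<beta> T0 T1 T2) a b"
    using As_exists[of "\<alpha> T0 T1 T2" "\<beta> T0 T1 T2"] leg[of T0 T1]
    by (auto simp: F3_in[OF \<alpha>] F3_in[OF \<beta>] F3_nat[OF \<alpha>] F3_nat[OF \<beta>])
  obtain c d where as2: "As (\<alpha> T0 T2 T1) (\<beta> T0 T1 T2) c d"
    using As_exists[of "\<alpha> T0 T2 T1" "\<beta> T0 T1 T2"] leg[of T0 T1]
    by (auto simp: F3_in[OF \<alpha>] F3_in[OF \<beta>] F3_nat[OF \<alpha>] F3_nat[OF \<beta>])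
  have M: "a \<in> M" "b \<in> M" "c \<in> M" "d \<in> M"
    using As_carrier[OF as1] As_carrier[OF as2] by auto
  define A where "A i j k = t (tri i j k) a" for i j k
  define B where "B i j k = t (tri i j k) b" for i j k
  define C where "C i j k = t (tri i j k) c" for i j k
  \<comment> \<open>In the order 0213 the element \<open>d\<close> is the value at
    \<open>T0 T2 T1 T2\<close>, which explains the interchange of the last two arguments.\<close>
  define D where "D i j k = t (tri i k j) d" for i j k
  \<comment> \<open>One clause for each pair, the last one being \<open>j = l\<close> by pigeonhole.
    The assumption \<open>leg\<close> and the leg equations \<open>l1\<close>, \<open>l2\<close>
    make the clauses agree where two pairs are merged at once.\<close>
  define \<rho> where "\<rho> i j k l = (if l = i then \<alpha> i j k else if j = k then \<beta> i j l
    else if i = j then A i k l else if k = l then B i j k else if i = k then C i j l else D i j k)"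
    for i j k l
  have l1: "\<alpha> i j i = B i j i" "\<alpha> i i j = A i j i" "\<beta> i i j = A i i j" "\<beta> i j j = B i j j"
     "A i j j = B i i j" for i j
    using As_legs_nat[OF as1, of i j] by (auto simp: A_def B_def F3_nat[OF \<alpha>] F3_nat[OF \<beta>])
  have l2: "\<alpha> i i j = D i i j" "\<alpha> i j i = C i j i" "\<beta> i i j = C i i j" "\<beta> i j j = D i j j"
     "C i j j = D i j i" for i j
    using As_legs_nat[OF as2, of i j] by (auto simp: C_def D_def F3_nat[OF \<alpha>] F3_nat[OF \<beta>])
  have r1: "\<rho> i j k i = \<alpha> i j k" for i j k by (simp add: \<rho>_def)
  have r2: "\<rho> i j j l = \<beta> i j l" for i j l using leg by (simp add: \<rho>_def)
  have r3: "\<rho> i i j k = A i j k" for i j k using l1 by (auto simp: \<rho>_def)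
  have r4: "\<rho> i j k k = B i j k" for i j k using l1 by (auto simp: \<rho>_def)
  have r5: "\<rho> i j i k = C i j k" for i j k using l1 l2 by (auto simp: \<rho>_def)
  have r6: "\<rho> i j k j = D i j k" for i j k using l1 l2 by (auto simp: \<rho>_def)
  have F: "F3 A" "F3 B" "F3 C" "F3 D"
    using M by (auto simp: F3_def A_def B_def C_def D_def t_closed t_comp)
  note r = r1 r2 r3 r4 r5 r6
  have "natural4 \<rho>"
    unfolding natural4_def
  proof (intro conjI allI)
    fix g and i j k l :: three
    show "\<rho> i j k l \<in> M"
      by (rule three_pigeonhole4[where i = i and j = j and k = k and l = l]) (simp_all add: r F3_in[OF \<alpha>] F3_in[OF \<beta>] F[THEN F3_in])
    show "\<rho> (g i) (g j) (g k) (g l) = t g (\<rho> i j k l)"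
      by (rule three_pigeonhole4[where i = i and j = j and k = k and l = l])
        (simp_all add: r F3_nat[OF \<alpha>] F3_nat[OF \<beta>] F[THEN F3_nat])
  qed
  moreover have "A4 \<rho>" using as1 M by (simp add: A4_def r A_def B_def t_id)
  moreover have "A4 (\<lambda>i j k l. \<rho> i k j l)" using as2 M by (simp add: A4_def r C_def D_def t_id)
  ultimately have "F4 \<rho>" by (simp add: F4_def)
  with r1 r2 show ?thesis using that by blast
qed

text \<open>The cyclic version relabelled so that the merged pairs are the first two and the last
  two points; the first two will be the distinguished pair.\<close>

lemma F4_glue:
  assumes \<alpha>: "F3 \<alpha>" and \<mu>: "F3 \<mu>" and leg: "\<And>i k. \<mu> i i k = \<alpha> i k k"
  obtains \<rho> where "F4 \<rho>" "\<And>i k l. \<rho> i i k l = \<alpha> i k l" "\<And>i j k. \<rho> i j k k = \<mu> i j k"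
proof -
  have "F3 (\<lambda>i k j. \<mu> i j k)" using \<mu> by (simp add: F3_def)
  from F4_glue_cyclic[OF \<alpha> this] leg obtain \<rho>
    where r: "F4 \<rho>" "\<And>i j k. \<rho> i j k i = \<alpha> i j k" "\<And>i j l. \<rho> i j j l = \<mu> i l j" by metis
  show ?thesis
    using that[of "\<lambda>i j k l. \<rho> i k l j"] F4_perm[OF r(1), of Q0 Q2 Q3 Q1] r(2,3) by simp
qed

lemma F4_unique:
  assumes \<rho>: "F4 \<rho>" "F4 \<rho>'"
    and eq: "\<And>i k l. \<rho> i i k l = \<rho>' i i k l" "\<And>i j k. \<rho> i j k k = \<rho>' i j k k"
  shows "\<rho> i j k l = \<rho>' i j k l"
  using F4_unique_cyclic[of "\<lambda>i j k l. \<rho> i l j k" "\<lambda>i j k l. \<rho>' i l j k" i k l j]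
    F4_perm[OF \<rho>(1), of Q0 Q3 Q1 Q2] F4_perm[OF \<rho>(2), of Q0 Q3 Q1 Q2] eq by simp

text \<open>The points are \<open>a, b, c, d, e\<close>, and \<open>r\<close>, \<open>G1\<close>, \<open>G2\<close>, \<open>R\<close>, \<open>S\<close> are the elements obtained by merging \<open>ab\<close>,
  \<open>cd\<close>, \<open>de\<close>, \<open>ac\<close>, \<open>be\<close>, respectively. The first three determine \<open>R\<close> and \<open>S\<close>; the pentagon gives the
  remaining compatibilities. A merged point takes the place of its first member, except that the
  arguments of \<open>G2\<close> are \<open>(a, b, de, c)\<close>.\<close>

lemma F4_pentagon:
  assumes r: "F4 r" and G1: "F4 G1" and G2: "F4 G2" and R: "F4 R" and S: "F4 S"
    and G1r: "\<And>i x e. G1 i i x e = r i x x e" and G1G2: "\<And>i j x. G1 i j x x = G2 i j x x"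
    and G2r: "\<And>i x c. G2 i i x c = r i c x x"
    and Rr: "\<And>x d e. R x x d e = r x x d e" and RG2: "\<And>x b y. R x b y y = G2 x b y x"
    and Sr: "\<And>x c d. S x x c d = r x c d x" and SG1: "\<And>a x y. S a x y y = G1 a x y x"
  shows "R i j i k = G1 i j i k" "R i j k j = S i j i k" "G2 i j j k = S i j k j"
proof -
  have p: "F4 (\<lambda>i j k l. G2 i l k j)" "F4 (\<lambda>i j k l. R i l j k)" "F4 (\<lambda>i j k l. G1 i l j k)"
    "F4 (\<lambda>i j k l. S i l j k)"
    using F4_perm[OF G2, of Q0 Q3 Q2 Q1] F4_perm[OF R, of Q0 Q3 Q1 Q2]
      F4_perm[OF G1, of Q0 Q3 Q1 Q2] F4_perm[OF S, of Q0 Q3 Q1 Q2] by simp_all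
  \<comment> \<open>Read the points in the cyclic order a, c, d, e, b. The five pairs of neighbours
    are then exactly the five merged pairs, and each line is one edge of the pentagon.\<close>
  have a: "As (r T0 T1 T2 T0) (r T0 T1 T1 T2) (r T0 T0 T1 T2) (r T0 T1 T2 T2)"
    "As (r T0 T1 T2 T2) (G2 T0 T2 T1 T1) (G2 T0 T2 T1 T0) (G2 T0 T2 T2 T1)"
    "As (r T0 T0 T1 T2) (G2 T0 T2 T1 T0) (R T0 T2 T0 T1) (R T0 T2 T1 T2)"
    "As (r T0 T1 T1 T2) (G2 T0 T2 T1 T1) (G1 T0 T2 T0 T1) (G1 T0 T2 T1 T2)"
    "As (r T0 T1 T2 T0) (G1 T0 T2 T1 T2) (S T0 T2 T0 T1) (S T0 T2 T1 T2)"
    using r p by (simp_all add: F4_def A4_def G1r G2r Rr RG2 Sr SG1 G1G2)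
  note e = As_pentagon[OF a]
  have m: "F3 (\<lambda>i j k. R i j i k)" "F3 (\<lambda>i j k. G1 i j i k)" "F3 (\<lambda>i j k. R i j k j)"
    "F3 (\<lambda>i j k. S i j i k)" "F3 (\<lambda>i j k. G2 i j j k)" "F3 (\<lambda>i j k. S i j k j)"
    using F4_F3[OF R] F4_F3[OF G1] F4_F3[OF S] F4_F3[OF G2] by simp_all
  have x: "F3 \<mu> \<Longrightarrow> F3 \<nu> \<Longrightarrow> \<mu> T0 T2 T1 = \<nu> T0 T2 T1 \<Longrightarrow> \<mu> i j k = \<nu> i j k" for \<mu> \<nu> i j k
    using F3_ext[of "\<lambda>i j k. \<mu> i k j" "\<lambda>i j k. \<nu> i k j" i k j] by (simp add: F3_def)
  show "R i j i k = G1 i j i k" by (rule x[OF m(1,2)]) (use e in simp)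
  show "R i j k j = S i j i k" by (rule x[OF m(3,4)]) (use e in simp)
  show "G2 i j j k = S i j k j" by (rule x[OF m(5,6)]) (use e in simp)
qed

end

section \<open>Gluing on five points\<close>

lemma three_cases_of_distinct:
  fixes i k l n :: three
  assumes "k \<noteq> l" "k \<noteq> n" "l \<noteq> n"
  shows "i = k \<or> i = l \<or> i = n"
  using assms by (cases i; cases k; cases l; cases n) auto

context seed begin

definition F5 :: "(three \<Rightarrow> three \<Rightarrow> three \<Rightarrow> three \<Rightarrow> three \<Rightarrow> 'a) \<Rightarrow> bool" where
  "F5 z \<longleftrightarrow> (\<forall>p q r s u. F4 (\<lambda>i j k l.
     z (quad i j k l p) (quad i j k l q) (quad i j k l r) (quad i j k l s) (quad i j k l u)))"

lemma F3_swap: "F3 \<mu> \<Longrightarrow> F3 (\<lambda>i j k. \<mu> i k j)"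
  by (simp add: F3_def)

lemma F5_F4: "F5 z \<Longrightarrow> F4 (\<lambda>i j k l.
     z (quad i j k l p) (quad i j k l q) (quad i j k l r) (quad i j k l s) (quad i j k l u))"
  unfolding F5_def by blast

text \<open>The points are a, b, c, d, e; in \<open>r\<close> the points a, b are merged, in \<mu>
  the points c, d, e. Of the ten pairs, ab is \<open>r\<close> itself, each pair inside cde is glued
  from \<open>r\<close> and \<mu>, and each of the six cross pairs is glued from \<open>r\<close>
  and one of these. The pentagon shows that the ten families match.\<close>

lemma F5_glue:
  assumes r: "F4 r" and \<mu>: "F3 \<mu>" and leg: "\<And>i k. \<mu> i i k = r i k k k"
  obtains z where "F5 z" "\<And>i k l n. z i i k l n = r i k l n" "\<And>i j k. z i j k k k = \<mu> i j k"
proof -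
  note r3 = F4_F3[OF r]
  obtain Gcd where cd: "F4 Gcd" "\<And>i x e. Gcd i i x e = r i x x e" "\<And>i j x. Gcd i j x x = \<mu> i j x"
    using F4_glue[OF r3(4) \<mu>] leg by metis
  obtain Gce where ce: "F4 Gce" "\<And>i x d. Gce i i x d = r i x d x" "\<And>i j x. Gce i j x x = \<mu> i j x"
    using F4_glue[OF r3(5) \<mu>] leg by metis
  obtain Gde where de: "F4 Gde" "\<And>i x c. Gde i i x c = r i c x x" "\<And>i j x. Gde i j x x = \<mu> i j x"
    using F4_glue[OF r3(6)[THEN F3_swap] \<mu>] leg by metis
  note ac = F4_glue[OF r3(1) F4_F3(3)[OF de(1)]]
  note ad = F4_glue[OF r3(2) F4_F3(3)[OF ce(1)]]
  note ae = F4_glue[OF r3(3) F4_F3(3)[OF cd(1)]]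
  note bc = F4_glue[OF r3(1) F4_F3(5)[OF de(1)]]
  note bd = F4_glue[OF r3(2) F4_F3(5)[OF ce(1)]]
  note be = F4_glue[OF r3(3) F4_F3(5)[OF cd(1)]]
  obtain Rac where ac: "F4 Rac" "\<And>x d e. Rac x x d e = r x x d e" "\<And>x b y. Rac x b y y = Gde x b y x"
    using ac de(2) by metis
  obtain Rad where ad: "F4 Rad" "\<And>x c e. Rad x x c e = r x c x e" "\<And>x b y. Rad x b y y = Gce x b y x"
    using ad ce(2) by metis
  obtain Rae where ae: "F4 Rae" "\<And>x c d. Rae x x c d = r x c d x" "\<And>x b y. Rae x b y y = Gcd x b y x"
    using ae cd(2) by metis
  obtain Sbc where bc: "F4 Sbc" "\<And>x d e. Sbc x x d e = r x x d e" "\<And>a x y. Sbc a x y y = Gde a x y x"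
    using bc de(2) by metis
  obtain Sbd where bd: "F4 Sbd" "\<And>x c e. Sbd x x c e = r x c x e" "\<And>a x y. Sbd a x y y = Gce a x y x"
    using bd ce(2) by metis
  obtain Sbe where be: "F4 Sbe" "\<And>x c d. Sbe x x c d = r x c d x" "\<And>a x y. Sbe a x y y = Gcd a x y x"
    using be cd(2) by metis
  note F4s = r cd(1) ce(1) de(1) ac(1) ad(1) ae(1) bc(1) bd(1) be(1)
  have sw: "F4 (\<lambda>i j k l. \<rho> i j l k)" if "F4 \<rho>" for \<rho>
    using F4_perm[OF that, of Q0 Q1 Q3 Q2] by simp
  have rp: "F4 (\<lambda>i k l n. r i k n l)" "F4 (\<lambda>i k l n. r i l k n)" "F4 (\<lambda>i k l n. r i n k l)"
     "F4 (\<lambda>i k l n. r i l n k)" "F4 (\<lambda>i k l n. r i n l k)"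
    using F4_perm[OF r, of Q0 Q1 Q3 Q2] F4_perm[OF r, of Q0 Q2 Q1 Q3] F4_perm[OF r, of Q0 Q3 Q1 Q2]
      F4_perm[OF r, of Q0 Q2 Q3 Q1] F4_perm[OF r, of Q0 Q3 Q2 Q1] by simp_all
  note eqs = cd(2,3) ce(2,3) de(2,3) ac(2,3) ad(2,3) ae(2,3) bc(2,3) bd(2,3) be(2,3)
  \<comment> \<open>One pentagon for each of the six orders of c, d, e.\<close>
  note p1 = F4_pentagon[OF r cd(1) de(1) ac(1) be(1), unfolded eqs, OF refl refl refl refl refl refl refl]
  note p2 = F4_pentagon[OF rp(1) ce(1) de(1) sw[OF ac(1)] bd(1), unfolded eqs, OF refl refl refl refl refl refl refl]
  note p3 = F4_pentagon[OF rp(2) cd(1) ce(1) ad(1) sw[OF be(1)], unfolded eqs, OF refl refl refl refl refl refl refl]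
  note p4 = F4_pentagon[OF rp(3) de(1) ce(1) sw[OF ad(1)] bc(1), unfolded eqs, OF refl refl refl refl refl refl refl]
  note p5 = F4_pentagon[OF rp(4) ce(1) cd(1) ae(1) sw[OF bd(1)], unfolded eqs, OF refl refl refl refl refl refl refl]
  note p6 = F4_pentagon[OF rp(5) de(1) cd(1) sw[OF ae(1)] sw[OF bc(1)], unfolded eqs, OF refl refl refl refl refl refl refl]
  \<comment> \<open>Oriented as rewrite rules: the families for ac, ad, ae pass to those for bc, bd,
    be or for cd, ce, de, and the families for bc, bd, be pass to those for cd, ce, de.\<close>
  note p = p1(1,2) p2(1,2) p3(1,2) p4(1,2) p5(1,2) p6(1,2)
    p1(3)[symmetric] p2(3)[symmetric] p3(3)[symmetric] p4(3)[symmetric] p5(3)[symmetric] p6(3)[symmetric]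
  \<comment> \<open>Once \<open>k\<close>, \<open>l\<close>, \<open>n\<close> are distinct they
    exhaust the three values, so \<open>i\<close> is one of them and the last clause is
    \<open>i = n\<close>. For the same reason arguments merging bc, bd or be are caught by some
    clause, as checked in \<open>zbc\<close>, \<open>zbd\<close> and \<open>zbe\<close>.\<close>
  define z where "z i j k l n = (if i = j then r i k l n else if k = l then Gcd i j k n
    else if k = n then Gce i j k l else if l = n then Gde i j l k
    else if i = k then Rac i j l n else if i = l then Rad i j k n else Rae i j k l)" for i j k l n
  have zab: "z i i k l n = r i k l n" for i k l n by (simp add: z_def)
  have zcd: "z i j k k n = Gcd i j k n" for i j k n by (simp add: z_def eqs)
  have zce: "z i j k l k = Gce i j k l" for i j k l by (simp add: z_def eqs)
  have zde: "z i j k l l = Gde i j l k" for i j k l by (simp add: z_def eqs)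
  have zac: "z i j i l n = Rac i j l n" for i j l n by (simp add: z_def eqs p)
  have zad: "z i j k i n = Rad i j k n" for i j k n by (simp add: z_def eqs p)
  have zae: "z i j k l i = Rae i j k l" for i j k l by (simp add: z_def eqs p)
  have zbc: "z i j j l n = Sbc i j l n" for i j l n
    using three_cases_of_distinct[of j l n i] by (auto simp add: z_def eqs p)
  have zbd: "z i j k j n = Sbd i j k n" for i j k n
    using three_cases_of_distinct[of k j n i] by (auto simp add: z_def eqs p)
  have zbe: "z i j k l j = Sbe i j k l" for i j k l
    using three_cases_of_distinct[of k l j i] by (auto simp add: z_def eqs p)
  note zs = zab zcd zce zde zac zad zae zbc zbd zbe
  have "F4 (\<lambda>i j k l. z (quad i j k l a) (quad i j k l b) (quad i j k l c) (quad i j k l d) (quad i j k l e))"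
    for a b c d e
  proof -
    consider "a = b" | "a = c" | "a = d" | "a = e" | "b = c" | "b = d" | "b = e" | "c = d" | "c = e" | "d = e"
      by (cases a; cases b; cases c; cases d; cases e) auto
    then show ?thesis
      by cases (simp add: zs F4s F4_subst)+
  qed
  then have "F5 z" by (simp add: F5_def)
  with zab zcd cd(3) show ?thesis using that by metis
qed

text \<open>The assumptions determine the pairs inside cde, these determine ac, ad, ae, and any
  arguments with values in three points merge one of these six pairs.\<close>

lemma F5_unique:
  assumes z: "F5 z" "F5 z'"
    and eq: "\<And>i k l n. z i i k l n = z' i i k l n" "\<And>i j k. z i j k k k = z' i j k k k"
  shows "z i j k l n = z' i j k l n"
proof -
  note F = F5_F4[OF z(1)] F5_F4[OF z(2)]
  have cd: "z i j k k n = z' i j k k n" for i j k n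
    by (rule F4_unique[of "\<lambda>i j k n. z i j k k n" "\<lambda>i j k n. z' i j k k n"])
      (use F[of Q0 Q1 Q2 Q2 Q3] eq in simp_all)
  have ce: "z i j k n k = z' i j k n k" for i j k n
    by (rule F4_unique[of "\<lambda>i j k n. z i j k n k" "\<lambda>i j k n. z' i j k n k"])
      (use F[of Q0 Q1 Q2 Q3 Q2] eq in simp_all)
  have de: "z i j n k k = z' i j n k k" for i j k n
    by (rule F4_unique[of "\<lambda>i j k n. z i j n k k" "\<lambda>i j k n. z' i j n k k"])
      (use F[of Q0 Q1 Q3 Q2 Q2] eq in simp_all)
  have ac: "z i j i k n = z' i j i k n" for i j k n
    by (rule F4_unique[of "\<lambda>i j k n. z i j i k n" "\<lambda>i j k n. z' i j i k n"])
      (use F[of Q0 Q1 Q0 Q2 Q3] eq de in simp_all)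
  have ad: "z i j k i n = z' i j k i n" for i j k n
    by (rule F4_unique[of "\<lambda>i j k n. z i j k i n" "\<lambda>i j k n. z' i j k i n"])
      (use F[of Q0 Q1 Q2 Q0 Q3] eq ce in simp_all)
  have ae: "z i j k n i = z' i j k n i" for i j k n
    by (rule F4_unique[of "\<lambda>i j k n. z i j k n i" "\<lambda>i j k n. z' i j k n i"])
      (use F[of Q0 Q1 Q2 Q3 Q0] eq cd in simp_all)
  have "k = l \<or> k = n \<or> l = n \<or> i = k \<or> i = l \<or> i = n"
    using three_cases_of_distinct by blast
  then show ?thesis
    by (elim disjE) (simp_all add: cd ce de ac ad ae)
qed

text \<open>\<open>N\<close> is a family on the points \<open>a, b, p, q, u, v\<close> whose restrictions to five points are already known
  to be elements. The element \<open>z\<close> below lives on \<open>u, v, a, p\<close> and the merged point \<open>bq\<close>, and is built by a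
  gluing that does not involve the pair \<open>ab\<close>.\<close>

lemma F4_of_F5_family:
  assumes ab: "F5 (\<lambda>i p q u v. N i i p q u v)"
    and pu: "F5 (\<lambda>i j x q v. N i j x q x v)" and pv: "F5 (\<lambda>i j x q u. N i j x q u x)"
    and qu: "F5 (\<lambda>i j p x v. N i j p x x v)" and qv: "F5 (\<lambda>i j p x u. N i j p x u x)"
    and uv: "F5 (\<lambda>i j p q x. N i j p q x x)"
  shows "F4 (\<lambda>p q u v. N p q p q u v)"
proof -
  \<comment> \<open>The arguments of \<open>z\<close> will be u, v, a, p and the merged bq, in this
    order. The gluing prescribes \<open>z\<close> where u and v are merged and where a, p and bq are
    merged.\<close>
  have r: "F4 (\<lambda>x a p b. N a b p b x x)" using F5_F4[OF uv, of Q1 Q3 Q2 Q3 Q0] by simp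
  have "F4 (\<lambda>u v k l. N k k k k u v)" using F5_F4[OF ab, of Q2 Q2 Q2 Q0 Q1] by simp
  from F4_F3(6)[OF this] have \<mu>: "F3 (\<lambda>u v k. N k k k k u v)" by simp
  obtain z where z: "F5 z" and C1: "\<And>x a p b. z x x a p b = N a b p b x x"
    and C0: "\<And>u v k. z u v k k k = N k k k k u v"
    using F5_glue[OF r \<mu>] by metis
  note F = F5_F4[OF z]
  \<comment> \<open>Each further merged pair is compared with \<open>N\<close> through two disjoint
    pairs already settled: a with bq in \<open>C2\<close>, p with u or v in \<open>C3\<close> and
    \<open>C3'\<close>, bq with u or v in \<open>C4\<close> and \<open>C4'\<close>.\<close>
  have C2: "z u v b p b = N b b p b u v" for u v p b
    by (rule F4_unique[of "\<lambda>u v p b. z u v b p b" "\<lambda>u v p b. N b b p b u v" u v p b])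
      (use F[of Q0 Q1 Q3 Q2 Q3] F5_F4[OF ab, of Q3 Q2 Q3 Q0 Q1] C0 C1 in simp_all)
  have C3: "z u v a u b = N a b u b u v" for u v a b
    by (rule F4_unique[of "\<lambda>u v a b. z u v a u b" "\<lambda>u v a b. N a b u b u v" u v a b])
      (use F[of Q0 Q1 Q2 Q0 Q3] F5_F4[OF pu, of Q2 Q3 Q0 Q3 Q1] C1 C2 in simp_all)
  have C3': "z u v a v b = N a b v b u v" for u v a b
    by (rule F4_unique[of "\<lambda>u v a b. z u v a v b" "\<lambda>u v a b. N a b v b u v" u v a b])
      (use F[of Q0 Q1 Q2 Q1 Q3] F5_F4[OF pv, of Q2 Q3 Q1 Q3 Q0] C1 C2 in simp_all)
  have C4: "z b v a p b = N a b p b b v" for v a p b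
    by (rule F4_unique[of "\<lambda>a b p v. z b v a p b" "\<lambda>a b p v. N a b p b b v" a b p v])
      (use F[of Q1 Q3 Q0 Q2 Q1] F5_F4[OF qu, of Q0 Q1 Q2 Q1 Q3] C2 C3' in simp_all)
  have C4': "z u b a p b = N a b p b u b" for u a p b
    by (rule F4_unique[of "\<lambda>a b p u. z u b a p b" "\<lambda>a b p u. N a b p b u b" a b p u])
      (use F[of Q3 Q1 Q0 Q2 Q1] F5_F4[OF qv, of Q0 Q1 Q2 Q1 Q3] C2 C3 in simp_all)
  \<comment> \<open>Here a and p are merged. Four values among three points coincide somewhere, and
    every coincidence is one of the cases above; the claim then passes from \<open>z\<close> to
    \<open>N\<close>.\<close>
  have "z u v p p q = N p q p q u v" for p q u v
    by (rule three_pigeonhole4[where i = p and j = q and k = u and l = v])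
      (auto simp: C0 C1 C2 C3 C3' C4 C4')
  then show ?thesis
    using F[of Q2 Q3 Q0 Q0 Q1] by simp
qed

text \<open>The right Kan extension, at an arbitrary type of points.\<close>

definition Fam :: "(('s \<Rightarrow> three) \<Rightarrow> 'a) set" where
  "Fam = {m. \<forall>q :: 's \<Rightarrow> four. F4 (\<lambda>i j k l. m (\<lambda>s. quad i j k l (q s)))}"

section \<open>Elements at an arbitrary set of points: uniqueness and gluing\<close>

lemma Fam_F4: "m \<in> Fam \<Longrightarrow> F4 (\<lambda>i j k l. m (\<lambda>s. quad i j k l (q s)))"
  by (simp add: Fam_def)

lemma Fam_F3:
  assumes "m \<in> Fam"
  shows "F3 (\<lambda>i j k. m (\<lambda>s. tri i j k (f s)))"
proof -
  have "quad i i j k (tri Q1 Q2 Q3 x) = tri i j k x" for i j k :: three and x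
    by (cases x) auto
  then show ?thesis
    using F4_F3(1)[OF Fam_F4[OF assms, of "\<lambda>s. tri Q1 Q2 Q3 (f s)"]] by simp
qed

lemma Fam_in: "m \<in> Fam \<Longrightarrow> m f \<in> M"
  using F3_in[OF Fam_F3[of m f], of T0 T1 T2] by simp

lemma Fam_nat: "m \<in> Fam \<Longrightarrow> t g (m f) = m (g \<circ> f)"
  using F3_nat[OF Fam_F3[of m f], of g T0 T1 T2] tri_eta[of g] by (simp add: comp_def)

lemma Fam_push:
  assumes "m \<in> Fam"
  shows "(\<lambda>g. m (\<lambda>s. g (F s))) \<in> Fam"
  using Fam_F4[OF assms, of "\<lambda>s. q (F s)" for q] by (simp add: Fam_def)

text \<open>The five points are \<open>a\<close>, \<open>b\<close> and the three fibres of
  \<open>f\<close> on the remaining points.\<close>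

lemma Fam_F5:
  assumes "m \<in> Fam"
  shows "F5 (\<lambda>i j k l n. m (\<lambda>s. if s = a then i else if s = b then j else tri k l n (f s)))"
  unfolding F5_def
proof (intro allI)
  fix p q r s u
  have "(\<lambda>x. quad i j k l (if x = a then p else if x = b then q else tri r s u (f x))) =
    (\<lambda>x. if x = a then quad i j k l p else if x = b then quad i j k l q
       else tri (quad i j k l r) (quad i j k l s) (quad i j k l u) (f x))" for i j k l :: three
    by (auto simp: comp_tri_apply[of "quad i j k l"])
  then show "F4 (\<lambda>i j k l. m (\<lambda>x. if x = a then quad i j k l p else if x = b then quad i j k l q
       else tri (quad i j k l r) (quad i j k l s) (quad i j k l u) (f x)))"
    using Fam_F4[OF assms, of "\<lambda>x. if x = a then p else if x = b then q else tri r s u (f x)"] by simp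
qed

lemma F5_subst_tri:
  assumes "F5 z"
  shows "F5 (\<lambda>i j k l n. z i j (tri k l n c) (tri k l n d) (tri k l n e))"
  unfolding F5_def
proof (intro allI)
  fix p q r s u
  show "F4 (\<lambda>i j k l. z (quad i j k l p) (quad i j k l q)
      (tri (quad i j k l r) (quad i j k l s) (quad i j k l u) c)
      (tri (quad i j k l r) (quad i j k l s) (quad i j k l u) d)
      (tri (quad i j k l r) (quad i j k l s) (quad i j k l u) e))"
    using F5_F4[OF assms, of p q "tri r s u c" "tri r s u d" "tri r s u e"]
    by (simp add: comp_tri_apply[of "quad _ _ _ _"])
qed

lemma tri_const [simp]: "tri k k k x = k"
  by (cases x) auto

text \<open>Each map factors through \<open>a\<close>, \<open>b\<close> and its three fibres
  elsewhere, so this is uniqueness on five points. Merging the last three of them leaves the maps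
  that are constant away from \<open>a\<close> and \<open>b\<close>.\<close>

lemma Fam_unique:
  assumes m: "m \<in> Fam" "m' \<in> Fam" and "a \<noteq> b"
    and eq1: "\<And>f. f a = f b \<Longrightarrow> m f = m' f"
    and eq2: "\<And>i j k. m (\<lambda>s. if s = a then i else if s = b then j else k) =
      m' (\<lambda>s. if s = a then i else if s = b then j else k)"
  shows "m = m'"
proof
  fix f
  have f: "f = (\<lambda>s. if s = a then f a else if s = b then f b else tri T0 T1 T2 (f s))"
    by auto
  have "m (\<lambda>s. if s = a then i else if s = b then j else tri k l n (f s)) =
      m' (\<lambda>s. if s = a then i else if s = b then j else tri k l n (f s))" for i j k l n
    by (rule F5_unique[OF Fam_F5[OF m(1)] Fam_F5[OF m(2)]]) (use eq1 eq2 in \<open>auto cong: if_cong\<close>)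
  from this[of "f a" "f b" T0 T1 T2] f show "m f = m' f"
    by simp
qed

text \<open>The four labels can be permuted freely by \<open>F4_subst\<close>, so a map separating
  \<open>a\<close> and \<open>b\<close> may be normalized.\<close>

lemma F4_permuted_family:
  fixes m :: "('s \<Rightarrow> three) \<Rightarrow> 'a"
  assumes "q a \<noteq> q b"
    and *: "\<And>q'. q' a = Q0 \<Longrightarrow> q' b = Q1 \<Longrightarrow> F4 (\<lambda>i j k l. m (\<lambda>s. quad i j k l (q' s)))"
  shows "F4 (\<lambda>i j k l. m (\<lambda>s. quad i j k l (q s)))"
proof -
  obtain c d where d: "distinct [q a, q b, c, d]" and c: "\<forall>x. x \<in> {q a, q b, c, d}"
  proof -
    have "\<exists>c d. distinct [x, y, c, d] \<and> (\<forall>z. z \<in> {x, y, c, d})" if "x \<noteq> y" for x y :: four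
    proof -
      have u: "(\<forall>z. z \<in> A) \<longleftrightarrow> Q0 \<in> A \<and> Q1 \<in> A \<and> Q2 \<in> A \<and> Q3 \<in> A" for A
        by (metis four.exhaust)
      show ?thesis unfolding u using that by (cases x; cases y; auto)
    qed
    with assms(1) show ?thesis using that by blast
  qed
  have "\<forall>s. \<exists>x. quad (q a) (q b) c d x = q s"
    using c quad.simps[of "q a" "q b" c d] by (metis empty_iff insert_iff)
  then obtain q' where q': "\<And>s. quad (q a) (q b) c d (q' s) = q s"
    by metis
  have ends: "q' a = Q0" "q' b = Q1"
    using q'[of a] q'[of b] d by (cases "q' a"; cases "q' b"; auto)+
  from F4_subst[OF *[OF this], of "q a" "q b" c d] show ?thesis
    by (simp add: comp_quad[of "quad _ _ _ _", symmetric] q')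
qed

text \<open>This is the extension result behind the 2-Segal condition. Each \<open>f\<close> poses a
  five-point gluing problem; uniqueness makes the solutions compatible, and
  \<open>F4_of_F5_family\<close> gives the tetrahedron relation for maps to four points that
  separate \<open>a\<close> and \<open>b\<close>.\<close>

lemma Fam_glue:
  assumes ab: "a \<noteq> b" and r: "r \<in> Fam" and \<mu>: "F3 \<mu>"
    and leg: "\<And>i k. \<mu> i i k = r (\<lambda>s. if s = a then i else if s = b then i else k)"
  obtains m where "m \<in> Fam" "\<And>f. f a = f b \<Longrightarrow> m f = r f"
    "\<And>i j k. m (\<lambda>s. if s = a then i else if s = b then j else k) = \<mu> i j k"
proof -
  define P where "P f z \<longleftrightarrow> F5 z \<and>
      (\<forall>i k l n. z i i k l n = r (\<lambda>s. if s = a then i else if s = b then i else tri k l n (f s))) \<and>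
      (\<forall>i j k. z i j k k k = \<mu> i j k)" for f :: "'b \<Rightarrow> three" and z
  have "\<exists>z. P f z" for f
  proof -
    have "F4 (\<lambda>i k l n. r (\<lambda>s. if s = a then i else if s = b then i else tri k l n (f s)))"
      using F5_F4[OF Fam_F5[OF r, of a b f], of Q0 Q0 Q1 Q2 Q3] by (simp cong: if_cong)
    then show ?thesis
    proof (rule F5_glue[OF _ \<mu>])
      show "\<mu> i i k = r (\<lambda>s. if s = a then i else if s = b then i else tri k k k (f s))" for i k
        using leg by (simp cong: if_cong)
      show "\<exists>z. P f z" if "F5 z" "\<And>i j k. z i j k k k = \<mu> i j k"
        "\<And>i k l n. z i i k l n = r (\<lambda>s. if s = a then i else if s = b then i else tri k l n (f s))" for z
        using that unfolding P_def by blast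
    qed
  qed
  then obtain Z where "\<And>f. P f (Z f)" by metis
  then have Z: "F5 (Z f)"
    "Z f i i k l n = r (\<lambda>s. if s = a then i else if s = b then i else tri k l n (f s))"
    "Z f i j k k k = \<mu> i j k" for f i j k l n
    by (auto simp: P_def)
  \<comment> \<open>The map \<open>f\<close> factors through its own five points, with the fibres
    labelled by their values.\<close>
  define m where "m f = Z f (f a) (f b) T0 T1 T2" for f
  \<comment> \<open>The solutions for \<open>f\<close> and for a map factoring through the five
    points of \<open>f\<close> solve the same gluing problem, so they agree.\<close>
  have mZ: "m (\<lambda>s. if s = a then i else if s = b then j else tri k l n (f s)) = Z f i j k l n"
    for f i j k l n
  proof -
    let ?f = "\<lambda>s. if s = a then i else if s = b then j else tri k l n (f s)"
    have "Z ?f i' j' k' l' n' = Z f i' j' (tri k' l' n' k) (tri k' l' n' l) (tri k' l' n' n)"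
      for i' j' k' l' n'
    proof (rule F5_unique[OF Z(1) F5_subst_tri[OF Z(1)]])
      fix i' k' l' n' :: three
      have "(\<lambda>s. if s = a then i' else if s = b then i' else tri k' l' n' (?f s)) =
         (\<lambda>s. if s = a then i' else if s = b then i'
            else tri (tri k' l' n' k) (tri k' l' n' l) (tri k' l' n' n) (f s))"
        by (auto simp: comp_tri_apply[of "tri k' l' n'"])
      then show "Z ?f i' i' k' l' n' =
          Z f i' i' (tri k' l' n' k) (tri k' l' n' l) (tri k' l' n' n)"
        by (simp only: Z(2))
    qed (simp add: Z(3))
    from this[of i j T0 T1 T2] ab show ?thesis
      by (simp add: m_def)
  qed
  have mr: "m f = r f" if "f a = f b" for f
  proof -
    have "(\<lambda>s. if s = a then f b else if s = b then f b else f s) = f" using that by auto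
    then show ?thesis using that by (simp add: m_def Z(2) cong: if_cong)
  qed
  have F4: "F4 (\<lambda>i j k l. m (\<lambda>s. quad i j k l (q s)))" for q
  proof (cases "q a = q b")
    case True
    then show ?thesis using Fam_F4[OF r, of q] by (simp add: mr)
  next
    case False
    then show ?thesis
    proof (rule F4_permuted_family)
      fix q' assume q': "q' a = Q0" "q' b = Q1"
      define N where "N i j p q u v =
        m (\<lambda>s. if s = a then i else if s = b then j else quad p q u v (q' s))" for i j p q u v
      have tq: "tri k l n (quad c d e f x) = quad (tri k l n c) (tri k l n d) (tri k l n e) (tri k l n f) x"
        for k l n :: three and c d e f x by (cases x) auto
      \<comment> \<open>In these five hypotheses two of the four fibres of \<open>q'\<close> are
        merged, so three remain and \<open>mZ\<close> applies. The sixth merges \<open>a\<close> and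
        \<open>b\<close> and is therefore about \<open>r\<close>.\<close>
      have "F5 (\<lambda>i j x q v. N i j x q x v)" "F5 (\<lambda>i j x q u. N i j x q u x)"
        "F5 (\<lambda>i j p x v. N i j p x x v)" "F5 (\<lambda>i j p x u. N i j p x u x)"
        "F5 (\<lambda>i j p q x. N i j p q x x)"
        using mZ[of _ _ _ _ _ "\<lambda>s. quad T0 T1 T0 T2 (q' s)"]
          mZ[of _ _ _ _ _ "\<lambda>s. quad T0 T1 T2 T0 (q' s)"]
          mZ[of _ _ _ _ _ "\<lambda>s. quad T0 T1 T1 T2 (q' s)"]
          mZ[of _ _ _ _ _ "\<lambda>s. quad T0 T1 T2 T1 (q' s)"]
          mZ[of _ _ _ _ _ "\<lambda>s. quad T0 T1 T2 T2 (q' s)"] Z(1)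
        by (simp_all add: N_def tq cong: if_cong)
      moreover have "F5 (\<lambda>i p q u v. N i i p q u v)"
        unfolding F5_def
      proof (intro allI)
        fix P Q R S U :: four
        let ?q = "\<lambda>s. if s = a \<or> s = b then P else quad Q R S U (q' s)"
        have "(\<lambda>s. quad i j k l (?q s)) = (\<lambda>s. if s = a then quad i j k l P
           else if s = b then quad i j k l P else quad (quad i j k l Q) (quad i j k l R)
             (quad i j k l S) (quad i j k l U) (q' s))" for i j k l :: three
          by (auto simp: comp_quad[of "quad i j k l"])
        then show "F4 (\<lambda>i j k l. N (quad i j k l P) (quad i j k l P) (quad i j k l Q)
            (quad i j k l R) (quad i j k l S) (quad i j k l U))"
          using Fam_F4[OF r, of ?q] by (simp add: N_def mr)
      qed
      ultimately have "F4 (\<lambda>p q u v. N p q p q u v)" by (intro F4_of_F5_family)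
      moreover have "N i j i j k l = m (\<lambda>s. quad i j k l (q' s))" for i j k l
        unfolding N_def by (rule arg_cong[of _ _ m]) (auto simp: q')
      ultimately show "F4 (\<lambda>i j k l. m (\<lambda>s. quad i j k l (q' s)))" by simp
    qed
  qed
  have "m \<in> Fam" using F4 by (simp add: Fam_def)
  moreover have "m (\<lambda>s. if s = a then i else if s = b then j else k) = \<mu> i j k" for i j k
    using mZ[of i j k k k] by (simp add: Z(3) cong: if_cong)
  ultimately show ?thesis using mr that by blast
qed

end

section \<open>From pseudomonoids to seeds\<close>

locale cf_pseudomonoid =
  fixes P :: "'a cf_pseudomonoid"
  assumes P: "P \<in> comm_frob_pseudomonoids"
begin

abbreviation "M \<equiv> Mul P"
abbreviation "X \<equiv> Ob P"
abbreviation "lam \<equiv> lleg P"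
abbreviation "rho \<equiv> rleg P"
abbreviation "prd \<equiv> pleg P"
abbreviation "\<sigma> \<equiv> braid P"

lemma cf_facts: "well_typed_spans P" "associator P" "unitors P" "pentagon P" "triangle P"
    "commutative_structure P" "frobenius_structure P"
  using P by (simp_all add: comm_frob_pseudomonoids_def pseudomonoid_def)

lemma leg_in: "m \<in> M \<Longrightarrow> lam m \<in> X" "m \<in> M \<Longrightarrow> rho m \<in> X" "m \<in> M \<Longrightarrow> prd m \<in> X"
    "u \<in> Unt P \<Longrightarrow> uleg P u \<in> X" "v \<in> Cou P \<Longrightarrow> cleg P v \<in> X"
  using cf_facts(1) cf_facts(7)[unfolded frobenius_structure_def, THEN conjunct1]
  by (auto simp: well_typed_spans_def)

lemma braid_in: "m \<in> M \<Longrightarrow> \<sigma> m \<in> M"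
  using cf_facts(6)[unfolded commutative_structure_def, THEN conjunct1] by (rule bij_betwE[rule_format])

lemma braid [simp]: "m \<in> M \<Longrightarrow> lam (\<sigma> m) = rho m" "m \<in> M \<Longrightarrow> rho (\<sigma> m) = lam m"
    "m \<in> M \<Longrightarrow> prd (\<sigma> m) = prd m" "m \<in> M \<Longrightarrow> \<sigma> (\<sigma> m) = m"
  using cf_facts(6)[unfolded commutative_structure_def, THEN conjunct2, THEN conjunct1] by simp_all

lemma unit_legs: "m \<in> M \<Longrightarrow> u \<in> Unt P \<Longrightarrow> lam m = uleg P u \<Longrightarrow> prd m = rho m"
  using cf_facts(3)[unfolded unitors_def, THEN conjunct1] by metis

lemma lunit_ex1: "x \<in> X \<Longrightarrow> \<exists>!m. m \<in> M \<and> lam m \<in> uleg P ` Unt P \<and> rho m = x"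
proof -
  assume x: "x \<in> X"
  have b: "bij_betw (\<lambda>(u, m). rho m) {(u, m) \<in> Unt P \<times> M. lam m = uleg P u} X"
    using cf_facts(3) by (simp add: unitors_def)
  have "x \<in> (\<lambda>(u, m). rho m) ` {(u, m) \<in> Unt P \<times> M. lam m = uleg P u}"
    using bij_betw_imp_surj_on[OF b] x by simp
  then have "\<exists>m. m \<in> M \<and> lam m \<in> uleg P ` Unt P \<and> rho m = x" by auto
  moreover have "m = m'" if mm: "m \<in> M \<and> lam m \<in> uleg P ` Unt P \<and> rho m = x"
    "m' \<in> M \<and> lam m' \<in> uleg P ` Unt P \<and> rho m' = x" for m m'
  proof -
    obtain u u' where u: "(u, m) \<in> {(u, m) \<in> Unt P \<times> M. lam m = uleg P u}"
      "(u', m') \<in> {(u, m) \<in> Unt P \<times> M. lam m = uleg P u}" using mm by auto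
    have "(\<lambda>(u, m). rho m) (u, m) = (\<lambda>(u, m). rho m) (u', m')" using that by simp
    then show ?thesis using inj_onD[OF bij_betw_imp_inj_on[OF b] _ u] by simp
  qed
  ultimately show ?thesis by blast
qed

lemma pairing_ex1: "x \<in> X \<Longrightarrow> \<exists>!m. m \<in> M \<and> prd m \<in> cleg P ` Cou P \<and> lam m = x"
proof -
  assume x: "x \<in> X"
  have b: "bij_betw (\<lambda>(m, v). lam m) {(m, v) \<in> M \<times> Cou P. prd m = cleg P v} X"
    using cf_facts(7) by (simp add: frobenius_structure_def Let_def)
  have "x \<in> (\<lambda>(m, v). lam m) ` {(m, v) \<in> M \<times> Cou P. prd m = cleg P v}"
    using bij_betw_imp_surj_on[OF b] x by simp
  then have "\<exists>m. m \<in> M \<and> prd m \<in> cleg P ` Cou P \<and> lam m = x" by auto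
  moreover have "m = m'" if mm: "m \<in> M \<and> prd m \<in> cleg P ` Cou P \<and> lam m = x"
    "m' \<in> M \<and> prd m' \<in> cleg P ` Cou P \<and> lam m' = x" for m m'
  proof -
    obtain v v' where v: "(m, v) \<in> {(m, v) \<in> M \<times> Cou P. prd m = cleg P v}"
      "(m', v') \<in> {(m, v) \<in> M \<times> Cou P. prd m = cleg P v}" using mm by auto
    have "(\<lambda>(m, v). lam m) (m, v) = (\<lambda>(m, v). lam m) (m', v')" using that by simp
    then show ?thesis using inj_onD[OF bij_betw_imp_inj_on[OF b] _ v] by simp
  qed
  ultimately show ?thesis by blast
qed

definition lunit :: "'a \<Rightarrow> 'a" where
  "lunit x = (THE m. m \<in> M \<and> lam m \<in> uleg P ` Unt P \<and> rho m = x)"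
definition runit :: "'a \<Rightarrow> 'a" where "runit x = \<sigma> (lunit x)"
text \<open>The unit belonging to \<open>x\<close>. In a cosymmetric set this is the action of the
  constant map with value 0 on two points.\<close>

definition eps :: "'a \<Rightarrow> 'a" where "eps x = lam (lunit x)"
definition bet :: "'a \<Rightarrow> 'a" where
  "bet x = (THE m. m \<in> M \<and> prd m \<in> cleg P ` Cou P \<and> lam m = x)"
text \<open>The partner of \<open>x\<close> under the pairing. In a cosymmetric set this is the
  interchange of the two points.\<close>

definition tau :: "'a \<Rightarrow> 'a" where "tau x = rho (bet x)"
text \<open>Associating \<open>m\<close> with the pairing at its product rotates the legs:
  \<open>lam\<close>, \<open>rho\<close>, \<open>prd\<close> of the result are the old
  \<open>rho\<close>, \<open>tau\<close> of \<open>prd\<close> and \<open>tau\<close> of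
  \<open>lam\<close>. In a cosymmetric set it is the action of 0, 1, 2 going to 2, 0, 1.\<close>

definition kap :: "'a \<Rightarrow> 'a" where "kap m = fst (assoc P (m, bet (prd m)))"
definition As :: "'a \<Rightarrow> 'a \<Rightarrow> 'a \<Rightarrow> 'a \<Rightarrow> bool" where
  "As \<alpha> \<beta> \<alpha>' \<beta>' \<longleftrightarrow> \<alpha> \<in> M \<and> \<beta> \<in> M \<and> prd \<alpha> = lam \<beta> \<and> assoc P (\<alpha>, \<beta>) = (\<alpha>', \<beta>')"

section \<open>Units, the involution of the pairing and the rotation of order three\<close>

lemma lunit0: "x \<in> X \<Longrightarrow> lunit x \<in> M \<and> lam (lunit x) \<in> uleg P ` Unt P \<and> rho (lunit x) = x"
  unfolding lunit_def by (rule theI'[OF lunit_ex1])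

lemma lunit_eqI: "m \<in> M \<Longrightarrow> lam m \<in> uleg P ` Unt P \<Longrightarrow> m = lunit (rho m)"
  using lunit_ex1[of "rho m"] lunit0[of "rho m"] leg_in by blast

lemma runit_eqI: "m \<in> M \<Longrightarrow> rho m \<in> uleg P ` Unt P \<Longrightarrow> m = runit (lam m)"
  using lunit_eqI[of "\<sigma> m"] braid[of m] braid_in[of m] by (simp add: runit_def flip: lunit_eqI)

lemma bet0: "x \<in> X \<Longrightarrow> bet x \<in> M \<and> prd (bet x) \<in> cleg P ` Cou P \<and> lam (bet x) = x"
  unfolding bet_def by (rule theI'[OF pairing_ex1])

lemma bet_eqI: "m \<in> M \<Longrightarrow> prd m \<in> cleg P ` Cou P \<Longrightarrow> m = bet (lam m)"
  using pairing_ex1[of "lam m"] bet0[of "lam m"] leg_in by blast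

lemma eps_in_unit: "x \<in> X \<Longrightarrow> eps x \<in> uleg P ` Unt P"
  using lunit0 by (simp add: eps_def)

lemma in_X [simp]: "x \<in> X \<Longrightarrow> eps x \<in> X" "x \<in> X \<Longrightarrow> tau x \<in> X"
  "m \<in> M \<Longrightarrow> lam m \<in> X" "m \<in> M \<Longrightarrow> rho m \<in> X" "m \<in> M \<Longrightarrow> prd m \<in> X"
  using lunit0 bet0 leg_in by (auto simp: eps_def tau_def)

lemma in_M [simp]: "x \<in> X \<Longrightarrow> lunit x \<in> M" "x \<in> X \<Longrightarrow> runit x \<in> M" "x \<in> X \<Longrightarrow> bet x \<in> M"
  "m \<in> M \<Longrightarrow> \<sigma> m \<in> M"
  using lunit0 bet0 braid_in by (auto simp: runit_def)

lemma lunit_legs [simp]: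
  "x \<in> X \<Longrightarrow> lam (lunit x) = eps x" "x \<in> X \<Longrightarrow> rho (lunit x) = x" "x \<in> X \<Longrightarrow> prd (lunit x) = x"
  using lunit0 unit_legs[of "lunit x"] by (auto simp: eps_def)

lemma runit_legs [simp]:
  "x \<in> X \<Longrightarrow> lam (runit x) = x" "x \<in> X \<Longrightarrow> rho (runit x) = eps x" "x \<in> X \<Longrightarrow> prd (runit x) = x"
  by (simp_all add: runit_def)

lemma assoc_in:
  assumes "As \<alpha> \<beta> \<alpha>' \<beta>'"
  shows "\<alpha> \<in> M \<and> \<beta> \<in> M \<and> \<alpha>' \<in> M \<and> \<beta>' \<in> M"
proof -
  have "(\<alpha>, \<beta>) \<in> left_comps P" using assms by (simp add: As_def left_comps_def)
  with cf_facts(2) have "assoc P (\<alpha>, \<beta>) \<in> right_comps P"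
    unfolding associator_def by (blast dest: bij_betwE)
  then show ?thesis using assms by (simp add: As_def right_comps_def)
qed

lemma assoc_legs:
  assumes "As \<alpha> \<beta> \<alpha>' \<beta>'"
  shows "prd \<alpha> = lam \<beta> \<and> lam \<alpha> = lam \<beta>' \<and> rho \<alpha> = lam \<alpha>' \<and> rho \<beta> = rho \<alpha>' \<and> prd \<beta> = prd \<beta>' \<and> prd \<alpha>' = rho \<beta>'"
proof -
  have lc: "(\<alpha>, \<beta>) \<in> left_comps P" and a: "assoc P (\<alpha>, \<beta>) = (\<alpha>', \<beta>')"
    using assms by (auto simp: As_def left_comps_def)
  note as = cf_facts(2)
  then have "(\<alpha>', \<beta>') \<in> right_comps P" using lc a unfolding associator_def by (metis bij_betwE)
  moreover have "lam \<alpha> = lam \<beta>' \<and> rho \<alpha> = lam \<alpha>' \<and> rho \<beta> = rho \<alpha>' \<and> prd \<beta> = prd \<beta>'"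
    using as lc a unfolding associator_def by blast
  ultimately show ?thesis using lc by (simp add: left_comps_def right_comps_def)
qed

lemma assoc_ex: "\<alpha> \<in> M \<Longrightarrow> \<beta> \<in> M \<Longrightarrow> prd \<alpha> = lam \<beta> \<Longrightarrow> \<exists>\<alpha>' \<beta>'. As \<alpha> \<beta> \<alpha>' \<beta>'"
  by (cases "assoc P (\<alpha>, \<beta>)") (simp add: As_def)

lemma assoc_unique: "As \<alpha> \<beta> \<alpha>' \<beta>' \<Longrightarrow> As \<alpha> \<beta> \<alpha>2 \<beta>2 \<Longrightarrow> \<alpha>2 = \<alpha>' \<and> \<beta>2 = \<beta>'"
  by (simp add: As_def)

lemma assoc_inj:
  assumes "As \<alpha> \<beta> \<alpha>' \<beta>'" "As \<gamma> \<delta> \<alpha>' \<beta>'"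
  shows "\<alpha> = \<gamma> \<and> \<beta> = \<delta>"
proof -
  have "inj_on (assoc P) (left_comps P)"
    using cf_facts(2) by (simp add: associator_def bij_betw_def)
  then have "(\<alpha>, \<beta>) = (\<gamma>, \<delta>)"
    by (rule inj_onD) (use assms in \<open>simp_all add: As_def left_comps_def\<close>)
  then show ?thesis by simp
qed

lemma assoc_pentagon:
  assumes "As \<alpha> \<beta> \<alpha>' \<beta>'" "As \<beta>' \<gamma> \<gamma>2 \<delta>" "As \<alpha>' \<gamma>2 \<epsilon> \<zeta>" "As \<beta> \<gamma> \<epsilon>t \<beta>t" "As \<alpha> \<beta>t \<zeta>t \<delta>t"
  shows "\<epsilon>t = \<epsilon> \<and> \<zeta>t = \<zeta> \<and> \<delta>t = \<delta>"
proof -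
  have "(\<epsilon>, \<zeta>, \<delta>) = (\<epsilon>t, \<zeta>t, \<delta>t)"
    using cf_facts(4) assms unfolding pentagon_def As_def by blast
  then show ?thesis by simp
qed

lemma assoc_hexagon:
  assumes "As \<alpha> \<beta> \<alpha>' \<beta>'" "As (\<sigma> \<alpha>) \<beta> \<gamma> \<delta>"
  shows "As \<alpha>' (\<sigma> \<beta>') (\<sigma> \<gamma>) \<delta>"
proof -
  have m: "\<alpha>' \<in> M" "\<sigma> \<beta>' \<in> M" and l: "prd \<alpha>' = lam (\<sigma> \<beta>')"
    using assoc_in[OF assms(1)] assoc_legs[OF assms(1)] by auto
  obtain \<alpha>2 \<beta>2 where 2: "As \<alpha>' (\<sigma> \<beta>') \<alpha>2 \<beta>2" using assoc_ex[OF m l] by blast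
  have "(\<alpha>2, \<beta>2) = (\<sigma> \<gamma>, \<delta>)"
    using cf_facts(6) assms 2 unfolding commutative_structure_def As_def by blast
  with 2 show ?thesis by simp
qed

lemma assoc_triangle:
  assumes "As \<alpha> \<beta> \<alpha>' \<beta>'" "rho \<alpha> \<in> uleg P ` Unt P"
  shows "\<beta>' = \<beta>"
proof -
  show ?thesis using cf_facts(5) assms unfolding triangle_def As_def by blast
qed

text \<open>Associating the left unit at \<open>lam m\<close> with \<open>m\<close> gives an element
  with product \<open>prd m\<close> whose left leg is again a unit. It is therefore a left unit
  itself, and comparing its legs gives the first claim. The braiding gives the second.\<close>

lemma eps_legs: "m \<in> M \<Longrightarrow> eps (prd m) = eps (lam m)" "m \<in> M \<Longrightarrow> eps (rho m) = eps (lam m)"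
proof -
  have *: "eps (prd m) = eps (lam m)" if m: "m \<in> M" for m
  proof -
    obtain a b where as: "As (lunit (lam m)) m a b" using assoc_ex[of "lunit (lam m)" m] m by auto
    have b: "b \<in> M" "lam b = eps (lam m)" "prd b = prd m"
      using assoc_in[OF as] assoc_legs[OF as] m by auto
    then have "lam b \<in> uleg P ` Unt P" using eps_in_unit m by simp
    from lunit_eqI[OF b(1) this] have "b = lunit (rho b)" .
    then have "prd b = rho b" "lam b = eps (rho b)" using b(1) lunit_legs[of "rho b"] by auto
    then show ?thesis using b by simp
  qed
  show "m \<in> M \<Longrightarrow> eps (prd m) = eps (lam m)" by (rule *)
  show "m \<in> M \<Longrightarrow> eps (rho m) = eps (lam m)" using *[of m] *[of "\<sigma> m"] by simp
qed

lemma eps_eps: "x \<in> X \<Longrightarrow> eps (eps x) = eps x"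
  using eps_legs(2)[of "lunit x"] by simp

lemma lunit_eps: "x \<in> X \<Longrightarrow> lunit (eps x) = runit (eps x)"
  using runit_eqI[of "lunit (eps x)"] eps_in_unit by (simp add: eps_eps)

lemma braid_units: "x \<in> X \<Longrightarrow> \<sigma> (lunit x) = runit x" "x \<in> X \<Longrightarrow> \<sigma> (runit x) = lunit x"
  by (simp_all add: runit_def)

lemma bet_braid: "x \<in> X \<Longrightarrow> \<sigma> (bet x) = bet (tau x)"
  using bet_eqI[of "\<sigma> (bet x)"] bet0 by (simp add: tau_def)

lemma tau_tau: "x \<in> X \<Longrightarrow> tau (tau x) = x"
  using bet_braid[of x] bet0[of x] braid[of "bet x"] by (simp add: tau_def)

lemma eps_tau: "x \<in> X \<Longrightarrow> eps (tau x) = eps x"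
  using eps_legs(2)[of "bet x"] bet0[of x] by (simp add: tau_def)

text \<open>The left unit at a counit has a counit as product, so it is also a value of
  \<open>bet\<close>; its right leg can be read off in both ways.\<close>

lemma counit_eq: "v \<in> Cou P \<Longrightarrow> cleg P v = tau (eps (cleg P v))"
proof -
  assume v: "v \<in> Cou P"
  then have x: "cleg P v \<in> X" by (rule leg_in)
  have "lunit (cleg P v) = bet (eps (cleg P v))"
    using bet_eqI[of "lunit (cleg P v)"] x v by simp
  then show ?thesis using x lunit_legs(2)[OF x] by (simp add: tau_def)
qed

text \<open>The left leg of \<open>bet (eps x)\<close> is a unit, so its product, which is a counit,
  equals its right leg.\<close>

lemma tau_eps_counit: "x \<in> X \<Longrightarrow> tau (eps x) \<in> cleg P ` Cou P"
proof -
  assume x: "x \<in> X"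
  then have b: "bet (eps x) \<in> M" "lam (bet (eps x)) = eps x" "prd (bet (eps x)) \<in> cleg P ` Cou P"
    using bet0[of "eps x"] by auto
  have "prd (bet (eps x)) = tau (eps x)"
    using unit_legs[OF b(1)] b(2) eps_in_unit[OF x] by (auto simp: tau_def)
  with b(3) show ?thesis by simp
qed

lemma bet_legs [simp]: "x \<in> X \<Longrightarrow> lam (bet x) = x" "x \<in> X \<Longrightarrow> rho (bet x) = tau x"
    "x \<in> X \<Longrightarrow> prd (bet x) = tau (eps x)"
proof -
  assume x: "x \<in> X"
  then show "lam (bet x) = x" "rho (bet x) = tau x" using bet0 by (auto simp: tau_def)
  have "prd (bet x) = tau (eps (prd (bet x)))" using bet0[OF x] counit_eq by auto
  then show "prd (bet x) = tau (eps x)"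
    using eps_legs(1)[of "bet x"] bet0[OF x] by simp
qed

lemma bet_tau_eps: "x \<in> X \<Longrightarrow> bet (tau (eps x)) = runit (tau (eps x))"
  using bet_eqI[of "runit (tau (eps x))"] tau_eps_counit by simp

lemma lunit_tau_eps: "x \<in> X \<Longrightarrow> lunit (tau (eps x)) = bet (eps x)"
  using bet_braid[of "tau (eps x)"] bet_tau_eps[of x] by (simp add: tau_tau braid_units)

text \<open>The last component has a counit as product, so nondegeneracy determines it from its left
  leg.\<close>

lemma kap_As:
  assumes "m \<in> M"
  shows "As m (bet (prd m)) (kap m) (bet (lam m))"
proof -
  obtain a b where as: "As m (bet (prd m)) a b" using assoc_ex[of m "bet (prd m)"] assms by auto
  then have a: "a = kap m" by (simp add: kap_def As_def)
  have b: "b \<in> M" "prd b = tau (eps (prd m))" "lam b = lam m"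
    using assoc_in[OF as] assoc_legs[OF as] assms by auto
  then have "b = bet (lam m)"
    using bet_eqI[OF b(1)] tau_eps_counit assms by simp
  then show ?thesis using as a by simp
qed

lemma kap_in [simp]: "m \<in> M \<Longrightarrow> kap m \<in> M"
  using assoc_in[OF kap_As] by blast

lemma kap_legs [simp]: "m \<in> M \<Longrightarrow> lam (kap m) = rho m" "m \<in> M \<Longrightarrow> rho (kap m) = tau (prd m)"
    "m \<in> M \<Longrightarrow> prd (kap m) = tau (lam m)"
  using assoc_legs[OF kap_As] by auto

text \<open>The hexagon, applied to the associators that define \<open>kap m\<close> and
  \<open>kap (\<sigma> m)\<close>, produces the associator that defines
  \<open>kap (kap m)\<close>.\<close>

lemma kap_kap: "m \<in> M \<Longrightarrow> kap (kap m) = \<sigma> (kap (\<sigma> m))"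
proof -
  assume m: "m \<in> M"
  have "As (kap m) (bet (tau (lam m))) (\<sigma> (kap (\<sigma> m))) (bet (rho m))"
    using assoc_hexagon[OF kap_As[OF m], of "kap (\<sigma> m)" "bet (rho m)"] kap_As[of "\<sigma> m"] m
    by (simp add: bet_braid)
  with kap_As[of "kap m"] m show ?thesis using assoc_unique by fastforce
qed

lemma kap_inj: "m \<in> M \<Longrightarrow> m' \<in> M \<Longrightarrow> kap m = kap m' \<Longrightarrow> m = m'"
proof -
  assume m: "m \<in> M" "m' \<in> M" and e: "kap m = kap m'"
  have "tau (lam m) = tau (lam m')" using kap_legs(3) m e by metis
  then have "lam m = lam m'" using tau_tau m leg_in(1) by metis
  then show ?thesis using assoc_inj[OF kap_As[OF m(1)]] kap_As[OF m(2)] e by simp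
qed

text \<open>Repeated use of \<open>kap_kap\<close> reduces the fourth power of \<open>kap\<close> to
  \<open>kap\<close>, and injectivity cancels one factor.\<close>

lemma kap3: "m \<in> M \<Longrightarrow> kap (kap (kap m)) = m"
proof -
  assume m: "m \<in> M"
  have "kap (kap (kap (kap m))) = \<sigma> (kap (\<sigma> (kap (kap m))))"
    using kap_kap[of "kap (kap m)"] m by simp
  also have "\<sigma> (kap (kap m)) = kap (\<sigma> m)" using kap_kap[OF m] m by simp
  also have "\<sigma> (kap (kap (\<sigma> m))) = kap m" using kap_kap[of "\<sigma> m"] m by simp
  finally show ?thesis using kap_inj m by simp
qed

lemma braid_kap_braid: "m \<in> M \<Longrightarrow> \<sigma> (kap (\<sigma> m)) = kap (kap m)"
  by (simp add: kap_kap)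

lemma kap_braid_kap: "m \<in> M \<Longrightarrow> kap (\<sigma> (kap m)) = \<sigma> m"
proof -
  assume m: "m \<in> M"
  have "\<sigma> (kap (\<sigma> (kap m))) = m" using kap_kap[of "kap m"] kap3[OF m] m by simp
  then have "\<sigma> (\<sigma> (kap (\<sigma> (kap m)))) = \<sigma> m" by simp
  then show ?thesis using m by simp
qed

lemma braid_kap_kap: "m \<in> M \<Longrightarrow> \<sigma> (kap (kap m)) = kap (\<sigma> m)"
  by (simp add: kap_kap)

lemma kap_kap_braid: "m \<in> M \<Longrightarrow> kap (kap (\<sigma> m)) = \<sigma> (kap m)"
  using kap_kap[of "\<sigma> m"] by simp

lemma kap_units: "x \<in> X \<Longrightarrow> kap (runit x) = lunit (tau x)" "x \<in> X \<Longrightarrow> kap (lunit x) = bet x"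
    "x \<in> X \<Longrightarrow> kap (bet x) = runit (tau x)"
proof -
  assume x: "x \<in> X"
  show "kap (runit x) = lunit (tau x)"
    using lunit_eqI[of "kap (runit x)"] x eps_in_unit by simp
  show "kap (lunit x) = bet x"
    using bet_eqI[of "kap (lunit x)"] x tau_eps_counit by simp
  show "kap (bet x) = runit (tau x)"
    using runit_eqI[of "kap (bet x)"] x eps_in_unit tau_tau by simp
qed

text \<open>\<open>act3 i j k\<close> is the action of the map with values \<open>i, j, k\<close>: a permutation is a word in \<open>\<sigma>\<close> and \<open>kap\<close>,
  and any other map factors through a leg, which is then included by \<open>runit\<close>, \<open>lunit\<close> or \<open>bet\<close> as
  the inclusion of the points \<open>01\<close>, \<open>02\<close> or \<open>21\<close>.\<close>

fun act3 :: "three \<Rightarrow> three \<Rightarrow> three \<Rightarrow> 'a \<Rightarrow> 'a" where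
  "act3 T0 T1 T2 m = m" | "act3 T0 T2 T1 m = \<sigma> m" | "act3 T2 T0 T1 m = kap m"
| "act3 T1 T2 T0 m = kap (kap m)" | "act3 T2 T1 T0 m = kap (\<sigma> m)" | "act3 T1 T0 T2 m = \<sigma> (kap m)"
| "act3 T0 T1 T0 m = runit (lam m)" | "act3 T0 T0 T1 m = runit (rho m)" | "act3 T0 T1 T1 m = runit (prd m)"
| "act3 T1 T0 T1 m = runit (tau (lam m))" | "act3 T1 T1 T0 m = runit (tau (rho m))" | "act3 T1 T0 T0 m = runit (tau (prd m))"
| "act3 T0 T2 T0 m = lunit (lam m)" | "act3 T0 T0 T2 m = lunit (rho m)" | "act3 T0 T2 T2 m = lunit (prd m)"
| "act3 T2 T0 T2 m = lunit (tau (lam m))" | "act3 T2 T2 T0 m = lunit (tau (rho m))" | "act3 T2 T0 T0 m = lunit (tau (prd m))"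
| "act3 T2 T1 T2 m = bet (lam m)" | "act3 T2 T2 T1 m = bet (rho m)" | "act3 T2 T1 T1 m = bet (prd m)"
| "act3 T1 T2 T1 m = bet (tau (lam m))" | "act3 T1 T1 T2 m = bet (tau (rho m))" | "act3 T1 T2 T2 m = bet (tau (prd m))"
| "act3 T0 T0 T0 m = runit (eps (lam m))" | "act3 T1 T1 T1 m = runit (tau (eps (lam m)))" | "act3 T2 T2 T2 m = bet (eps (lam m))"

definition t :: "(three \<Rightarrow> three) \<Rightarrow> 'a \<Rightarrow> 'a" where
  "t g = act3 (g T0) (g T1) (g T2)"

lemmas act3_rules = braid_kap_braid kap_braid_kap braid_kap_kap kap_kap_braid kap3 kap_units braid_units
  bet_braid tau_tau eps_tau eps_eps eps_legs lunit_eps lunit_tau_eps bet_tau_eps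

lemma act3_in: "m \<in> M \<Longrightarrow> act3 i j k m \<in> M"
  by (cases i; cases j; cases k) simp_all

text \<open>The composition table of the 27 self-maps, entry by entry; \<open>act3_rules\<close>
  contains the relations of the symmetric group and those between the inclusions, \<open>eps\<close>
  and \<open>tau\<close>.\<close>

lemma act3_act3:
  assumes "m \<in> M"
  shows "act3 (g T0) (g T1) (g T2) (act3 i j k m) = act3 (g i) (g j) (g k) m"
  using assms
  by (cases i; cases j; cases k; cases "g T0"; cases "g T1"; cases "g T2") (simp_all add: act3_rules)

text \<open>The pentagon with the pairing at \<open>prd \<beta>\<close> as third element: three of
  its associators are instances of \<open>kap_As\<close>, a fourth is the assumption, and the fifth
  is the one to be computed.\<close>

lemma As_rotate:
  assumes "As \<alpha> \<beta> \<alpha>' \<beta>'"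
  shows "As \<alpha>' (kap \<beta>') (kap \<beta>) (kap \<alpha>)"
proof -
  have m: "\<alpha> \<in> M" "\<beta> \<in> M" "\<alpha>' \<in> M" "\<beta>' \<in> M"
    using assoc_in[OF assms] by auto
  have l: "prd \<alpha> = lam \<beta>" "lam \<alpha> = lam \<beta>'" "prd \<beta> = prd \<beta>'" "prd \<alpha>' = rho \<beta>'"
    using assoc_legs[OF assms] by auto
  obtain \<epsilon> \<zeta> where as: "As \<alpha>' (kap \<beta>') \<epsilon> \<zeta>"
    using assoc_ex[of \<alpha>' "kap \<beta>'"] m l by auto
  have "kap \<beta> = \<epsilon> \<and> kap \<alpha> = \<zeta> \<and> bet (lam \<alpha>) = bet (lam \<beta>')"
    by (rule assoc_pentagon[OF assms _ as])
      (use kap_As[OF m(1)] kap_As[OF m(2)] kap_As[OF m(4)] l in simp_all)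
  with as show ?thesis by simp
qed

text \<open>The digits in the names of facts give the order of the three inputs. A hexagon passes
  from the orders 123 and 213 to 231, that is, it moves the first input to the end. Going round the
  six orders leads back to 123 with the same right-hand side, and injectivity of the associator
  compares the two.\<close>

lemma As_reflect:
  assumes A123: "As \<alpha> \<beta> \<alpha>' \<beta>'"
  shows "As (\<sigma> \<alpha>') (\<sigma> \<beta>') (\<sigma> \<alpha>) (\<sigma> \<beta>)"
proof -
  have m: "\<alpha> \<in> M" "\<beta> \<in> M" "\<alpha>' \<in> M" "\<beta>' \<in> M"
    using assoc_in[OF assms] by auto
  note l = assoc_legs[OF assms]
  obtain \<gamma> \<delta> where A213: "As (\<sigma> \<alpha>) \<beta> \<gamma> \<delta>"
    using assoc_ex[of "\<sigma> \<alpha>" \<beta>] m l by auto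
  obtain \<epsilon> \<zeta> where A321: "As (\<sigma> \<alpha>') (\<sigma> \<beta>') \<epsilon> \<zeta>"
    using assoc_ex[of "\<sigma> \<alpha>'" "\<sigma> \<beta>'"] m l by auto
  have n: "\<gamma> \<in> M" "\<delta> \<in> M" "\<epsilon> \<in> M" "\<zeta> \<in> M"
    using assoc_in[OF A213] assoc_in[OF A321] by auto
  have A231: "As \<alpha>' (\<sigma> \<beta>') (\<sigma> \<gamma>) \<delta>" by (rule assoc_hexagon[OF A123 A213])
  have A312: "As (\<sigma> \<gamma>) (\<sigma> \<delta>) (\<sigma> \<epsilon>) \<zeta>" by (rule assoc_hexagon[OF A231 A321])
  have A132: "As \<gamma> (\<sigma> \<delta>) (\<sigma> \<alpha>') \<beta>'"
    by (rule assoc_hexagon[OF A213]) (use A123 m in simp)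
  have "As (\<sigma> \<epsilon>) (\<sigma> \<zeta>) (\<sigma> (\<sigma> \<alpha>')) \<beta>'"
    by (rule assoc_hexagon[OF A312]) (use A132 n in simp)
  then have "\<sigma> \<epsilon> = \<alpha> \<and> \<sigma> \<zeta> = \<beta>"
    using assoc_inj[OF _ A123] m by simp
  then have "\<epsilon> = \<sigma> \<alpha>" "\<zeta> = \<sigma> \<beta>" using n by auto
  with A321 show ?thesis by simp
qed

text \<open>The triangle fixes the last component. The other one has a unit as left leg, so it is a
  left unit.\<close>

lemma As_unit: "\<beta> \<in> M \<Longrightarrow> As (runit (lam \<beta>)) \<beta> (lunit (rho \<beta>)) \<beta>"
proof -
  assume m: "\<beta> \<in> M"
  obtain a b where as: "As (runit (lam \<beta>)) \<beta> a b"
    using assoc_ex[of "runit (lam \<beta>)" \<beta>] m by auto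
  have b: "b = \<beta>" using assoc_triangle[OF as] m eps_in_unit by simp
  have "rho (runit (lam \<beta>)) = lam a" using assoc_legs[OF as] by blast
  then have "lam a \<in> uleg P ` Unt P" using eps_in_unit[of "lam \<beta>"] m by simp
  then have "a = lunit (rho a)"
    using lunit_eqI[of a] assoc_in[OF as] by simp
  then show ?thesis using as b assoc_legs[OF as] by simp
qed

lemma runit_inj: "x \<in> X \<Longrightarrow> y \<in> X \<Longrightarrow> runit x = runit y \<Longrightarrow> x = y"
  using runit_legs(1) by metis

sublocale seed M t As
proof
  show "t g m \<in> M" if "m \<in> M" for g m using that by (simp add: t_def act3_in)
  show "t id m = m" if "m \<in> M" for m by (simp add: t_def)
  show "t g (t h m) = t (g \<circ> h) m" if "m \<in> M" for g h m
    using act3_act3[OF that, of g] by (simp add: t_def)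
next
  fix \<alpha> \<beta> \<alpha>' \<beta>' assume a: "As \<alpha> \<beta> \<alpha>' \<beta>'"
  show "\<alpha> \<in> M \<and> \<beta> \<in> M \<and> \<alpha>' \<in> M \<and> \<beta>' \<in> M" by (rule assoc_in[OF a])
  show "t (tri T0 T1 T1) \<alpha> = t (tri T0 T1 T0) \<beta> \<and> t (tri T0 T1 T0) \<alpha> = t (tri T0 T1 T0) \<beta>' \<and>
      t (tri T0 T0 T1) \<alpha> = t (tri T0 T1 T0) \<alpha>' \<and> t (tri T0 T0 T1) \<beta> = t (tri T0 T0 T1) \<alpha>' \<and>
      t (tri T0 T1 T1) \<beta> = t (tri T0 T1 T1) \<beta>' \<and> t (tri T0 T1 T1) \<alpha>' = t (tri T0 T0 T1) \<beta>'"
    using assoc_legs[OF a] by (simp add: t_def)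
  show "As \<alpha>' (t (tri T2 T0 T1) \<beta>') (t (tri T2 T0 T1) \<beta>) (t (tri T2 T0 T1) \<alpha>)"
    using As_rotate[OF a] by (simp add: t_def)
  show "As (t (tri T0 T2 T1) \<alpha>') (t (tri T0 T2 T1) \<beta>') (t (tri T0 T2 T1) \<alpha>) (t (tri T0 T2 T1) \<beta>)"
    using As_reflect[OF a] by (simp add: t_def)
next
  fix \<alpha> \<beta> assume m: "\<alpha> \<in> M" "\<beta> \<in> M" "t (tri T0 T1 T1) \<alpha> = t (tri T0 T1 T0) \<beta>"
  then show "\<exists>\<alpha>' \<beta>'. As \<alpha> \<beta> \<alpha>' \<beta>'"
    using runit_inj[of "prd \<alpha>" "lam \<beta>"] assoc_ex by (simp add: t_def)
next
  show "\<alpha>2 = \<alpha>' \<and> \<beta>2 = \<beta>'" if "As \<alpha> \<beta> \<alpha>' \<beta>'" "As \<alpha> \<beta> \<alpha>2 \<beta>2" for \<alpha> \<beta> \<alpha>' \<beta>' \<alpha>2 \<beta>2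
    using that by (rule assoc_unique)
  show "As \<alpha>' (t (tri T0 T2 T1) \<beta>') (t (tri T0 T2 T1) \<gamma>) \<delta>"
    if "As \<alpha> \<beta> \<alpha>' \<beta>'" "As (t (tri T0 T2 T1) \<alpha>) \<beta> \<gamma> \<delta>" for \<alpha> \<beta> \<alpha>' \<beta>' \<gamma> \<delta>
    using that assoc_hexagon by (simp add: t_def)
  show "As (t (tri T0 T1 T0) \<beta>) \<beta> (t (tri T0 T0 T2) \<beta>) \<beta>" if "\<beta> \<in> M" for \<beta>
    using As_unit[OF that] by (simp add: t_def)
  show "\<epsilon>t = \<epsilon> \<and> \<zeta>t = \<zeta> \<and> \<delta>t = \<delta>"
    if "As \<alpha> \<beta> \<alpha>' \<beta>'" "As \<beta>' \<gamma> \<gamma>2 \<delta>" "As \<alpha>' \<gamma>2 \<epsilon> \<zeta>" "As \<beta> \<gamma> \<epsilon>t \<beta>t" "As \<alpha> \<beta>t \<zeta>t \<delta>t"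
    for \<alpha> \<beta> \<alpha>' \<beta>' \<gamma> \<gamma>2 \<delta> \<epsilon> \<zeta> \<epsilon>t \<beta>t \<zeta>t \<delta>t
    using that by (rule assoc_pentagon)
qed

end

section \<open>The cosymmetric set of a seed\<close>

context seed begin

text \<open>All levels share the points \<open>nat\<close> and hence one type; those above
  \<open>n\<close> are made irrelevant.\<close>

definition flev :: "nat \<Rightarrow> ((nat \<Rightarrow> three) \<Rightarrow> 'a) set" where
  "flev n = {x \<in> Fam. \<forall>f g. (\<forall>k\<le>n. f k = g k) \<longrightarrow> x f = x g}"

definition fcosym :: "((nat \<Rightarrow> three) \<Rightarrow> 'a) cosym" where
  "fcosym = \<lparr> lev = flev, act = (\<lambda>m n F x g. x (\<lambda>k. g (F k))) \<rparr>"

lemma flev_Fam: "x \<in> flev n \<Longrightarrow> x \<in> Fam"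
  by (simp add: flev_def)

lemma flev_cong: "x \<in> flev n \<Longrightarrow> (\<And>k. k \<le> n \<Longrightarrow> f k = g k) \<Longrightarrow> x f = x g"
  unfolding flev_def by blast

lemma flev_push:
  assumes x: "x \<in> flev m" and F: "\<And>k. k \<le> m \<Longrightarrow> F k \<le> n"
  shows "(\<lambda>g. x (\<lambda>k. g (F k))) \<in> flev n"
  unfolding flev_def mem_Collect_eq
proof (intro conjI allI impI)
  show "(\<lambda>g. x (\<lambda>k. g (F k))) \<in> Fam" by (rule Fam_push[OF flev_Fam[OF x]])
  show "x (\<lambda>k. f (F k)) = x (\<lambda>k. g (F k))" if "\<forall>k\<le>n. f k = g k" for f g
    by (rule flev_cong[OF x]) (use that F in blast)
qed

lemma fcosym_cosymmetric: "cosymmetric_set fcosym"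
  unfolding cosymmetric_set_def
proof (intro conjI allI ballI)
  show "act fcosym m n f \<in> lev fcosym m \<rightarrow> lev fcosym n" if "f \<in> Phi m n" for m n f
  proof
    show "act fcosym m n f x \<in> lev fcosym n" if "x \<in> lev fcosym m" for x
      using flev_push[of x m f n] that PiE_mem[OF \<open>f \<in> Phi m n\<close>[unfolded Phi_def]]
      by (simp add: fcosym_def)
  qed
  show "act fcosym n n (restrict (\<lambda>k. k) {..n}) x = x" if "x \<in> lev fcosym n" for n x
  proof
    show "act fcosym n n (restrict (\<lambda>k. k) {..n}) x g = x g" for g
      using that by (auto simp: fcosym_def intro!: flev_cong)
  qed
  show "act fcosym l n (compose {..l} g f) x = act fcosym m n g (act fcosym l m f x)"
    if "x \<in> lev fcosym l" for l m n f g x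
  proof
    show "act fcosym l n (compose {..l} g f) x h = act fcosym m n g (act fcosym l m f x) h" for h
      using that by (auto simp: fcosym_def compose_def intro!: flev_cong)
  qed
qed

text \<open>Covers both kinds of 2-Segal maps: \<open>q1\<close> merges \<open>a\<close> and
  \<open>b\<close>, \<open>q2\<close> merges the disjoint pair \<open>c\<close> and
  \<open>d\<close>. The sections \<open>s1\<close>, \<open>s2\<close>, \<open>s\<close> choose
  representatives, so that \<open>x\<close> prescribes the values at maps not separating
  \<open>a\<close> and \<open>b\<close>, and \<open>y\<close> those at maps not separating
  \<open>c\<close> and \<open>d\<close>.\<close>

lemma flev_pullback:
  assumes q1: "\<And>k. k \<le> N \<Longrightarrow> q1 k \<le> n" "\<And>k. k \<le> n \<Longrightarrow> s1 k \<le> N" "\<And>k. k \<le> n \<Longrightarrow> q1 (s1 k) = k"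
      "\<And>k. k \<le> N \<Longrightarrow> s1 (q1 k) = (if k = b then a else k)"
    and q2: "\<And>k. k \<le> N \<Longrightarrow> q2 k \<le> n" "\<And>k. k \<le> n \<Longrightarrow> s2 k \<le> N" "\<And>k. k \<le> n \<Longrightarrow> q2 (s2 k) = k"
      "\<And>k. k \<le> N \<Longrightarrow> s2 (q2 k) = (if k = d then c else k)"
    and sq: "\<And>k. k \<le> N \<Longrightarrow> q2' (q1 k) = q1' (q2 k)"
      "\<And>k. k \<le> N \<Longrightarrow> s (q2' (q1 k)) = (if k = b then a else if k = d then c else k)"
    and abcd: "distinct [a, b, c, d]" "a \<le> N" "b \<le> N" "c \<le> N" "d \<le> N"
  shows "bij_betw (\<lambda>w. (\<lambda>g. w (\<lambda>k. g (q1 k)), \<lambda>g. w (\<lambda>k. g (q2 k)))) (flev N)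
    {(x, y) \<in> flev n \<times> flev n. (\<lambda>g. x (\<lambda>k. g (q2' k))) = (\<lambda>g. y (\<lambda>k. g (q1' k)))}"
  unfolding bij_betw_def
proof (intro conjI equalityI subsetI)
  have f1: "f k = f (s1 (q1 k))" if "f a = f b" "k \<le> N" for f :: "nat \<Rightarrow> three" and k
    using that q1(4) by auto
  have f2: "f k = f (s2 (q2 k))" if "f c = f d" "k \<le> N" for f :: "nat \<Rightarrow> three" and k
    using that q2(4) by auto
  have qab: "q1 a = q1 b"
    using q1(4)[of b] q1(3)[OF q1(1)[of b]] abcd by auto
  show "inj_on (\<lambda>w. (\<lambda>g. w (\<lambda>k. g (q1 k)), \<lambda>g. w (\<lambda>k. g (q2 k)))) (flev N)"
  proof (rule inj_onI)
    fix w w' assume w: "w \<in> flev N" "w' \<in> flev N" and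
      e: "(\<lambda>g. w (\<lambda>k. g (q1 k)), \<lambda>g. w (\<lambda>k. g (q2 k))) =
        (\<lambda>g. w' (\<lambda>k. g (q1 k)), \<lambda>g. w' (\<lambda>k. g (q2 k)))"
    have e1: "w (\<lambda>k. g (q1 k)) = w' (\<lambda>k. g (q1 k))" and e2: "w (\<lambda>k. g (q2 k)) = w' (\<lambda>k. g (q2 k))" for g
      using e by (simp_all add: fun_eq_iff)
    have ab: "w f = w' f" if "f a = f b" for f
      using flev_cong[OF w(1) f1[OF that]] flev_cong[OF w(2) f1[OF that]] e1[of "\<lambda>k. f (s1 k)"] by simp
    have cd: "w f = w' f" if "f c = f d" for f
      using flev_cong[OF w(1) f2[OF that]] flev_cong[OF w(2) f2[OF that]] e2[of "\<lambda>k. f (s2 k)"] by simp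
    show "w = w'"
      by (rule Fam_unique[of _ _ a b]) (use w abcd ab cd flev_Fam in auto)
  qed
  fix p
  {
    assume "p \<in> (\<lambda>w. (\<lambda>g. w (\<lambda>k. g (q1 k)), \<lambda>g. w (\<lambda>k. g (q2 k)))) ` flev N"
    then obtain w where w: "w \<in> flev N" and p: "p = (\<lambda>g. w (\<lambda>k. g (q1 k)), \<lambda>g. w (\<lambda>k. g (q2 k)))"
      by blast
    have "w (\<lambda>k. g (q2' (q1 k))) = w (\<lambda>k. g (q1' (q2 k)))" for g
      by (rule flev_cong[OF w]) (simp add: sq)
    then show "p \<in> {(x, y) \<in> flev n \<times> flev n.
        (\<lambda>g. x (\<lambda>k. g (q2' k))) = (\<lambda>g. y (\<lambda>k. g (q1' k)))}"
      using flev_push[OF w q1(1)] flev_push[OF w q2(1)] p by auto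
  }
  assume "p \<in> {(x, y) \<in> flev n \<times> flev n. (\<lambda>g. x (\<lambda>k. g (q2' k))) = (\<lambda>g. y (\<lambda>k. g (q1' k)))}"
  then obtain x y where p: "p = (x, y)" and x: "x \<in> flev n" and y: "y \<in> flev n"
    and xy0: "(\<lambda>g. x (\<lambda>k. g (q2' k))) = (\<lambda>g. y (\<lambda>k. g (q1' k)))" by auto
  have xy: "x (\<lambda>k. f (s1 k)) = y (\<lambda>k. f (s2 k))" if ab: "f a = f b" and cd: "f c = f d" for f
  proof -
    have f: "f (s (q2' (q1 k))) = f k" if "k \<le> N" for k
      using sq(2)[OF that] ab cd by auto
    have "x (\<lambda>k. f (s1 k)) = x (\<lambda>k. f (s (q2' k)))"
      by (rule flev_cong[OF x]) (use f[OF q1(2)] q1(3) in simp)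
    also have "\<dots> = y (\<lambda>k. f (s (q1' k)))" using fun_cong[OF xy0, of "\<lambda>k. f (s k)"] .
    also have "\<dots> = y (\<lambda>k. f (s2 k))"
      by (rule flev_cong[OF y]) (use f[OF q2(2)] sq(1)[OF q2(2)] q2(3) in simp)
    finally show ?thesis .
  qed
  let ?chi = "\<lambda>i j k s. if s = a then i else if s = b then j else k"
  define r where "r f = x (\<lambda>k. f (s1 k))" for f
  \<comment> \<open>A map that is constant away from \<open>a\<close> and \<open>b\<close> does not
    separate \<open>c\<close> and \<open>d\<close>, so its value is prescribed by
    \<open>y\<close>.\<close>
  define \<mu> where "\<mu> i j k = y (\<lambda>l. ?chi i j k (s2 l))" for i j k
  have r: "r \<in> Fam" using Fam_push[OF flev_Fam[OF x]] by (simp add: r_def[abs_def])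
  have \<mu>: "F3 \<mu>"
    using Fam_F3[OF flev_Fam[OF y], of "\<lambda>l. ?chi T0 T1 T2 (s2 l)"]
    by (simp add: \<mu>_def[abs_def] if_distrib[of "tri _ _ _"] cong: if_cong)
  have "\<mu> i i k = r (?chi i i k)" for i k
    unfolding \<mu>_def r_def by (rule xy[symmetric]) (use abcd in auto)
  then obtain m where m: "m \<in> Fam" "\<And>f. f a = f b \<Longrightarrow> m f = r f" "\<And>i j k. m (?chi i j k) = \<mu> i j k"
    using Fam_glue[OF _ r \<mu>, of a b] abcd by auto
  \<comment> \<open>Truncation to the points up to \<open>N\<close>. The default \<open>c\<close>
    differs from \<open>a\<close> and \<open>b\<close>, which preserves the values at maps constant
    away from these two.\<close>
  define w where "w f = m (\<lambda>k. f (if k \<le> N then k else c))" for f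
  have w: "w \<in> flev N"
    unfolding flev_def mem_Collect_eq
  proof (intro conjI allI impI)
    show "w \<in> Fam" using Fam_push[OF m(1)] by (simp add: w_def[abs_def])
    show "w f = w g" if "\<forall>k\<le>N. f k = g k" for f g
      unfolding w_def by (rule arg_cong[of _ _ m]) (use that abcd in auto)
  qed
  have wr: "w f = r f" if "f a = f b" for f
  proof -
    have "w f = r (\<lambda>k. f (if k \<le> N then k else c))"
      unfolding w_def by (rule m(2)) (use that abcd in simp)
    also have "\<dots> = r f" unfolding r_def by (rule flev_cong[OF x]) (simp add: q1(2))
    finally show ?thesis .
  qed
  have w1: "w (\<lambda>k. g (q1 k)) = x g" for g
    using wr[of "\<lambda>k. g (q1 k)"] flev_cong[OF x, of "\<lambda>k. g (q1 (s1 k))" g] qab q1(3) by (simp add: r_def)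
  \<comment> \<open>Both families are compared on the points up to \<open>N\<close>, where the pair
    \<open>a\<close>, \<open>b\<close> is available for \<open>Fam_unique\<close>; the section
    property of \<open>s2\<close> then removes the detour.\<close>
  have "(\<lambda>f. w (\<lambda>k. f (s2 (q2 k)))) = (\<lambda>f. y (\<lambda>k. f (s2 k)))"
  proof (rule Fam_unique[of _ _ a b])
    show "(\<lambda>f. w (\<lambda>k. f (s2 (q2 k)))) \<in> Fam" "(\<lambda>f. y (\<lambda>k. f (s2 k))) \<in> Fam" "a \<noteq> b"
      using Fam_push[OF flev_Fam[OF w], of "\<lambda>k. s2 (q2 k)"] Fam_push[OF flev_Fam[OF y]] abcd by auto
  next
    fix f :: "nat \<Rightarrow> three" assume f: "f a = f b"
    let ?f = "\<lambda>k. f (s2 (q2 k))"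
    have fab: "?f a = ?f b" "?f c = ?f d" using f q2(4)[of a] q2(4)[of b] q2(4)[of c] q2(4)[of d] abcd by auto
    have "w ?f = x (\<lambda>k. ?f (s1 k))" using wr[OF fab(1)] by (simp add: r_def)
    also have "\<dots> = y (\<lambda>k. ?f (s2 k))" by (rule xy[OF fab])
    also have "\<dots> = y (\<lambda>k. f (s2 k))" by (rule flev_cong[OF y]) (simp add: q2(3))
    finally show "w ?f = y (\<lambda>k. f (s2 k))" .
  next
    fix i j l
    have "w (\<lambda>k. ?chi i j l (s2 (q2 k))) = w (?chi i j l)"
      by (rule flev_cong[OF w]) (use q2(4) abcd in auto)
    also have "\<dots> = m (?chi i j l)"
      unfolding w_def by (rule arg_cong[of _ _ m]) (use abcd in auto)
    finally show "w (\<lambda>k. ?chi i j l (s2 (q2 k))) = y (\<lambda>k. ?chi i j l (s2 k))"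
      by (simp add: m(3) \<mu>_def)
  qed
  then have "w (\<lambda>k. g (q2 (s2 (q2 k)))) = y (\<lambda>k. g (q2 (s2 k)))" for g
    by (rule fun_cong)
  moreover have "w (\<lambda>k. g (q2 (s2 (q2 k)))) = w (\<lambda>k. g (q2 k))" for g
    by (rule flev_cong[OF w]) (simp only: q2(3)[OF q2(1)])
  moreover have "y (\<lambda>k. g (q2 (s2 k))) = y g" for g
    by (rule flev_cong[OF y]) (simp add: q2)
  ultimately have w2: "w (\<lambda>k. g (q2 k)) = y g" for g by simp
  show "p \<in> (\<lambda>w. (\<lambda>g. w (\<lambda>k. g (q1 k)), \<lambda>g. w (\<lambda>k. g (q2 k)))) ` flev N"
    by (rule image_eqI[OF _ w]) (simp add: p w1 w2)
qed

text \<open>The first map merges i+1 with i+2 and 0 with 1; the second merges i with i+1 and n+1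
  with 0. The bounds on \<open>i\<close> make the pairs disjoint.\<close>

lemma fcosym_two_segal: "two_segal fcosym"
  unfolding two_segal_def
proof (intro allI impI)
  fix n i :: nat assume i: "0 < i \<and> i < n"
  have "bij_betw (\<lambda>w. (\<lambda>g. w (\<lambda>k. g (face_map (n + 1) (i + 1) k)), \<lambda>g. w (\<lambda>k. g (face_map (n + 1) 0 k))))
      (flev (n + 1)) {(x, y) \<in> flev n \<times> flev n.
        (\<lambda>g. x (\<lambda>k. g (face_map n 0 k))) = (\<lambda>g. y (\<lambda>k. g (face_map n i k)))}"
    by (rule flev_pullback[where a = "i + 1" and b = "i + 2" and c = 0 and d = 1 and
          ?s1.0 = "\<lambda>k. if k \<le> i + 1 then k else k + 1" and ?s2.0 = "\<lambda>k. if k = 0 then 0 else k + 1" and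
          s = "\<lambda>k. if k = 0 then 0 else if k \<le> i then k + 1 else k + 2"])
      (use i in \<open>auto simp: face_map_def\<close>)
  moreover have "bij_betw (\<lambda>w. (\<lambda>g. w (\<lambda>k. g (face_map (n + 1) i k)), \<lambda>g. w (\<lambda>k. g (face_map (n + 1) (n + 1) k))))
      (flev (n + 1)) {(x, y) \<in> flev n \<times> flev n.
        (\<lambda>g. x (\<lambda>k. g (face_map n n k))) = (\<lambda>g. y (\<lambda>k. g (face_map n i k)))}"
    by (rule flev_pullback[where a = i and b = "i + 1" and c = 0 and d = "n + 1" and
          ?s1.0 = "\<lambda>k. if k \<le> i then k else k + 1" and ?s2.0 = "\<lambda>k. k" and
          s = "\<lambda>k. if k \<le> i then k else k + 1"])
      (use i in \<open>auto simp: face_map_def\<close>)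
  ultimately show "bij_betw (\<lambda>w. (dface fcosym (n + 1) (i + 1) w, dface fcosym (n + 1) 0 w)) (lev fcosym (n + 1))
          {(x, y) \<in> lev fcosym n \<times> lev fcosym n. dface fcosym n 0 x = dface fcosym n i y} \<and>
        bij_betw (\<lambda>w. (dface fcosym (n + 1) i w, dface fcosym (n + 1) (n + 1) w)) (lev fcosym (n + 1))
          {(x, y) \<in> lev fcosym n \<times> lev fcosym n. dface fcosym n n x = dface fcosym n i y}"
    by (simp add: dface_def fcosym_def)
qed

end

section \<open>From cosymmetric sets to pseudomonoids\<close>

locale segal_cosym =
  fixes X :: "'a cosym"
  assumes X: "X \<in> two_segal_cosyms"
begin

lemma act_in: "f \<in> Phi m n \<Longrightarrow> x \<in> lev X m \<Longrightarrow> act X m n f x \<in> lev X n"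
  and act_id: "x \<in> lev X n \<Longrightarrow> act X n n (restrict (\<lambda>k. k) {..n}) x = x"
  and act_comp: "f \<in> Phi l m \<Longrightarrow> g \<in> Phi m n \<Longrightarrow> x \<in> lev X l \<Longrightarrow>
    act X m n g (act X l m f x) = act X l n (compose {..l} g f) x"
  using X by (auto simp: two_segal_cosyms_def cosymmetric_set_def)

text \<open>A map is encoded by the list of its values, so that the simplifier can compute
  composites and compare maps.\<close>

definition ap :: "nat \<Rightarrow> nat \<Rightarrow> nat list \<Rightarrow> 'a \<Rightarrow> 'a" where
  "ap m n fs = act X m n (restrict (nth fs) {..m})"

lemma list_in_Phi: "length fs = Suc m \<Longrightarrow> set fs \<subseteq> {..n} \<Longrightarrow> restrict (nth fs) {..m} \<in> Phi m n"
  by (auto simp: Phi_def subset_iff less_Suc_eq_le)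

lemma ap_in: "x \<in> lev X m \<Longrightarrow> length fs = Suc m \<Longrightarrow> set fs \<subseteq> {..n} \<Longrightarrow> ap m n fs x \<in> lev X n"
  unfolding ap_def by (rule act_in[OF list_in_Phi])

lemma ap_ap:
  assumes "x \<in> lev X m" "length fs = Suc m" "set fs \<subseteq> {..n}" "length gs = Suc n" "set gs \<subseteq> {..p}"
  shows "ap n p gs (ap m n fs x) = ap m p (map (nth gs) fs) x"
proof -
  have "compose {..m} (restrict (nth gs) {..n}) (restrict (nth fs) {..m}) =
      restrict (nth (map (nth gs) fs)) {..m}"
  proof
    fix k
    have "fs ! k \<le> n" if "k \<le> m" using assms(2,3) that by (auto simp: subset_iff less_Suc_eq_le)
    then show "compose {..m} (restrict (nth gs) {..n}) (restrict (nth fs) {..m}) k =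
      restrict (nth (map (nth gs) fs)) {..m} k"
      using assms(2) by (simp add: compose_def)
  qed
  then show ?thesis
    unfolding ap_def using act_comp[OF list_in_Phi list_in_Phi] assms by simp
qed

lemma ap_id:
  assumes "x \<in> lev X n"
  shows "ap n n [0..<Suc n] x = x"
proof -
  have "restrict (nth [0..<Suc n]) {..n} = restrict (\<lambda>k. k) {..n}"
    by (rule ext) (auto simp del: upt_Suc)
  then show ?thesis using act_id[OF assms] by (simp add: ap_def)
qed

lemma ap_ids: "x \<in> lev X 0 \<Longrightarrow> ap 0 0 [0] x = x" "x \<in> lev X (Suc 0) \<Longrightarrow> ap (Suc 0) (Suc 0) [0, Suc 0] x = x"
    "x \<in> lev X 2 \<Longrightarrow> ap 2 2 [0, Suc 0, 2] x = x" "x \<in> lev X 3 \<Longrightarrow> ap 3 3 [0, Suc 0, 2, 3] x = x"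
  using ap_id[of x 0] ap_id[of x "Suc 0"] ap_id[of x 2] ap_id[of x 3]
  by (simp_all add: upt_rec numeral_2_eq_2 numeral_3_eq_3)

lemma restrict_list_eqI:
  "length fs = Suc m \<Longrightarrow> (\<And>k. k \<in> set [0..<Suc m] \<Longrightarrow> F k = fs ! k) \<Longrightarrow>
    restrict F {..m} = restrict (nth fs) {..m}"
  by (rule ext) (auto simp: less_Suc_eq_le simp del: upt_Suc)

lemma faces: "dface X 2 0 = ap 2 (Suc 0) [0, 0, Suc 0]" "dface X 2 (Suc 0) = ap 2 (Suc 0) [0, Suc 0, Suc 0]"
    "dface X 2 2 = ap 2 (Suc 0) [0, Suc 0, 0]"
    "dface X 3 0 = ap 3 2 [0, 0, Suc 0, 2]" "dface X 3 (Suc 0) = ap 3 2 [0, Suc 0, Suc 0, 2]"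
    "dface X 3 2 = ap 3 2 [0, Suc 0, 2, 2]" "dface X 3 3 = ap 3 2 [0, Suc 0, 2, 0]"
    "dface X 4 (Suc 0) = ap 4 3 [0, Suc 0, Suc 0, 2, 3]" "dface X 4 4 = ap 4 3 [0, Suc 0, 2, 3, 0]"
  unfolding dface_def ap_def face_map_def
  by (rule arg_cong2[of _ _ _ _ "act X _"]; (rule restrict_list_eqI)?; auto simp: upt_rec)+

lemma degens: "sdegen X 0 0 = ap 0 (Suc 0) [0]" "sdegen X 0 (Suc 0) = ap 0 (Suc 0) [Suc 0]"
    "theta X 2 (Suc 0) = ap 2 2 [0, 2, Suc 0]"
proof -
  show "sdegen X 0 0 = ap 0 (Suc 0) [0]"
    unfolding sdegen_def ap_def degen_map_def by (simp cong: restrict_cong)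
  have "extra_degen_map 0 = restrict (nth [Suc 0]) {..0}"
    by (rule ext) (simp add: extra_degen_map_def compose_def cyc_map_def degen_map_def restrict_def)
  then show "sdegen X 0 (Suc 0) = ap 0 (Suc 0) [Suc 0]"
    by (simp add: sdegen_def ap_def)
  have "transp_map 2 (Suc 0) = restrict (nth [0, 2, Suc 0]) {..2}"
    unfolding transp_map_def by (rule restrict_list_eqI) (auto simp: upt_rec transpose_def)
  then show "theta X 2 (Suc 0) = ap 2 2 [0, 2, Suc 0]"
    by (simp add: theta_def ap_def)
qed

lemma segal: "two_segal X"
  using X by (simp add: two_segal_cosyms_def)

lemmas ap_simps = ap_ap ap_in ap_ids faces degens

lemma segal3: "bij_betw (\<lambda>w. (dface X 3 3 w, dface X 3 1 w)) (lev X 3)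
      {(x, y) \<in> lev X 2 \<times> lev X 2. dface X 2 1 x = dface X 2 2 y}"
    "bij_betw (\<lambda>w. (dface X 3 0 w, dface X 3 2 w)) (lev X 3)
      {(x, y) \<in> lev X 2 \<times> lev X 2. dface X 2 1 x = dface X 2 0 y}"
proof -
  \<comment> \<open>The 2-Segal maps list the two faces in the opposite order to the
    associator.\<close>
  have sw: "bij_betw (\<lambda>w. (g w, f w)) A {(x, y) \<in> B \<times> B. q x = p y}"
    if "bij_betw (\<lambda>w. (f w, g w)) A {(x, y) \<in> B \<times> B. p x = q y}" for f g A B p q
  proof -
    have "bij_betw prod.swap {(x, y) \<in> B \<times> B. p x = q y} {(x, y) \<in> B \<times> B. q x = p y}"
      by (rule bij_betw_byWitness[of _ prod.swap]) auto
    from bij_betw_trans[OF that this] show ?thesis by (simp add: comp_def)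
  qed
  have "(0::nat) < 1 \<and> (1::nat) < 2" by simp
  note s = segal[unfolded two_segal_def, rule_format, OF this]
  show "bij_betw (\<lambda>w. (dface X 3 3 w, dface X 3 1 w)) (lev X 3)
      {(x, y) \<in> lev X 2 \<times> lev X 2. dface X 2 1 x = dface X 2 2 y}"
    using sw[OF conjunct2[OF s]] by simp
  show "bij_betw (\<lambda>w. (dface X 3 0 w, dface X 3 2 w)) (lev X 3)
      {(x, y) \<in> lev X 2 \<times> lev X 2. dface X 2 1 x = dface X 2 0 y}"
    using sw[OF conjunct1[OF s]] by (simp add: numeral_2_eq_2 numeral_3_eq_3)
qed

lemma segal3_inj: "w \<in> lev X 3 \<Longrightarrow> w' \<in> lev X 3 \<Longrightarrow>
    ap 3 2 [0, Suc 0, 2, 0] w = ap 3 2 [0, Suc 0, 2, 0] w' \<Longrightarrow>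
    ap 3 2 [0, Suc 0, Suc 0, 2] w = ap 3 2 [0, Suc 0, Suc 0, 2] w' \<Longrightarrow> w = w'"
  using bij_betw_imp_inj_on[OF segal3(1)] by (auto simp: inj_on_def faces)

lemma segal3_ex: "\<alpha> \<in> lev X 2 \<Longrightarrow> \<beta> \<in> lev X 2 \<Longrightarrow>
    ap 2 (Suc 0) [0, Suc 0, Suc 0] \<alpha> = ap 2 (Suc 0) [0, Suc 0, 0] \<beta> \<Longrightarrow>
    \<exists>w\<in>lev X 3. \<alpha> = ap 3 2 [0, Suc 0, 2, 0] w \<and> \<beta> = ap 3 2 [0, Suc 0, Suc 0, 2] w"
  using bij_betw_imp_surj_on[OF segal3(1)] by (force simp: faces image_def set_eq_iff)

lemma segal4_ex: "v \<in> lev X 3 \<Longrightarrow> w \<in> lev X 3 \<Longrightarrow>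
    ap 3 2 [0, Suc 0, 2, 0] v = ap 3 2 [0, Suc 0, Suc 0, 2] w \<Longrightarrow>
    \<exists>z\<in>lev X 4. v = ap 4 3 [0, Suc 0, Suc 0, 2, 3] z \<and> w = ap 4 3 [0, Suc 0, 2, 3, 0] z"
proof -
  assume vw: "v \<in> lev X 3" "w \<in> lev X 3" "ap 3 2 [0, Suc 0, 2, 0] v = ap 3 2 [0, Suc 0, Suc 0, 2] w"
  have "(0::nat) < 1 \<and> (1::nat) < 3" by simp
  note s = segal[unfolded two_segal_def, rule_format, OF this, THEN conjunct2]
  have "(v, w) \<in> (\<lambda>w. (dface X (3 + 1) 1 w, dface X (3 + 1) (3 + 1) w)) ` lev X (3 + 1)"
    unfolding bij_betw_imp_surj_on[OF s] using vw by (simp add: faces)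
  then show ?thesis by (auto simp: faces)
qed

abbreviation "P \<equiv> cf_of_cosym X"

lemma cf_sel: "Ob P = lev X 1" "Mul P = lev X 2" "Unt P = lev X 0" "Cou P = lev X 0"
    "lleg P = dface X 2 2" "rleg P = dface X 2 0" "pleg P = dface X 2 1" "uleg P = sdegen X 0 0"
    "braid P = theta X 2 1" "cleg P = sdegen X 0 1"
  by (simp_all add: cf_of_cosym_def)

lemma assoc_eq: "w \<in> lev X 3 \<Longrightarrow> assoc P (ap 3 2 [0, Suc 0, 2, 0] w, ap 3 2 [0, Suc 0, Suc 0, 2] w) =
    (ap 3 2 [0, 0, Suc 0, 2] w, ap 3 2 [0, Suc 0, 2, 2] w)"
  using assoc_cf_of_cosym[OF segal] by (simp add: faces)

lemma assocE:
  assumes "\<alpha> \<in> lev X 2" "\<beta> \<in> lev X 2" "pleg P \<alpha> = lleg P \<beta>"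
  obtains w where "w \<in> lev X 3" "\<alpha> = ap 3 2 [0, Suc 0, 2, 0] w" "\<beta> = ap 3 2 [0, Suc 0, Suc 0, 2] w"
    "assoc P (\<alpha>, \<beta>) = (ap 3 2 [0, 0, Suc 0, 2] w, ap 3 2 [0, Suc 0, 2, 2] w)"
  using segal3_ex[of \<alpha> \<beta>] assms assoc_eq by (auto simp: cf_sel faces)

text \<open>Two ways of including \<open>\<alpha>\<close> in level 3, with the middle vertex sent to 1 or to 2, have the same
  faces over two disjoint pairs because the leg over the first vertex is degenerate. So they agree, and
  merging 2 with 0 gives the claim.\<close>

lemma unit_degenerate:
  assumes \<alpha>: "\<alpha> \<in> lev X 2" and u: "u \<in> lev X 0" "ap 2 (Suc 0) [0, Suc 0, 0] \<alpha> = ap 0 (Suc 0) [0] u"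
  shows "ap 2 2 [0, 0, 2] \<alpha> = \<alpha>"
proof -
  have c: "ap 2 2 [0, k, 0] \<alpha> = ap 0 2 [0] u" if "k \<le> 2" for k
    using arg_cong[OF u(2), of "ap (Suc 0) 2 [0, k]"] \<alpha> u(1) that by (simp add: ap_simps)
  have "ap 2 3 [0, Suc 0, 3] \<alpha> = ap 2 3 [0, 2, 3] \<alpha>"
    by (rule segal3_inj) (use \<alpha> u(1) c in \<open>simp_all add: ap_simps\<close>)
  from arg_cong[OF this, of "ap 3 2 [0, Suc 0, 0, 2]"] show ?thesis
    using \<alpha> by (simp add: ap_simps)
qed

lemma runit_degenerate:
  assumes \<alpha>: "\<alpha> \<in> lev X 2" and u: "u \<in> lev X 0" "ap 2 (Suc 0) [0, 0, Suc 0] \<alpha> = ap 0 (Suc 0) [0] u"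
  shows "ap 2 2 [0, Suc 0, 0] \<alpha> = \<alpha>"
proof -
  have "ap 2 2 [0, 0, 2] (ap 2 2 [0, 2, Suc 0] \<alpha>) = ap 2 2 [0, 2, Suc 0] \<alpha>"
    by (rule unit_degenerate) (use \<alpha> u in \<open>simp_all add: ap_simps\<close>)
  from arg_cong[OF this, of "ap 2 2 [0, 2, Suc 0]"] show ?thesis
    using \<alpha> by (simp add: ap_simps)
qed

text \<open>Interchanging 0 and 1 turns a counit in the product into a unit in the left leg, which
  reduces the claim to \<open>unit_degenerate\<close>.\<close>

lemma counit_degenerate:
  assumes \<alpha>: "\<alpha> \<in> lev X 2" and u: "u \<in> lev X 0" "ap 2 (Suc 0) [0, Suc 0, Suc 0] \<alpha> = ap 0 (Suc 0) [Suc 0] u"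
  shows "ap 2 2 [Suc 0, Suc 0, 2] \<alpha> = \<alpha>" "ap 2 2 [2, Suc 0, 2] \<alpha> = \<alpha>"
proof -
  have "ap 2 (Suc 0) [Suc 0, 0, 0] \<alpha> = ap 0 (Suc 0) [0] u"
    using arg_cong[OF u(2), of "ap (Suc 0) (Suc 0) [Suc 0, 0]"] \<alpha> u(1) by (simp add: ap_simps)
  then have "ap 2 2 [0, 0, 2] (ap 2 2 [Suc 0, 0, 2] \<alpha>) = ap 2 2 [Suc 0, 0, 2] \<alpha>"
    by (intro unit_degenerate[OF _ u(1)]) (use \<alpha> in \<open>simp_all add: ap_simps\<close>)
  from arg_cong[OF this, of "ap 2 2 [Suc 0, 0, 2]"] show *: "ap 2 2 [Suc 0, Suc 0, 2] \<alpha> = \<alpha>"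
    using \<alpha> by (simp add: ap_simps)
  have "ap 2 2 [2, Suc 0, 2] (ap 2 2 [Suc 0, Suc 0, 2] \<alpha>) = ap 2 2 [Suc 0, Suc 0, 2] \<alpha>"
    using \<alpha> by (simp add: ap_simps)
  then show "ap 2 2 [2, Suc 0, 2] \<alpha> = \<alpha>" using * by simp
qed

section \<open>The axioms of a commutative Frobenius pseudomonoid\<close>

lemma cf_associator: "associator P"
proof -
  have lc: "left_comps P = {(x, y) \<in> lev X 2 \<times> lev X 2. dface X 2 1 x = dface X 2 2 y}"
    and rc: "right_comps P = {(x, y) \<in> lev X 2 \<times> lev X 2. dface X 2 1 x = dface X 2 0 y}"
    by (auto simp: left_comps_def right_comps_def cf_sel)
  have "bij_betw (assoc P \<circ> (\<lambda>w. (dface X 3 3 w, dface X 3 1 w))) (lev X 3) (right_comps P)"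
    using segal3(2) unfolding rc
    by (rule bij_betw_cong[THEN iffD1, rotated]) (simp add: assoc_cf_of_cosym[OF segal, symmetric])
  then have "bij_betw (assoc P) (left_comps P) (right_comps P)"
    using bij_betw_comp_iff[OF segal3(1)] unfolding lc by blast
  moreover have "lleg P \<alpha> = lleg P \<beta>' \<and> rleg P \<alpha> = lleg P \<alpha>' \<and> rleg P \<beta> = rleg P \<alpha>' \<and> pleg P \<beta> = pleg P \<beta>'"
    if "(\<alpha>, \<beta>) \<in> left_comps P" "assoc P (\<alpha>, \<beta>) = (\<alpha>', \<beta>')" for \<alpha> \<beta> \<alpha>' \<beta>'
  proof -
    have "\<alpha> \<in> lev X 2" "\<beta> \<in> lev X 2" "pleg P \<alpha> = lleg P \<beta>" using that(1) by (auto simp: lc cf_sel)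
    then show ?thesis
      by (rule assocE) (use that(2) in \<open>auto simp: cf_sel ap_simps\<close>)
  qed
  ultimately show ?thesis unfolding associator_def by blast
qed

lemma cf_unitors: "unitors P"
proof -
  have m: "a = b" if "a \<in> lev X 0" "b \<in> lev X 0" "ap 0 (Suc 0) [0] a = ap 0 (Suc 0) [0] b" for a b
  proof -
    have "ap (Suc 0) 0 [0, 0] (ap 0 (Suc 0) [0] v) = v" if "v \<in> lev X 0" for v
      using that by (simp add: ap_simps)
    with that show ?thesis by metis
  qed
  have l: "ap 2 2 [0, 0, 2] \<alpha> = \<alpha>" if "\<alpha> \<in> lev X 2" "u \<in> lev X 0" "lleg P \<alpha> = uleg P u" for \<alpha> u
    using unit_degenerate[OF that(1,2)] that(3) by (simp add: cf_sel faces degens)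
  have r: "ap 2 2 [0, Suc 0, 0] \<alpha> = \<alpha>" if "\<alpha> \<in> lev X 2" "u \<in> lev X 0" "rleg P \<alpha> = uleg P u" for \<alpha> u
    using runit_degenerate[OF that(1,2)] that(3) by (simp add: cf_sel faces degens)
  have 1: "rleg P \<alpha> = pleg P \<alpha>" if "\<alpha> \<in> lev X 2" "u \<in> lev X 0" "lleg P \<alpha> = uleg P u" for \<alpha> u
    using arg_cong[OF l[OF that], of "ap 2 (Suc 0) [0, Suc 0, Suc 0]"] that(1) by (simp add: cf_sel ap_simps)
  have 2: "lleg P \<alpha> = pleg P \<alpha>" if "\<alpha> \<in> lev X 2" "u \<in> lev X 0" "rleg P \<alpha> = uleg P u" for \<alpha> u
    using arg_cong[OF r[OF that], of "ap 2 (Suc 0) [0, Suc 0, Suc 0]"] that(1) by (simp add: cf_sel ap_simps)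
  have 3: "bij_betw (\<lambda>(u, \<alpha>). rleg P \<alpha>) {(u, \<alpha>) \<in> Unt P \<times> Mul P. lleg P \<alpha> = uleg P u} (Ob P)"
  proof (rule bij_betw_byWitness[where f' = "\<lambda>x. (ap (Suc 0) 0 [0, 0] x, ap (Suc 0) 2 [0, 2] x)"])
    show "\<forall>p\<in>{(u, \<alpha>) \<in> Unt P \<times> Mul P. lleg P \<alpha> = uleg P u}.
      (ap (Suc 0) 0 [0, 0] (case p of (u, \<alpha>) \<Rightarrow> rleg P \<alpha>), ap (Suc 0) 2 [0, 2] (case p of (u, \<alpha>) \<Rightarrow> rleg P \<alpha>)) = p"
    proof clarify
      fix u \<alpha> assume "u \<in> Unt P" "\<alpha> \<in> Mul P" and e: "lleg P \<alpha> = uleg P u"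
      then have u: "u \<in> lev X 0" and \<alpha>: "\<alpha> \<in> lev X 2" by (auto simp: cf_sel)
      show "ap (Suc 0) 0 [0, 0] (rleg P \<alpha>) = u \<and> ap (Suc 0) 2 [0, 2] (rleg P \<alpha>) = \<alpha>"
        using l[OF \<alpha> u e] arg_cong[OF e, of "ap (Suc 0) 0 [0, 0]"] u \<alpha> by (simp add: cf_sel ap_simps)
    qed
  qed (auto simp: cf_sel ap_simps)
  have 4: "bij_betw (\<lambda>(\<alpha>, u). lleg P \<alpha>) {(\<alpha>, u) \<in> Mul P \<times> Unt P. rleg P \<alpha> = uleg P u} (Ob P)"
  proof (rule bij_betw_byWitness[where f' = "\<lambda>x. (ap (Suc 0) 2 [0, Suc 0] x, ap (Suc 0) 0 [0, 0] x)"])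
    show "\<forall>p\<in>{(\<alpha>, u) \<in> Mul P \<times> Unt P. rleg P \<alpha> = uleg P u}.
      (ap (Suc 0) 2 [0, Suc 0] (case p of (\<alpha>, u) \<Rightarrow> lleg P \<alpha>), ap (Suc 0) 0 [0, 0] (case p of (\<alpha>, u) \<Rightarrow> lleg P \<alpha>)) = p"
    proof clarify
      fix u \<alpha> assume "u \<in> Unt P" "\<alpha> \<in> Mul P" and e: "rleg P \<alpha> = uleg P u"
      then have u: "u \<in> lev X 0" and \<alpha>: "\<alpha> \<in> lev X 2" by (auto simp: cf_sel)
      show "ap (Suc 0) 2 [0, Suc 0] (lleg P \<alpha>) = \<alpha> \<and> ap (Suc 0) 0 [0, 0] (lleg P \<alpha>) = u"
        using r[OF \<alpha> u e] arg_cong[OF e, of "ap (Suc 0) 0 [0, 0]"] u \<alpha> by (simp add: cf_sel ap_simps)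
    qed
  qed (auto simp: cf_sel ap_simps)
  show ?thesis
    unfolding unitors_def using 1 2 3 4 cf_sel(2,3) by blast
qed

lemma cf_pentagon: "pentagon P"
  unfolding pentagon_def
proof (intro ballI allI impI, elim conjE)
  fix \<alpha> \<beta> \<gamma> \<alpha>' \<beta>' \<gamma>2 \<delta> \<epsilon> \<zeta> \<epsilon>t \<beta>t \<zeta>t \<delta>t
  assume m: "\<alpha> \<in> Mul P" "\<beta> \<in> Mul P" "\<gamma> \<in> Mul P" and l: "pleg P \<alpha> = lleg P \<beta>" "pleg P \<beta> = lleg P \<gamma>"
    and a: "assoc P (\<alpha>, \<beta>) = (\<alpha>', \<beta>')" "assoc P (\<beta>', \<gamma>) = (\<gamma>2, \<delta>)" "assoc P (\<alpha>', \<gamma>2) = (\<epsilon>, \<zeta>)"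
      "assoc P (\<beta>, \<gamma>) = (\<epsilon>t, \<beta>t)" "assoc P (\<alpha>, \<beta>t) = (\<zeta>t, \<delta>t)"
  obtain w where w: "w \<in> lev X 3" "\<alpha> = ap 3 2 [0, Suc 0, 2, 0] w" "\<beta> = ap 3 2 [0, Suc 0, Suc 0, 2] w"
    using segal3_ex[of \<alpha> \<beta>] m l by (auto simp: cf_sel faces)
  obtain v where v: "v \<in> lev X 3" "\<beta> = ap 3 2 [0, Suc 0, 2, 0] v" "\<gamma> = ap 3 2 [0, Suc 0, Suc 0, 2] v"
    using segal3_ex[of \<beta> \<gamma>] m l by (auto simp: cf_sel faces)
  obtain z where z: "z \<in> lev X 4" "v = ap 4 3 [0, Suc 0, Suc 0, 2, 3] z" "w = ap 4 3 [0, Suc 0, 2, 3, 0] z"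
    using segal4_ex[of v w] v w by auto
  \<comment> \<open>An element \<open>z\<close> on five points has five merges along cyclic
    neighbours; each gives a tetrahedron and hence one edge of the pentagon.\<close>
  have q: "assoc P (ap 4 2 (map (nth [0, Suc 0, 2, 0]) fs) z, ap 4 2 (map (nth [0, Suc 0, Suc 0, 2]) fs) z) =
      (ap 4 2 (map (nth [0, 0, Suc 0, 2]) fs) z, ap 4 2 (map (nth [0, Suc 0, 2, 2]) fs) z)"
    if "length fs = 5" "set fs \<subseteq> {..3}" for fs
    using assoc_eq[of "ap 4 3 fs z"] z(1) that by (simp add: ap_ap ap_in)
  have abc: "\<alpha> = ap 4 2 [0, Suc 0, 2, 0, 0] z" "\<beta> = ap 4 2 [0, Suc 0, Suc 0, 2, 0] z"
    "\<gamma> = ap 4 2 [0, Suc 0, Suc 0, Suc 0, 2] z"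
    using w v z by (simp_all add: ap_simps)
  have 1: "\<alpha>' = ap 4 2 [0, 0, Suc 0, 2, 0] z" "\<beta>' = ap 4 2 [0, Suc 0, 2, 2, 0] z"
    using a(1) q[of "[0, Suc 0, 2, 3, 0]"] abc by simp_all
  have 2: "\<gamma>2 = ap 4 2 [0, 0, Suc 0, Suc 0, 2] z" "\<delta> = ap 4 2 [0, Suc 0, 2, 2, 2] z"
    using a(2) q[of "[0, Suc 0, 2, 2, 3]"] abc 1 by simp_all
  have 3: "\<epsilon> = ap 4 2 [0, 0, 0, Suc 0, 2] z" "\<zeta> = ap 4 2 [0, 0, Suc 0, 2, 2] z"
    using a(3) q[of "[0, 0, Suc 0, 2, 3]"] 1 2 by simp_all
  have 4: "\<epsilon>t = ap 4 2 [0, 0, 0, Suc 0, 2] z" "\<beta>t = ap 4 2 [0, Suc 0, Suc 0, 2, 2] z"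
    using a(4) q[of "[0, Suc 0, Suc 0, 2, 3]"] abc by simp_all
  have 5: "\<zeta>t = ap 4 2 [0, 0, Suc 0, 2, 2] z" "\<delta>t = ap 4 2 [0, Suc 0, 2, 2, 2] z"
    using a(5) q[of "[0, Suc 0, 2, 3, 3]"] abc 4 by simp_all
  show "(\<epsilon>, \<zeta>, \<delta>) = (\<epsilon>t, \<zeta>t, \<delta>t)" using 2 3 4 5 by simp
qed

lemma cf_triangle: "triangle P"
  unfolding triangle_def
proof (intro ballI allI impI, elim conjE bexE)
  fix \<alpha> \<beta> \<alpha>' \<beta>' u
  assume "\<alpha> \<in> Mul P" "\<beta> \<in> Mul P" "u \<in> Unt P" and e: "rleg P \<alpha> = uleg P u" and l: "pleg P \<alpha> = lleg P \<beta>"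
    and a: "assoc P (\<alpha>, \<beta>) = (\<alpha>', \<beta>')"
  then have m: "\<alpha> \<in> lev X 2" "\<beta> \<in> lev X 2" "u \<in> lev X 0" by (auto simp: cf_sel)
  have d: "ap 2 2 [0, Suc 0, 0] \<alpha> = \<alpha>"
    using runit_degenerate[OF m(1,3)] e by (simp add: cf_sel faces degens)
  have "ap 2 2 [0, Suc 0, Suc 0] \<alpha> = ap 2 2 [0, Suc 0, 0] \<beta>"
    using arg_cong[OF l, of "ap (Suc 0) 2 [0, Suc 0]"] m by (simp add: cf_sel ap_simps)
  moreover have "ap 2 2 [0, Suc 0, Suc 0] (ap 2 2 [0, Suc 0, 0] \<alpha>) = ap 2 2 [0, Suc 0, 0] \<alpha>"
    using m by (simp add: ap_simps)
  then have "ap 2 2 [0, Suc 0, Suc 0] \<alpha> = \<alpha>" using d by simp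
  \<comment> \<open>The witness is \<beta> with its last point moved to 3. Its face d3 is \<alpha>,
    because \<alpha> is degenerate, and its faces d1 and d2 are both \<beta>.\<close>
  ultimately show "\<beta>' = \<beta>"
    using a assoc_eq[of "ap 2 3 [0, Suc 0, 3] \<beta>"] m by (simp add: ap_simps)
qed

lemma cf_commutative: "commutative_structure P"
  unfolding commutative_structure_def
proof (intro conjI ballI allI impI, goal_cases)
  case 1
  show ?case
    by (rule bij_betw_byWitness[where f' = "ap 2 2 [0, 2, Suc 0]"]) (auto simp: cf_sel ap_simps)
next
  case (6 \<alpha> \<beta> \<alpha>' \<beta>' \<alpha>2 \<beta>2 \<alpha>3 \<beta>3)
  then obtain w where w: "w \<in> lev X 3" "\<alpha> = ap 3 2 [0, Suc 0, 2, 0] w" "\<beta> = ap 3 2 [0, Suc 0, Suc 0, 2] w"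
    using segal3_ex[of \<alpha> \<beta>] by (auto simp: cf_sel faces)
  have 1: "\<alpha>' = ap 3 2 [0, 0, Suc 0, 2] w" "\<beta>' = ap 3 2 [0, Suc 0, 2, 2] w"
    using 6 w assoc_eq[OF w(1)] by auto
  \<comment> \<open>The other two associators of the hexagon come from the same tetrahedron with its
    points permuted.\<close>
  have "\<alpha>2 = ap 3 2 [0, 2, 0, Suc 0] w \<and> \<beta>2 = ap 3 2 [0, 2, Suc 0, 2] w"
    using 6 w 1 assoc_eq[of "ap 3 3 [0, 3, Suc 0, 2] w"] by (simp add: cf_sel ap_simps)
  moreover have "\<alpha>3 = ap 3 2 [0, Suc 0, 0, 2] w \<and> \<beta>3 = ap 3 2 [0, 2, Suc 0, 2] w"
    using 6 w assoc_eq[of "ap 3 3 [0, 2, Suc 0, 3] w"] by (simp add: cf_sel ap_simps)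
  ultimately show ?case using w(1) by (simp add: cf_sel ap_simps)
qed (simp_all add: cf_sel ap_simps)

text \<open>An element whose product is a counit is fixed by the idempotents of
  \<open>counit_degenerate\<close>, so either leg recovers it.\<close>

lemma cf_frobenius: "frobenius_structure P"
proof -
  define B where "B = {(\<alpha>, v) \<in> Mul P \<times> Cou P. pleg P \<alpha> = cleg P v}"
  have B: "\<alpha> \<in> lev X 2 \<and> v \<in> lev X 0 \<and> ap 2 2 [Suc 0, Suc 0, 2] \<alpha> = \<alpha> \<and> ap 2 2 [2, Suc 0, 2] \<alpha> = \<alpha> \<and>
      v = ap 2 0 [0, 0, 0] \<alpha>" if "(\<alpha>, v) \<in> B" for \<alpha> v
  proof -
    have m: "\<alpha> \<in> lev X 2" "v \<in> lev X 0" and e: "ap 2 (Suc 0) [0, Suc 0, Suc 0] \<alpha> = ap 0 (Suc 0) [Suc 0] v"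
      using that by (auto simp: B_def cf_sel faces degens)
    have "v = ap 2 0 [0, 0, 0] \<alpha>"
      using arg_cong[OF e, of "ap (Suc 0) 0 [0, 0]"] m by (simp add: ap_simps)
    with counit_degenerate[OF m e] m show ?thesis by simp
  qed
  have 1: "bij_betw (\<lambda>(\<alpha>, v). lleg P \<alpha>) B (Ob P)"
  proof (rule bij_betw_byWitness[where f' = "\<lambda>x. (ap (Suc 0) 2 [2, Suc 0] x, ap (Suc 0) 0 [0, 0] x)"])
    show "\<forall>p\<in>B. (ap (Suc 0) 2 [2, Suc 0] (case p of (\<alpha>, v) \<Rightarrow> lleg P \<alpha>),
        ap (Suc 0) 0 [0, 0] (case p of (\<alpha>, v) \<Rightarrow> lleg P \<alpha>)) = p"
      using B by (auto simp: cf_sel ap_simps)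
  qed (auto simp: B_def cf_sel ap_simps)
  have 2: "bij_betw (\<lambda>(\<alpha>, v). rleg P \<alpha>) B (Ob P)"
  proof (rule bij_betw_byWitness[where f' = "\<lambda>x. (ap (Suc 0) 2 [Suc 0, 2] x, ap (Suc 0) 0 [0, 0] x)"])
    show "\<forall>p\<in>B. (ap (Suc 0) 2 [Suc 0, 2] (case p of (\<alpha>, v) \<Rightarrow> rleg P \<alpha>),
        ap (Suc 0) 0 [0, 0] (case p of (\<alpha>, v) \<Rightarrow> rleg P \<alpha>)) = p"
      using B by (auto simp: cf_sel ap_simps)
  qed (auto simp: B_def cf_sel ap_simps)
  show ?thesis
    using 1 2 by (auto simp: frobenius_structure_def B_def cf_sel ap_simps Let_def)
qed

lemma cf_of_cosym_cf: "P \<in> comm_frob_pseudomonoids"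
proof -
  have "well_typed_spans P"
    by (auto simp: well_typed_spans_def cf_sel ap_simps)
  then show ?thesis
    using cf_associator cf_unitors cf_pentagon cf_triangle cf_commutative cf_frobenius
    by (simp add: comm_frob_pseudomonoids_def pseudomonoid_def)
qed

end

section \<open>Recovering a cosymmetric set from its pseudomonoid\<close>

fun num :: "three \<Rightarrow> nat" where "num T0 = 0" | "num T1 = Suc 0" | "num T2 = 2"
fun num4 :: "four \<Rightarrow> nat" where "num4 Q0 = 0" | "num4 Q1 = Suc 0" | "num4 Q2 = 2" | "num4 Q3 = 3"

text \<open>Evaluating a family at \<open>iota\<close> gives its underlying element at the points 0,
  1, 2.\<close>

definition iota :: "nat \<Rightarrow> three" where "iota k = (if k = 0 then T0 else if k = 1 then T1 else T2)"

lemma iota_simps [simp]: "iota 0 = T0" "iota (Suc 0) = T1" "iota 2 = T2"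
  by (simp_all add: iota_def)

lemma num_le [simp]: "num i \<le> 2"
  by (cases i) auto

lemma num4_le [simp]: "num4 i \<le> 3"
  by (cases i) auto

lemma atMost_cases: "k \<le> Suc 0 \<Longrightarrow> k = 0 \<or> k = Suc 0" "k \<le> 2 \<Longrightarrow> k = 0 \<or> k = Suc 0 \<or> k = 2"
    "k \<le> 3 \<Longrightarrow> k = 0 \<or> k = Suc 0 \<or> k = 2 \<or> k = 3"
  for k :: nat by auto

context segal_cosym
begin

sublocale cf: cf_pseudomonoid P
  by unfold_locales (rule cf_of_cosym_cf)

lemma cf_lunit: "x \<in> lev X (Suc 0) \<Longrightarrow> cf.lunit x = ap (Suc 0) 2 [0, 2] x"
proof -
  assume x: "x \<in> lev X (Suc 0)"
  have "lleg P (ap (Suc 0) 2 [0, 2] x) = uleg P (ap (Suc 0) 0 [0, 0] x)"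
    using x by (simp add: cf_sel ap_simps)
  then have "lleg P (ap (Suc 0) 2 [0, 2] x) \<in> uleg P ` Unt P"
    by (rule image_eqI) (use x in \<open>simp add: cf_sel ap_simps\<close>)
  from cf.lunit_eqI[OF _ this] show ?thesis using x by (simp add: cf_sel ap_simps)
qed

lemma cf_bet: "x \<in> lev X (Suc 0) \<Longrightarrow> cf.bet x = ap (Suc 0) 2 [2, Suc 0] x"
proof -
  assume x: "x \<in> lev X (Suc 0)"
  have "pleg P (ap (Suc 0) 2 [2, Suc 0] x) = cleg P (ap (Suc 0) 0 [0, 0] x)"
    using x by (simp add: cf_sel ap_simps)
  then have "pleg P (ap (Suc 0) 2 [2, Suc 0] x) \<in> cleg P ` Cou P"
    by (rule image_eqI) (use x in \<open>simp add: cf_sel ap_simps\<close>)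
  from cf.bet_eqI[OF _ this] show ?thesis using x by (simp add: cf_sel ap_simps)
qed

lemma cf_ops: "x \<in> lev X (Suc 0) \<Longrightarrow> cf.runit x = ap (Suc 0) 2 [0, Suc 0] x"
    "x \<in> lev X (Suc 0) \<Longrightarrow> cf.eps x = ap (Suc 0) (Suc 0) [0, 0] x"
    "x \<in> lev X (Suc 0) \<Longrightarrow> cf.tau x = ap (Suc 0) (Suc 0) [Suc 0, 0] x"
  by (simp_all add: cf.runit_def cf.eps_def cf.tau_def cf_lunit cf_bet cf_sel ap_simps)

text \<open>The tetrahedron is \<alpha> with its point 0 moved to 3: d3 restores \<alpha>, d1 is the
  pairing at the product, and d0 is the rotation.\<close>

lemma cf_kap: "\<alpha> \<in> lev X 2 \<Longrightarrow> cf.kap \<alpha> = ap 2 2 [2, 0, Suc 0] \<alpha>"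
  using assoc_eq[of "ap 2 3 [3, Suc 0, 2] \<alpha>"]
  by (simp add: cf.kap_def cf_sel cf_bet ap_simps)

text \<open>The action rebuilt from associator, braiding and counit is the original one, so the seed
  of \<open>P\<close> is the low-dimensional part of \<open>X\<close>.\<close>

lemma cf_t: "\<alpha> \<in> lev X 2 \<Longrightarrow> cf.t g \<alpha> = ap 2 2 [num (g T0), num (g T1), num (g T2)] \<alpha>"
  unfolding cf.t_def
  by (cases "g T0"; cases "g T1"; cases "g T2")
    (simp_all add: cf_ops cf_kap cf_lunit cf_bet cf_sel ap_simps)

lemma cf_As: "w \<in> lev X 3 \<Longrightarrow> cf.As (ap 3 2 [0, Suc 0, 2, 0] w) (ap 3 2 [0, Suc 0, Suc 0, 2] w)
    (ap 3 2 [0, 0, Suc 0, 2] w) (ap 3 2 [0, Suc 0, 2, 2] w)"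
  by (simp add: cf.As_def assoc_eq) (simp add: cf_sel ap_simps)

definition psh :: "nat \<Rightarrow> nat \<Rightarrow> (nat \<Rightarrow> nat) \<Rightarrow> 'a \<Rightarrow> 'a" where
  "psh m n F = act X m n (restrict F {..m})"

lemma psh_in: "x \<in> lev X m \<Longrightarrow> (\<And>k. k \<le> m \<Longrightarrow> F k \<le> n) \<Longrightarrow> psh m n F x \<in> lev X n"
  unfolding psh_def by (rule act_in) (auto simp: Phi_def)

lemma psh_psh:
  "x \<in> lev X m \<Longrightarrow> (\<And>k. k \<le> m \<Longrightarrow> F k \<le> n) \<Longrightarrow> (\<And>k. k \<le> n \<Longrightarrow> G k \<le> p) \<Longrightarrow>
    psh n p G (psh m n F x) = psh m p (\<lambda>k. G (F k)) x"
proof -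
  assume x: "x \<in> lev X m" and F: "\<And>k. k \<le> m \<Longrightarrow> F k \<le> n" and G: "\<And>k. k \<le> n \<Longrightarrow> G k \<le> p"
  have "compose {..m} (restrict G {..n}) (restrict F {..m}) = restrict (\<lambda>k. G (F k)) {..m}"
    using F by (auto simp: compose_def)
  moreover have "restrict F {..m} \<in> Phi m n" "restrict G {..n} \<in> Phi n p"
    using F G by (auto simp: Phi_def)
  ultimately show ?thesis unfolding psh_def using act_comp x by metis
qed

lemma psh_cong: "(\<And>k. k \<le> m \<Longrightarrow> F k = G k) \<Longrightarrow> psh m n F x = psh m n G x"
proof -
  assume "\<And>k. k \<le> m \<Longrightarrow> F k = G k"
  then have "restrict F {..m} = restrict G {..m}" by auto
  then show ?thesis by (simp add: psh_def)
qed

lemma psh_id: "x \<in> lev X m \<Longrightarrow> (\<And>k. k \<le> m \<Longrightarrow> F k = k) \<Longrightarrow> psh m m F x = x"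
  using psh_cong[of m F "\<lambda>k. k"] act_id[of x m] by (simp add: psh_def)

lemma psh_act: "F \<in> Phi m n \<Longrightarrow> psh m n F x = act X m n F x"
proof -
  assume "F \<in> Phi m n"
  then have "restrict F {..m} = F" by (simp add: Phi_def PiE_restrict)
  then show ?thesis by (simp add: psh_def)
qed

lemma psh_list: "psh m n (nth fs) = ap m n fs"
  by (simp add: psh_def ap_def)

section \<open>The comparison map to the Kan extension\<close>

definition phi :: "nat \<Rightarrow> 'a \<Rightarrow> (nat \<Rightarrow> three) \<Rightarrow> 'a" where
  "phi n x f = psh n 2 (\<lambda>k. num (f k)) x"

lemma phi_in: "x \<in> lev X n \<Longrightarrow> phi n x f \<in> lev X 2"
  by (simp add: phi_def psh_in)

lemma phi_nat: "x \<in> lev X n \<Longrightarrow> cf.t g (phi n x f) = phi n x (\<lambda>k. g (f k))"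
proof -
  assume x: "x \<in> lev X n"
  have n: "[num (g T0), num (g T1), num (g T2)] ! num i = num (g i)" for i
    by (cases i) auto
  have le: "[num (g T0), num (g T1), num (g T2)] ! k \<le> 2" if "k \<le> 2" for k
    using atMost_cases(2)[OF that] by auto
  have "cf.t g (phi n x f) = psh 2 2 (nth [num (g T0), num (g T1), num (g T2)]) (psh n 2 (\<lambda>k. num (f k)) x)"
    using cf_t[OF phi_in[OF x]] by (simp add: psh_list phi_def)
  also have "\<dots> = psh n 2 (\<lambda>k. [num (g T0), num (g T1), num (g T2)] ! num (f k)) x"
    using x le by (intro psh_psh) auto
  finally show ?thesis by (simp add: n phi_def)
qed

lemma phi_flev: "x \<in> lev X n \<Longrightarrow> phi n x \<in> cf.flev n"
proof -
  assume x: "x \<in> lev X n"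
  have "cf.F4 (\<lambda>i j k l. phi n x (\<lambda>s. quad i j k l (q s)))" for q
  proof -
    define y where "y = psh n 3 (\<lambda>k. num4 (q k)) x"
    have y: "y \<in> lev X 3" using x by (simp add: y_def psh_in)
    have py: "phi n x (\<lambda>s. quad i j k l (q s)) = ap 3 2 [num i, num j, num k, num l] y" for i j k l
    proof -
      have n: "[num i, num j, num k, num l] ! num4 a = num (quad i j k l a)" for a
        by (cases a) (auto simp: numeral_3_eq_3)
      have le: "[num i, num j, num k, num l] ! m \<le> 2" if "m \<le> 3" for m
        using atMost_cases(3)[OF that] by (auto simp: numeral_3_eq_3)
      have "ap 3 2 [num i, num j, num k, num l] y = psh n 2 (\<lambda>s. [num i, num j, num k, num l] ! num4 (q s)) x"
        unfolding y_def psh_list[symmetric] using x le by (intro psh_psh) auto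
      then show ?thesis by (simp add: n phi_def)
    qed
    have "cf.natural4 (\<lambda>i j k l. phi n x (\<lambda>s. quad i j k l (q s)))"
      unfolding cf.natural4_def
    proof (intro conjI allI)
      fix g and i j k l :: three
      show "phi n x (\<lambda>s. quad i j k l (q s)) \<in> Mul P" using phi_in[OF x] by (simp add: cf_sel)
      show "phi n x (\<lambda>s. quad (g i) (g j) (g k) (g l) (q s)) = cf.t g (phi n x (\<lambda>s. quad i j k l (q s)))"
        by (simp add: phi_nat[OF x] comp_quad[of g])
    qed
    moreover have "cf.A4 (\<lambda>i j k l. phi n x (\<lambda>s. quad i j k l (q s)))"
      using cf_As[OF y] by (simp add: cf.A4_def py)
    moreover have "cf.A4 (\<lambda>i j k l. phi n x (\<lambda>s. quad i k j l (q s)))"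
      using cf_As[of "ap 3 3 [0, 2, Suc 0, 3] y"] y by (simp add: cf.A4_def py ap_simps)
    ultimately show ?thesis by (simp add: cf.F4_def)
  qed
  then have "phi n x \<in> cf.Fam" by (simp add: cf.Fam_def)
  then show ?thesis
    unfolding cf.flev_def by (auto simp: phi_def intro!: psh_cong)
qed

lemma phi_act:
  assumes "F \<in> Phi m n" "x \<in> lev X m"
  shows "phi n (act X m n F x) = act cf.fcosym m n F (phi m x)"
proof
  fix g
  have "\<And>k. k \<le> m \<Longrightarrow> F k \<le> n" using assms(1) by (auto simp: Phi_def)
  then show "phi n (act X m n F x) g = act cf.fcosym m n F (phi m x) g"
    unfolding phi_def cf.fcosym_def using psh_act[OF assms(1), of x] assms(2)
    by (simp add: phi_def psh_psh flip: psh_act[OF assms(1)])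
qed

lemma phi_inj_low:
  assumes "n \<le> 2"
  shows "inj_on (phi n) (lev X n)"
proof (rule inj_on_inverseI)
  fix x assume x: "x \<in> lev X n"
  show "psh 2 n (\<lambda>k. min k n) (phi n x iota) = x"
  proof -
    have "psh 2 n (\<lambda>k. min k n) (phi n x iota) = psh n n (\<lambda>k. min (num (iota k)) n) x"
      unfolding phi_def using x by (intro psh_psh) auto
    also have "\<dots> = x"
    proof (rule psh_id[OF x])
      fix k assume "k \<le> n"
      then have "k \<le> 2" "k \<le> n" using assms by auto
      then show "min (num (iota k)) n = k"
        using atMost_cases(2)[of k] by auto
    qed
    finally show ?thesis .
  qed
qed

text \<open>Every map from at most three points factors through \<open>iota\<close>, so the value
  there determines \<open>z\<close>.\<close>

lemma phi_surj_low:
  assumes n: "n \<le> 2" and z: "z \<in> cf.flev n"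
  shows "z \<in> phi n ` lev X n"
proof (rule image_eqI)
  have m: "z iota \<in> lev X 2"
    using cf.Fam_in[OF cf.flev_Fam[OF z]] by (simp add: cf_sel)
  show "psh 2 n (\<lambda>k. min k n) (z iota) \<in> lev X n"
    using m by (simp add: psh_in)
  show "z = phi n (psh 2 n (\<lambda>k. min k n) (z iota))"
  proof
    fix f :: "nat \<Rightarrow> three"
    define g where "g = (\<lambda>i. f (min (num i) n))"
    have "phi n (psh 2 n (\<lambda>k. min k n) (z iota)) f = psh 2 2 (\<lambda>k. num (f (min k n))) (z iota)"
      unfolding phi_def using m by (intro psh_psh) auto
    also have "\<dots> = psh 2 2 (nth [num (g T0), num (g T1), num (g T2)]) (z iota)"
    proof (rule psh_cong)
      fix k :: nat assume "k \<le> 2"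
      then show "num (f (min k n)) = [num (g T0), num (g T1), num (g T2)] ! k"
        using atMost_cases(2)[of k] by (auto simp: g_def)
    qed
    also have "\<dots> = cf.t g (z iota)" by (simp add: psh_list cf_t[OF m])
    also have "\<dots> = z (g \<circ> iota)" by (rule cf.Fam_nat[OF cf.flev_Fam[OF z]])
    also have "\<dots> = z f"
    proof (rule cf.flev_cong[OF z])
      fix k assume "k \<le> n"
      then have "k \<le> 2" "k \<le> n" using n by auto
      then show "(g \<circ> iota) k = f k" using atMost_cases(2)[of k] by (auto simp: g_def)
    qed
    finally show "z f = phi n (psh 2 n (\<lambda>k. min k n) (z iota)) f" by simp
  qed
qed

lemma phi_dface: "0 < n \<Longrightarrow> x \<in> lev X n \<Longrightarrow> phi (n - 1) (dface X n i x) = dface cf.fcosym n i (phi n x)"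
  unfolding dface_def by (rule phi_act) (auto simp: Phi_def face_map_def)

lemma dface_in: "0 < n \<Longrightarrow> x \<in> lev X n \<Longrightarrow> dface X n i x \<in> lev X (n - 1)"
  unfolding dface_def by (rule act_in) (auto simp: Phi_def face_map_def)

text \<open>Above level 2 the condition with \<open>i = 1\<close> presents a level on either side as
  a fibre product of lower levels along corresponding faces, and \<open>phi\<close> commutes with
  faces.\<close>

lemma phi_bij: "bij_betw (phi n) (lev X n) (cf.flev n)"
proof (induction n rule: less_induct)
  case (less N)
  show ?case
  proof (cases "N \<le> 2")
    case True
    then show ?thesis
      using phi_inj_low phi_surj_low phi_flev unfolding bij_betw_def by blast
  next
    case False
    define n where "n = N - 1"
    have n: "N = n + 1" "0 < (1::nat) \<and> 1 < n" using False by (auto simp: n_def)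
    note sX = segal[unfolded two_segal_def, rule_format, OF n(2), THEN conjunct1]
    note sF = cf.fcosym_two_segal[unfolded two_segal_def, rule_format, OF n(2), THEN conjunct1]
    have b: "bij_betw (phi n) (lev X n) (cf.flev n)" "bij_betw (phi (n - 1)) (lev X (n - 1)) (cf.flev (n - 1))"
      using less n by auto
    have d: "phi n (dface X (n + 1) i x) = dface cf.fcosym (n + 1) i (phi (n + 1) x)"
       "dface X (n + 1) i x \<in> lev X n" if "x \<in> lev X (n + 1)" for x i
      using phi_dface[of "n + 1" x i] dface_in[of "n + 1" x i] that by auto
    have d': "phi (n - 1) (dface X n i x) = dface cf.fcosym n i (phi n x)"
       "dface X n i x \<in> lev X (n - 1)" if "x \<in> lev X n" for x i
      using phi_dface[of n x i] dface_in[of n x i] n that by auto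
    have flev: "lev cf.fcosym k = cf.flev k" for k by (simp add: cf.fcosym_def)
    have "inj_on (phi (n + 1)) (lev X (n + 1))"
    proof (rule inj_onI)
      fix x y assume x: "x \<in> lev X (n + 1)" and y: "y \<in> lev X (n + 1)" and e: "phi (n + 1) x = phi (n + 1) y"
      have "dface X (n + 1) i x = dface X (n + 1) i y" for i
        using inj_onD[OF bij_betw_imp_inj_on[OF b(1)]] d[OF x] d[OF y] e by simp
      then show "x = y" using inj_onD[OF bij_betw_imp_inj_on[OF sX] _ x y] by simp
    qed
    moreover have "z \<in> phi (n + 1) ` lev X (n + 1)" if z: "z \<in> cf.flev (n + 1)" for z
    proof -
      have "(dface cf.fcosym (n + 1) (1 + 1) z, dface cf.fcosym (n + 1) 0 z) \<in>
          {(x, y) \<in> lev cf.fcosym n \<times> lev cf.fcosym n. dface cf.fcosym n 0 x = dface cf.fcosym n 1 y}"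
        using bij_betwE[OF sF] z unfolding flev by blast
      then obtain u v where uv: "u \<in> cf.flev n" "v \<in> cf.flev n" "dface cf.fcosym n 0 u = dface cf.fcosym n 1 v"
        and z': "dface cf.fcosym (n + 1) (1 + 1) z = u" "dface cf.fcosym (n + 1) 0 z = v"
        by (auto simp: flev)
      obtain x y where x: "x \<in> lev X n" "u = phi n x" and y: "y \<in> lev X n" "v = phi n y"
        using uv bij_betw_imp_surj_on[OF b(1)] by (metis imageE)
      have "dface X n 0 x = dface X n 1 y"
        using inj_onD[OF bij_betw_imp_inj_on[OF b(2)] _ d'(2)[OF x(1), of 0] d'(2)[OF y(1), of 1]]
          uv(3) x y d'(1) by simp
      then have "(x, y) \<in> (\<lambda>w. (dface X (n + 1) (1 + 1) w, dface X (n + 1) 0 w)) ` lev X (n + 1)"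
        unfolding bij_betw_imp_surj_on[OF sX] using x y by simp
      then obtain w where w: "w \<in> lev X (n + 1)" "dface X (n + 1) (1 + 1) w = x" "dface X (n + 1) 0 w = y"
        by blast
      have "phi (n + 1) w = z"
        by (rule inj_onD[OF bij_betw_imp_inj_on[OF sF]])
          (use d[OF w(1)] w x y z z' phi_flev in \<open>auto simp: flev\<close>)
      then show ?thesis using w(1) by blast
    qed
    ultimately show ?thesis
      using phi_flev unfolding bij_betw_def n(1) by blast
  qed
qed

end

section \<open>Transfer along isomorphisms\<close>

locale cf_isomorphism = p: cf_pseudomonoid P + q: cf_pseudomonoid Q
  for P :: "'a cf_pseudomonoid" and Q :: "'a cf_pseudomonoid" +
  fixes f g h k
  assumes bij: "bij_betw f (Ob P) (Ob Q)" "bij_betw g (Mul P) (Mul Q)"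
      "bij_betw h (Unt P) (Unt Q)" "bij_betw k (Cou P) (Cou Q)"
    and legs: "\<And>m. m \<in> Mul P \<Longrightarrow> lleg Q (g m) = f (lleg P m)"
      "\<And>m. m \<in> Mul P \<Longrightarrow> rleg Q (g m) = f (rleg P m)"
      "\<And>m. m \<in> Mul P \<Longrightarrow> pleg Q (g m) = f (pleg P m)"
      "\<And>m. m \<in> Mul P \<Longrightarrow> braid Q (g m) = g (braid P m)"
      "\<And>u. u \<in> Unt P \<Longrightarrow> uleg Q (h u) = f (uleg P u)"
      "\<And>v. v \<in> Cou P \<Longrightarrow> cleg Q (k v) = f (cleg P v)"
    and assoc: "\<And>\<alpha> \<beta>. (\<alpha>, \<beta>) \<in> left_comps P \<Longrightarrow> assoc Q (g \<alpha>, g \<beta>) = map_prod g g (assoc P (\<alpha>, \<beta>))"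
begin

lemma g_in: "m \<in> Mul P \<Longrightarrow> g m \<in> Mul Q"
  using bij bij_betwE by blast

lemma f_inj: "x \<in> Ob P \<Longrightarrow> y \<in> Ob P \<Longrightarrow> f x = f y \<Longrightarrow> x = y"
  and g_inj: "m \<in> Mul P \<Longrightarrow> n \<in> Mul P \<Longrightarrow> g m = g n \<Longrightarrow> m = n"
  using bij by (auto simp: bij_betw_def inj_on_def)

text \<open>The derived operations come from unique existence in terms of the structure, so they are
  preserved as soon as the image satisfies the characterization.\<close>

lemma g_lunit: "x \<in> Ob P \<Longrightarrow> g (p.lunit x) = q.lunit (f x)"
proof -
  assume x: "x \<in> Ob P"
  obtain u where u: "u \<in> Unt P" "lleg P (p.lunit x) = uleg P u" using p.lunit0[OF x] by blast
  then have "lleg Q (g (p.lunit x)) = uleg Q (h u)" using legs x by simp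
  then have "lleg Q (g (p.lunit x)) \<in> uleg Q ` Unt Q" using u(1) bij_betwE[OF bij(3)] by simp
  from q.lunit_eqI[OF _ this] show ?thesis using x legs g_in by simp
qed

lemma g_bet: "x \<in> Ob P \<Longrightarrow> g (p.bet x) = q.bet (f x)"
proof -
  assume x: "x \<in> Ob P"
  obtain v where v: "v \<in> Cou P" "pleg P (p.bet x) = cleg P v" using p.bet0[OF x] by blast
  have "pleg Q (g (p.bet x)) = f (pleg P (p.bet x))" by (rule legs) (use x in simp)
  then have "pleg Q (g (p.bet x)) = cleg Q (k v)" using v legs by simp
  then have "pleg Q (g (p.bet x)) \<in> cleg Q ` Cou Q" using v(1) bij_betwE[OF bij(4)] by simp
  from q.bet_eqI[OF _ this] show ?thesis using x legs g_in by simp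
qed

lemma g_runit: "x \<in> Ob P \<Longrightarrow> g (p.runit x) = q.runit (f x)"
  by (simp add: p.runit_def q.runit_def legs flip: g_lunit)

lemma f_ops: "x \<in> Ob P \<Longrightarrow> f (p.eps x) = q.eps (f x)" "x \<in> Ob P \<Longrightarrow> f (p.tau x) = q.tau (f x)"
  by (simp_all add: p.eps_def q.eps_def p.tau_def q.tau_def del: p.lunit_legs p.bet_legs
      flip: g_lunit g_bet legs)

lemma As_image: "p.As \<alpha> \<beta> \<alpha>' \<beta>' \<Longrightarrow> q.As (g \<alpha>) (g \<beta>) (g \<alpha>') (g \<beta>')"
  using assoc[of \<alpha> \<beta>] by (simp add: p.As_def q.As_def left_comps_def legs g_in)

lemma As_iff:
  assumes "\<alpha> \<in> Mul P" "\<beta> \<in> Mul P" "\<alpha>' \<in> Mul P" "\<beta>' \<in> Mul P"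
  shows "q.As (g \<alpha>) (g \<beta>) (g \<alpha>') (g \<beta>') \<longleftrightarrow> p.As \<alpha> \<beta> \<alpha>' \<beta>'"
proof
  assume a: "q.As (g \<alpha>) (g \<beta>) (g \<alpha>') (g \<beta>')"
  then have "pleg P \<alpha> = lleg P \<beta>"
    using assms f_inj[of "pleg P \<alpha>" "lleg P \<beta>"] by (simp add: q.As_def legs)
  then obtain \<gamma> \<delta> where b: "p.As \<alpha> \<beta> \<gamma> \<delta>" using p.assoc_ex assms by blast
  then have "\<gamma> = \<alpha>' \<and> \<delta> = \<beta>'"
    using q.assoc_unique[OF a As_image[OF b]] p.assoc_in[OF b] g_inj assms by blast
  with b show "p.As \<alpha> \<beta> \<alpha>' \<beta>'" by simp
qed (rule As_image)

lemma g_kap: "m \<in> Mul P \<Longrightarrow> g (p.kap m) = q.kap (g m)"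
  using As_image[OF p.kap_As[of m]] q.kap_As[of "g m"] q.assoc_unique
  by (fastforce simp: g_bet legs g_in)

lemma g_t: "m \<in> Mul P \<Longrightarrow> g (p.t F m) = q.t F (g m)"
  unfolding p.t_def q.t_def
  by (cases "F T0"; cases "F T1"; cases "F T2")
    (simp_all add: g_lunit g_runit g_bet f_ops g_kap legs(1-3) legs(4)[symmetric])

lemma F4_iff:
  assumes "\<And>i j k l. \<rho> i j k l \<in> Mul P"
  shows "q.F4 (\<lambda>i j k l. g (\<rho> i j k l)) \<longleftrightarrow> p.F4 \<rho>"
proof -
  have "g (\<rho> (G i) (G j) (G k) (G l)) = q.t G (g (\<rho> i j k l)) \<longleftrightarrow>
      \<rho> (G i) (G j) (G k) (G l) = p.t G (\<rho> i j k l)" for G i j k l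
    using g_inj[OF assms p.t_closed[OF assms]] by (auto simp flip: g_t[OF assms])
  then have "q.natural4 (\<lambda>i j k l. g (\<rho> i j k l)) \<longleftrightarrow> p.natural4 \<rho>"
    unfolding p.natural4_def q.natural4_def by (simp add: assms g_in)
  then show ?thesis by (simp add: p.F4_def q.F4_def p.A4_def q.A4_def As_iff assms)
qed

lemma flev_bij: "bij_betw (\<lambda>x F. g (x F)) (p.flev n) (q.flev n)"
  unfolding bij_betw_def
proof (intro conjI equalityI subsetI)
  show "inj_on (\<lambda>x F. g (x F)) (p.flev n)"
  proof (rule inj_onI, rule ext)
    fix x y F assume "x \<in> p.flev n" "y \<in> p.flev n" "(\<lambda>F. g (x F)) = (\<lambda>F. g (y F))"
    then show "x F = y F"
      using g_inj[of "x F" "y F"] p.Fam_in[OF p.flev_Fam] by (simp add: fun_eq_iff)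
  qed
next
  fix z assume "z \<in> (\<lambda>x F. g (x F)) ` p.flev n"
  then obtain x where x: "x \<in> p.flev n" "z = (\<lambda>F. g (x F))" by blast
  have "z \<in> q.Fam"
    unfolding q.Fam_def x(2) mem_Collect_eq using p.Fam_in[OF p.flev_Fam[OF x(1)]]
      p.Fam_F4[OF p.flev_Fam[OF x(1)]] by (subst F4_iff) auto
  moreover have "z F = z G" if "\<forall>i\<le>n. F i = G i" for F G
    using p.flev_cong[OF x(1), of F G] that by (simp add: x(2))
  ultimately show "z \<in> q.flev n" unfolding q.flev_def by blast
next
  fix z assume z: "z \<in> q.flev n"
  define x where "x F = inv_into (Mul P) g (z F)" for F
  have zM: "z F \<in> Mul Q" for F using q.Fam_in[OF q.flev_Fam[OF z]] .
  have gx: "g (x F) = z F" for F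
    unfolding x_def by (rule bij_betw_inv_into_right[OF bij(2) zM])
  have xM: "x F \<in> Mul P" for F
    unfolding x_def using bij_betwE[OF bij_betw_inv_into[OF bij(2)]] zM by blast
  have "p.F4 (\<lambda>i j k l. x (\<lambda>s. quad i j k l (r s)))" for r
    using F4_iff[of "\<lambda>i j k l. x (\<lambda>s. quad i j k l (r s))"] xM q.Fam_F4[OF q.flev_Fam[OF z], of r]
    by (simp add: gx)
  moreover have "x F = x G" if "\<forall>i\<le>n. F i = G i" for F G
    using q.flev_cong[OF z, of F G] that by (simp add: x_def)
  ultimately have "x \<in> p.flev n" unfolding p.flev_def p.Fam_def by blast
  moreover have "z = (\<lambda>F. g (x F))" by (simp add: gx)
  ultimately show "z \<in> (\<lambda>x F. g (x F)) ` p.flev n" by blast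
qed

end

text \<open>The Kan extension lives over a type of functions, so the isomorphism has to be allowed
  to change the type, unlike in \<open>iso_cosym\<close>.\<close>

definition cosym_iso_via :: "(nat \<Rightarrow> 'a \<Rightarrow> 'b) \<Rightarrow> 'a cosym \<Rightarrow> 'b cosym \<Rightarrow> bool" where
  "cosym_iso_via h X Y \<longleftrightarrow> (\<forall>n. bij_betw (h n) (lev X n) (lev Y n)) \<and>
     (\<forall>m n. \<forall>f\<in>Phi m n. \<forall>x\<in>lev X m. h n (act X m n f x) = act Y m n f (h m x))"

lemma iso_cosym_via: "iso_cosym X Y \<longleftrightarrow> (\<exists>h. cosym_iso_via h X Y)"
  by (simp add: iso_cosym_def cosym_iso_via_def)

lemma cosym_iso_via_comp:
  assumes "cosym_iso_via h X Y" "cosym_iso_via k Y Z"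
  shows "cosym_iso_via (\<lambda>n. k n \<circ> h n) X Z"
proof -
  have b: "\<And>n. bij_betw (h n) (lev X n) (lev Y n)" "\<And>n. bij_betw (k n) (lev Y n) (lev Z n)"
    using assms by (simp_all add: cosym_iso_via_def)
  show ?thesis
    unfolding cosym_iso_via_def
  proof (intro conjI allI ballI)
    show "bij_betw (k n \<circ> h n) (lev X n) (lev Z n)" for n
      by (rule bij_betw_trans[OF b])
    show "(k n \<circ> h n) (act X m n f x) = act Z m n f ((k m \<circ> h m) x)"
      if f: "f \<in> Phi m n" and x: "x \<in> lev X m" for m n f x
    proof -
      have "h m x \<in> lev Y m" using bij_betwE[OF b(1)] x by blast
      moreover have "h n (act X m n f x) = act Y m n f (h m x)"
        using assms(1) f x unfolding cosym_iso_via_def by blast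
      moreover have "k n (act Y m n f y) = act Z m n f (k m y)" if "y \<in> lev Y m" for y
        using assms(2) f that unfolding cosym_iso_via_def by blast
      ultimately show ?thesis by simp
    qed
  qed
qed

lemma cosym_iso_via_inv:
  assumes X: "cosymmetric_set X" and h: "cosym_iso_via h X Y"
  shows "cosym_iso_via (\<lambda>n. inv_into (lev X n) (h n)) Y X"
proof -
  have b: "\<And>n. bij_betw (h n) (lev X n) (lev Y n)"
    and n: "\<And>m n f x. f \<in> Phi m n \<Longrightarrow> x \<in> lev X m \<Longrightarrow> h n (act X m n f x) = act Y m n f (h m x)"
    using h by (auto simp: cosym_iso_via_def)
  have "inv_into (lev X n) (h n) (act Y m n f y) = act X m n f (inv_into (lev X m) (h m) y)"
    if f: "f \<in> Phi m n" and y: "y \<in> lev Y m" for m n f y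
  proof -
    have x: "inv_into (lev X m) (h m) y \<in> lev X m" "h m (inv_into (lev X m) (h m) y) = y"
      using bij_betwE[OF bij_betw_inv_into[OF b]] y bij_betw_inv_into_right[OF b] by auto
    have "act X m n f (inv_into (lev X m) (h m) y) \<in> lev X n"
      using X f x(1) by (auto simp: cosymmetric_set_def)
    then show ?thesis
      using n[OF f x(1)] x(2) bij_betw_inv_into_left[OF b] by metis
  qed
  then show ?thesis
    unfolding cosym_iso_via_def using bij_betw_inv_into[OF b] by blast
qed

lemma face_map_Phi: "0 < n \<Longrightarrow> face_map n i \<in> Phi n (n - 1)"
  by (auto simp: face_map_def Phi_def)

lemma cosym_iso_via_dface:
  "cosym_iso_via h X Y \<Longrightarrow> x \<in> lev X (Suc n) \<Longrightarrow>
    dface Y (Suc n) i (h (Suc n) x) = h n (dface X (Suc n) i x)"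
  using face_map_Phi[of "Suc n" i] by (simp add: cosym_iso_via_def dface_def)

lemma two_segal_transfer:
  assumes X: "cosymmetric_set X" "two_segal X" and h: "cosym_iso_via h X Y"
  shows "two_segal Y"
proof -
  have b: "\<And>n. bij_betw (h n) (lev X n) (lev Y n)" using h by (simp add: cosym_iso_via_def)
  have dX: "dface X (Suc n) i x \<in> lev X n" if "x \<in> lev X (Suc n)" for n i x
    using X(1)[unfolded cosymmetric_set_def, THEN conjunct1, rule_format, OF face_map_Phi[of "Suc n" i]] that
    by (auto simp: dface_def)
  have *: "bij_betw (\<lambda>w. (dface Y (Suc n) i w, dface Y (Suc n) j w)) (lev Y (Suc n))
          {(x, y) \<in> lev Y n \<times> lev Y n. dface Y n p x = dface Y n q y}"
    if s: "bij_betw (\<lambda>w. (dface X (Suc n) i w, dface X (Suc n) j w)) (lev X (Suc n))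
          {(x, y) \<in> lev X n \<times> lev X n. dface X n p x = dface X n q y}" and n: "0 < n" for n i j p q
  proof -
    obtain m where m: "n = Suc m" using n by (cases n) auto
    let ?P = "{(x, y) \<in> lev X n \<times> lev X n. dface X n p x = dface X n q y}"
    let ?Q = "{(x, y) \<in> lev Y n \<times> lev Y n. dface Y n p x = dface Y n q y}"
    have inj: "inj_on (h n) (lev X n)" "inj_on (h m) (lev X m)" and im: "lev Y n = h n ` lev X n"
      using b by (auto simp: bij_betw_def)
    have e: "dface Y n p (h n x) = dface Y n q (h n y) \<longleftrightarrow> dface X n p x = dface X n q y"
      if "x \<in> lev X n" "y \<in> lev X n" for x y
      using cosym_iso_via_dface[OF h] inj_on_eq_iff[OF inj(2) dX dX] that by (simp add: m)
    have "bij_betw (map_prod (h n) (h n)) ?P ?Q"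
      unfolding bij_betw_def
    proof (intro conjI equalityI subsetI)
      show "inj_on (map_prod (h n) (h n)) ?P"
        using inj(1) by (auto simp: inj_on_def)
      show "z \<in> ?Q" if "z \<in> map_prod (h n) (h n) ` ?P" for z
        using that e by (auto simp: im)
      show "z \<in> map_prod (h n) (h n) ` ?P" if z: "z \<in> ?Q" for z
      proof -
        obtain x y where "x \<in> lev X n" "y \<in> lev X n" "z = (h n x, h n y)"
          using z im by auto
        then have "z = map_prod (h n) (h n) (x, y)" "(x, y) \<in> ?P" using z e by auto
        then show ?thesis by blast
      qed
    qed
    from bij_betw_trans[OF s this]
    have "bij_betw ((\<lambda>w. (dface Y (Suc n) i w, dface Y (Suc n) j w)) \<circ> h (Suc n)) (lev X (Suc n)) ?Q"
      by (rule bij_betw_cong[THEN iffD1, rotated]) (simp add: cosym_iso_via_dface[OF h])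
    then show ?thesis using bij_betw_comp_iff[OF b] by blast
  qed
  show ?thesis
    unfolding two_segal_def
  proof (intro allI impI)
    fix n i :: nat assume i: "0 < i \<and> i < n"
    note s = X(2)[unfolded two_segal_def, rule_format, OF i, folded Suc_eq_plus1]
    show "bij_betw (\<lambda>w. (dface Y (n + 1) (i + 1) w, dface Y (n + 1) 0 w)) (lev Y (n + 1))
          {(x, y) \<in> lev Y n \<times> lev Y n. dface Y n 0 x = dface Y n i y} \<and>
        bij_betw (\<lambda>w. (dface Y (n + 1) i w, dface Y (n + 1) (n + 1) w)) (lev Y (n + 1))
          {(x, y) \<in> lev Y n \<times> lev Y n. dface Y n n x = dface Y n i y}"
      unfolding Suc_eq_plus1[symmetric] using *[OF conjunct1[OF s]] *[OF conjunct2[OF s]] i by simp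
  qed
qed

lemma cosym_transport:
  fixes X :: "'b cosym" and e :: "nat \<Rightarrow> 'b \<Rightarrow> 'a"
  assumes X: "cosymmetric_set X" "two_segal X" and e: "\<And>n. inj_on (e n) (lev X n)"
  obtains Y where "Y \<in> two_segal_cosyms" "cosym_iso_via e X Y"
proof -
  define Y where "Y = \<lparr> lev = (\<lambda>n. e n ` lev X n),
      act = (\<lambda>m n f y. e n (act X m n f (inv_into (lev X m) (e m) y))) \<rparr>"
  have inv: "inv_into (lev X n) (e n) (e n x) = x" if "x \<in> lev X n" for n x
    using inv_into_f_f[OF e that] .
  have via: "cosym_iso_via e X Y"
    using e by (auto simp: cosym_iso_via_def Y_def inv bij_betw_def)
  have a: "act X m n f x \<in> lev X n" if "f \<in> Phi m n" "x \<in> lev X m" for m n f x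
    using X(1) that by (auto simp: cosymmetric_set_def)
  have c: "act X l n (compose {..l} g f) x = act X m n g (act X l m f x)"
    if "f \<in> Phi l m" "g \<in> Phi m n" "x \<in> lev X l" for l m n f g x
    using X(1) that by (simp add: cosymmetric_set_def)
  have i: "act X n n (restrict (\<lambda>k. k) {..n}) x = x" if "x \<in> lev X n" for n x
    using X(1) that by (simp add: cosymmetric_set_def)
  have "cosymmetric_set Y"
    unfolding cosymmetric_set_def by (auto simp: Y_def inv a i c)
  then have "Y \<in> two_segal_cosyms"
    using two_segal_transfer[OF X via] by (simp add: two_segal_cosyms_def)
  with via that show ?thesis by blast
qed

section \<open>Recovering a pseudomonoid from its cosymmetric set\<close>

context cf_pseudomonoid begin

text \<open>The family generated by one element of \<open>M\<close>; on levels up to 2 it is inverse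
  to evaluation at \<open>iota\<close>.\<close>

definition emb :: "'a \<Rightarrow> (nat \<Rightarrow> three) \<Rightarrow> 'a" where
  "emb m f = t (tri (f 0) (f (Suc 0)) (f 2)) m"

lemma emb_Fam: "m \<in> M \<Longrightarrow> emb m \<in> Fam"
  using F3_degenerate_F4[OF F3_of] by (simp add: Fam_def emb_def)

lemma emb_flev2: "m \<in> M \<Longrightarrow> emb m \<in> flev 2"
  by (simp add: flev_def emb_Fam) (simp add: emb_def)

lemma emb_iota: "m \<in> M \<Longrightarrow> emb m iota = m"
  by (simp add: emb_def t_id)

lemma flev_emb:
  assumes "z \<in> flev n" "n \<le> 2"
  shows "z = emb (z iota)"
proof
  fix f
  have "emb (z iota) f = z (tri (f 0) (f (Suc 0)) (f 2) \<circ> iota)"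
    by (simp add: emb_def Fam_nat[OF flev_Fam[OF assms(1)]])
  also have "\<dots> = z f"
  proof (rule flev_cong[OF assms(1)])
    fix k assume "k \<le> n"
    then have "k \<le> 2" using assms(2) by simp
    from atMost_cases(2)[OF this] show "(tri (f 0) (f (Suc 0)) (f 2) \<circ> iota) k = f k"
      by auto
  qed
  finally show "z f = emb (z iota) f" ..
qed

lemma flev_iota_in: "z \<in> flev n \<Longrightarrow> z iota \<in> M"
  by (rule Fam_in[OF flev_Fam])

lemma t_table: "t (tri T0 T1 T1) m = runit (prd m)" "t (tri T0 T1 T0) m = runit (lam m)"
    "t (tri T0 T0 T1) m = runit (rho m)" "t (tri T0 T2 T1) m = \<sigma> m"
    "t (tri T0 T0 T0) m = runit (eps (lam m))" "t (tri T1 T1 T1) m = runit (tau (eps (lam m)))"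
  by (simp_all add: t_def)

lemma emb_runit: "x \<in> X \<Longrightarrow> emb (runit x) f = t (tri (f 0) (f (Suc 0)) (f (Suc 0))) (runit x)"
  using t_comp[of "runit x" "tri (f 0) (f (Suc 0)) (f 2)" "tri T0 T1 T1"]
  by (simp add: emb_def t_table)

lemma emb_runit_eps: "x \<in> X \<Longrightarrow> eps x = x \<Longrightarrow> emb (runit x) f = t (tri (f 0) (f 0) (f 0)) (runit x)"
  using t_comp[of "runit x" "tri (f 0) (f (Suc 0)) (f 2)" "tri T0 T0 T0"]
  by (simp add: emb_def t_table)

lemma uleg_eps: "u \<in> Unt P \<Longrightarrow> eps (uleg P u) = uleg P u"
proof -
  assume u: "u \<in> Unt P"
  then have x: "uleg P u \<in> X" by (rule leg_in)
  have "runit (uleg P u) = lunit (eps (uleg P u))"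
    using lunit_eqI[of "runit (uleg P u)"] x u by simp
  then have "lam (runit (uleg P u)) = lam (lunit (eps (uleg P u)))" by simp
  then show ?thesis using x by (simp add: eps_eps)
qed

text \<open>The right unit at \<open>uleg P u\<close> occurs together with \<open>u\<close> and with
  \<open>u'\<close> in the domain of the right unitor, where both pairs have the same image.\<close>

lemma uleg_inj: "inj_on (uleg P) (Unt P)"
proof (rule inj_onI)
  fix u u' assume u: "u \<in> Unt P" "u' \<in> Unt P" and e: "uleg P u = uleg P u'"
  let ?A = "{(m, u) \<in> M \<times> Unt P. rho m = uleg P u}"
  have b: "inj_on (\<lambda>(m, u). lam m) ?A"
    using cf_facts(3) by (simp add: unitors_def bij_betw_def)
  have "(runit (uleg P u), u) = (runit (uleg P u), u')"
    by (rule inj_onD[OF b]) (use u e leg_in(4)[OF u(1)] uleg_eps in auto)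
  then show "u = u'" by simp
qed

lemma cleg_inj: "inj_on (cleg P) (Cou P)"
proof (rule inj_onI)
  fix v v' assume v: "v \<in> Cou P" "v' \<in> Cou P" and e: "cleg P v = cleg P v'"
  let ?A = "{(m, v) \<in> M \<times> Cou P. prd m = cleg P v}"
  have b: "inj_on (\<lambda>(m, v). lam m) ?A"
    using cf_facts(7) by (simp add: frobenius_structure_def Let_def bij_betw_def)
  have "prd (lunit (cleg P v)) = cleg P v" using leg_in(5)[OF v(1)] by simp
  then have "(lunit (cleg P v), v) = (lunit (cleg P v), v')"
    by (intro inj_onD[OF b]) (use v e leg_in(5)[OF v(1)] in auto)
  then show "v = v'" by simp
qed

text \<open>A cosymmetric set uses its level 0 for units and for counits, while a pseudomonoid has
  two separate sets. Here they are identified, with \<open>tau\<close> leading back to the counit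
  legs.\<close>

lemma counit_bij: "bij_betw (\<lambda>v. eps (cleg P v)) (Cou P) (uleg P ` Unt P)"
  unfolding bij_betw_def
proof (intro conjI equalityI subsetI)
  show "inj_on (\<lambda>v. eps (cleg P v)) (Cou P)"
    using cleg_inj counit_eq unfolding inj_on_def by metis
  show "x \<in> uleg P ` Unt P" if "x \<in> (\<lambda>v. eps (cleg P v)) ` Cou P" for x
    using that eps_in_unit leg_in(5) by blast
  fix x assume x: "x \<in> uleg P ` Unt P"
  then have "x \<in> X" "eps x = x" using leg_in(4) uleg_eps by auto
  moreover then obtain v where "v \<in> Cou P" "tau (eps x) = cleg P v" using tau_eps_counit by blast
  ultimately show "x \<in> (\<lambda>v. eps (cleg P v)) ` Cou P"
    using eps_tau by (metis image_eqI)
qed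

text \<open>At two points, merging 1 and 2 changes nothing, so the value at \<open>iota\<close> is
  the right unit of its own product.\<close>

lemma flev1_bij: "bij_betw (\<lambda>x. emb (runit x)) X (flev 1)"
proof (rule bij_betw_byWitness[where f' = "\<lambda>z. prd (z iota)"])
  show "\<forall>x\<in>X. prd (emb (runit x) iota) = x" by (simp add: emb_iota)
  show "\<forall>z\<in>flev 1. emb (runit (prd (z iota))) = z"
  proof
    fix z assume z: "z \<in> flev 1"
    have "runit (prd (z iota)) = z (tri T0 T1 T1 \<circ> iota)"
      using Fam_nat[OF flev_Fam[OF z], of "tri T0 T1 T1" iota] by (simp add: t_table)
    also have "\<dots> = z iota"
    proof (rule flev_cong[OF z])
      fix k :: nat assume "k \<le> 1"
      then have "k \<le> Suc 0" by simp
      from atMost_cases(1)[OF this] show "(tri T0 T1 T1 \<circ> iota) k = iota k" by auto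
    qed
    finally show "emb (runit (prd (z iota))) = z" using flev_emb[OF z] by simp
  qed
  show "(\<lambda>x. emb (runit x)) ` X \<subseteq> flev 1"
    by (auto simp: flev_def emb_Fam) (simp add: emb_runit)
  show "(\<lambda>z. prd (z iota)) ` flev 1 \<subseteq> X" by (auto simp: flev_iota_in)
qed

lemma flev0_bij: "bij_betw (\<lambda>x. emb (runit x)) (uleg P ` Unt P) (flev 0)"
proof (rule bij_betw_byWitness[where f' = "\<lambda>z. prd (z iota)"])
  have x: "x \<in> X \<and> eps x = x" if "x \<in> uleg P ` Unt P" for x
    using that leg_in(4) uleg_eps by auto
  have z0: "runit (eps (lam (z iota))) = z iota" if z: "z \<in> flev 0" for z
  proof -
    have "runit (eps (lam (z iota))) = z (tri T0 T0 T0 \<circ> iota)"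
      using Fam_nat[OF flev_Fam[OF z], of "tri T0 T0 T0" iota] by (simp add: t_table)
    also have "\<dots> = z iota" by (rule flev_cong[OF z]) simp
    finally show ?thesis .
  qed
  have pz: "prd (z iota) = eps (lam (z iota))" if "z \<in> flev 0" for z
  proof -
    have "prd (runit (eps (lam (z iota)))) = eps (lam (z iota))" using flev_iota_in[OF that] by simp
    then show ?thesis using z0[OF that] by simp
  qed
  show "\<forall>y\<in>uleg P ` Unt P. prd (emb (runit y) iota) = y" using x by (simp add: emb_iota)
  show "\<forall>z\<in>flev 0. emb (runit (prd (z iota))) = z"
    using z0 pz flev_emb by simp
  show "(\<lambda>x. emb (runit x)) ` uleg P ` Unt P \<subseteq> flev 0"
  proof
    fix z assume "z \<in> (\<lambda>x. emb (runit x)) ` uleg P ` Unt P"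
    then obtain y where y: "y \<in> uleg P ` Unt P" "z = emb (runit y)" by blast
    then show "z \<in> flev 0"
      using x[OF y(1)] emb_Fam[of "runit y"] emb_runit_eps[of y] by (simp add: flev_def)
  qed
  show "(\<lambda>z. prd (z iota)) ` flev 0 \<subseteq> uleg P ` Unt P"
    using pz flev_iota_in eps_in_unit by auto
qed

lemma flev2_bij: "bij_betw emb M (flev 2)"
  by (rule bij_betw_byWitness[where f' = "\<lambda>z. z iota"])
    (auto simp: emb_iota emb_flev2 flev_iota_in flev_emb[symmetric])

lemma fcosym_dface: "dface fcosym n i x = (\<lambda>g. x (\<lambda>k. g (face_map n i k)))"
  by (simp add: dface_def fcosym_def)

lemma emb_dface:
  assumes m: "m \<in> M"
  shows "dface fcosym 2 2 (emb m) = emb (runit (lam m))" "dface fcosym 2 0 (emb m) = emb (runit (rho m))"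
    "dface fcosym 2 (Suc 0) (emb m) = emb (runit (prd m))"
proof -
  have *: "emb (t (tri i j k) m) f = t (tri (tri (f 0) (f (Suc 0)) (f 2) i)
    (tri (f 0) (f (Suc 0)) (f 2) j) (tri (f 0) (f (Suc 0)) (f 2) k)) m" for i j k f
    using m by (simp add: emb_def t_comp)
  show "dface fcosym 2 2 (emb m) = emb (runit (lam m))"
    using *[of T0 T1 T0] by (simp add: fcosym_dface t_table fun_eq_iff) (simp add: emb_def face_map_def)
  show "dface fcosym 2 0 (emb m) = emb (runit (rho m))"
    using *[of T0 T0 T1] by (simp add: fcosym_dface t_table fun_eq_iff) (simp add: emb_def face_map_def)
  show "dface fcosym 2 (Suc 0) (emb m) = emb (runit (prd m))"
    using *[of T0 T1 T1] by (simp add: fcosym_dface t_table fun_eq_iff) (simp add: emb_def face_map_def)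
qed

lemma emb_theta: "m \<in> M \<Longrightarrow> theta fcosym 2 (Suc 0) (emb m) = emb (\<sigma> m)"
proof
  fix f assume m: "m \<in> M"
  show "theta fcosym 2 (Suc 0) (emb m) f = emb (\<sigma> m) f"
    using t_comp[OF m, of "tri (f 0) (f (Suc 0)) (f 2)" "tri T0 T2 T1"]
    by (simp add: theta_def fcosym_def emb_def t_table transp_map_def transpose_def numeral_2_eq_2)
qed

lemma emb_unit: "u \<in> Unt P \<Longrightarrow> sdegen fcosym 0 0 (emb (runit (uleg P u))) = emb (runit (uleg P u))"
proof
  fix f assume u: "u \<in> Unt P"
  show "sdegen fcosym 0 0 (emb (runit (uleg P u))) f = emb (runit (uleg P u)) f"
    using emb_runit_eps[OF leg_in(4)[OF u] uleg_eps[OF u]]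
    by (simp add: sdegen_def fcosym_def degen_map_def)
qed

lemma emb_counit: "v \<in> Cou P \<Longrightarrow> sdegen fcosym 0 (Suc 0) (emb (runit (eps (cleg P v)))) = emb (runit (cleg P v))"
proof
  fix f assume v: "v \<in> Cou P"
  then have x: "cleg P v \<in> X" by (rule leg_in)
  let ?m = "runit (eps (cleg P v))"
  have "sdegen fcosym 0 (Suc 0) (emb ?m) f = t (tri (f (Suc 0)) (f (Suc 0)) (f (Suc 0))) ?m"
    using emb_runit_eps[of "eps (cleg P v)"] x
    by (simp add: eps_eps sdegen_def fcosym_def extra_degen_map_def degen_map_def cyc_map_def compose_def)
  also have "\<dots> = t (tri (f 0) (f (Suc 0)) (f 2)) (t (tri T1 T1 T1) ?m)"
    using x by (simp add: t_comp)
  also have "t (tri T1 T1 T1) ?m = runit (cleg P v)"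
    using x counit_eq[OF v] by (simp add: t_table eps_eps)
  finally show "sdegen fcosym 0 (Suc 0) (emb ?m) f = emb (runit (cleg P v)) f"
    by (simp only: emb_def[of "runit (cleg P v)"])
qed

text \<open>The 2-Segal bijection supplies an element with the prescribed faces d3 and d1. As a
  member of the Kan extension it satisfies \<open>As\<close>, and uniqueness of the associator gives
  the other two faces.\<close>

lemma As_flev3:
  assumes as: "As \<alpha> \<beta> \<alpha>' \<beta>'"
  obtains w where "w \<in> flev 3" "dface fcosym 3 3 w = emb \<alpha>" "dface fcosym 3 (Suc 0) w = emb \<beta>"
    "dface fcosym 3 0 w = emb \<alpha>'" "dface fcosym 3 2 w = emb \<beta>'"
proof -
  have m: "\<alpha> \<in> M" "\<beta> \<in> M" "\<alpha>' \<in> M" "\<beta>' \<in> M" using assoc_in[OF as] by auto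
  have l: "prd \<alpha> = lam \<beta>" using assoc_legs[OF as] by simp
  have "(0::nat) < 1 \<and> (1::nat) < 2" by simp
  note s = fcosym_two_segal[unfolded two_segal_def, rule_format, OF this, THEN conjunct2]
  have lev: "lev fcosym n = flev n" for n by (simp add: fcosym_def)
  have "(emb \<beta>, emb \<alpha>) \<in> (\<lambda>w. (dface fcosym (2 + 1) 1 w, dface fcosym (2 + 1) (2 + 1) w)) ` lev fcosym (2 + 1)"
    unfolding bij_betw_imp_surj_on[OF s] using m l by (simp add: lev emb_flev2 emb_dface)
  then obtain w where w: "w \<in> flev 3" and d: "dface fcosym 3 3 w = emb \<alpha>" "dface fcosym 3 (Suc 0) w = emb \<beta>"
    by (auto simp: lev)
  let ?q = "\<lambda>k::nat. if k = 0 then Q0 else if k = Suc 0 then Q1 else if k = 2 then Q2 else Q3"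
  have e: "w (\<lambda>s. quad (iota (face_map 3 i 0)) (iota (face_map 3 i (Suc 0))) (iota (face_map 3 i 2))
      (iota (face_map 3 i 3)) (?q s)) = dface fcosym 3 i w iota" for i
    unfolding fcosym_dface
  proof (rule flev_cong[OF w])
    fix k :: nat assume "k \<le> 3"
    then show "quad (iota (face_map 3 i 0)) (iota (face_map 3 i (Suc 0))) (iota (face_map 3 i 2))
      (iota (face_map 3 i 3)) (?q k) = iota (face_map 3 i k)"
      using atMost_cases(3)[of k] by auto
  qed
  have "A4 (\<lambda>i j k l. w (\<lambda>s. quad i j k l (?q s)))"
    using Fam_F4[OF flev_Fam[OF w], of ?q] by (simp add: F4_def)
  then have "As (dface fcosym 3 3 w iota) (dface fcosym 3 (Suc 0) w iota)
      (dface fcosym 3 0 w iota) (dface fcosym 3 2 w iota)"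
    using e[of 3] e[of "Suc 0"] e[of 0] e[of 2] by (simp add: A4_def face_map_def)
  then have "As \<alpha> \<beta> (dface fcosym 3 0 w iota) (dface fcosym 3 2 w iota)"
    using d m by (simp add: emb_iota)
  then have a: "dface fcosym 3 0 w iota = \<alpha>'" "dface fcosym 3 2 w iota = \<beta>'"
    using assoc_unique[OF as] by auto
  have "dface fcosym 3 i w \<in> flev 2" for i
    unfolding fcosym_dface by (rule flev_push[OF w]) (auto simp: face_map_def)
  then have "dface fcosym 3 0 w = emb \<alpha>'" "dface fcosym 3 2 w = emb \<beta>'"
    using flev_emb[of _ 2] a by auto
  with w d that show ?thesis by blast
qed

text \<open>Above level 2 two faces determine an element, and an infinite \<open>'a\<close> absorbs
  its own square.\<close>

lemma flev_injection:
  assumes "infinite (UNIV :: 'a set)"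
  shows "\<exists>e :: ((nat \<Rightarrow> three) \<Rightarrow> 'a) \<Rightarrow> 'a. inj_on e (flev n)"
proof (induction n rule: less_induct)
  case (less N)
  show ?case
  proof (cases "N \<le> 2")
    case True
    have "inj_on (\<lambda>z. z iota) (flev N)"
      by (rule inj_on_inverseI[where g = emb]) (simp add: flev_emb[OF _ True, symmetric])
    then show ?thesis by blast
  next
    case False
    define n where "n = N - 1"
    have n: "N = n + 1" "0 < (1::nat) \<and> 1 < n" using False by (auto simp: n_def)
    note s = fcosym_two_segal[unfolded two_segal_def, rule_format, OF n(2), THEN conjunct1]
    obtain e :: "((nat \<Rightarrow> three) \<Rightarrow> 'a) \<Rightarrow> 'a" where e: "inj_on e (flev n)"
      using less.IH[of n] n by auto
    have "(card_of (UNIV \<times> UNIV :: ('a \<times> 'a) set), card_of (UNIV :: 'a set)) \<in> ordIso"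
      by (rule card_of_Times_same_infinite[OF assms])
    then obtain p :: "'a \<times> 'a \<Rightarrow> 'a" where p: "inj p"
      by (auto simp: card_of_ordIso[symmetric] bij_betw_def)
    let ?d = "\<lambda>w. (dface fcosym (n + 1) (1 + 1) w, dface fcosym (n + 1) 0 w)"
    have "inj_on (\<lambda>w. p (map_prod e e (?d w))) (flev N)"
    proof (rule inj_onI)
      fix w w' assume w: "w \<in> flev N" "w' \<in> flev N" and eq: "p (map_prod e e (?d w)) = p (map_prod e e (?d w'))"
      have w': "w \<in> lev fcosym (n + 1)" "w' \<in> lev fcosym (n + 1)" using w n by (simp_all add: fcosym_def)
      have d: "?d w \<in> flev n \<times> flev n" "?d w' \<in> flev n \<times> flev n"
        using bij_betwE[OF s] w' by (auto simp: fcosym_def)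
      have "map_prod e e (?d w) = map_prod e e (?d w')" using injD[OF p eq] .
      then have "?d w = ?d w'" using d inj_onD[OF e] by auto
      then show "w = w'" by (rule inj_onD[OF bij_betw_imp_inj_on[OF s] _ w'])
    qed
    then show ?thesis by blast
  qed
qed

lemma cosym_of_cf:
  assumes inf: "infinite (UNIV :: 'a set)"
  obtains Y :: "'a cosym" where "Y \<in> two_segal_cosyms" "iso_cf P (cf_of_cosym Y)"
proof -
  have lev: "lev fcosym n = flev n" for n by (simp add: fcosym_def)
  obtain e :: "nat \<Rightarrow> ((nat \<Rightarrow> three) \<Rightarrow> 'a) \<Rightarrow> 'a" where "\<And>n. inj_on (e n) (lev fcosym n)"
    using flev_injection[OF inf] unfolding lev by metis
  from cosym_transport[OF fcosym_cosymmetric fcosym_two_segal this] obtain Y :: "'a cosym"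
    where Y: "Y \<in> two_segal_cosyms" and via: "cosym_iso_via e fcosym Y" by blast
  have eb: "bij_betw (e n) (flev n) (lev Y n)" for n
    using via by (simp add: cosym_iso_via_def lev)
  have en: "act Y m n F (e m x) = e n (act fcosym m n F x)" if "F \<in> Phi m n" "x \<in> flev m" for m n F x
    using via that by (simp add: cosym_iso_via_def lev)
  have df: "dface Y (Suc n) i (e (Suc n) x) = e n (dface fcosym (Suc n) i x)" if "x \<in> flev (Suc n)" for n i x
    using cosym_iso_via_dface[OF via] that by (simp add: lev)
  have Ysegal: "two_segal Y" using Y by (simp add: two_segal_cosyms_def)
  let ?f = "\<lambda>x. e 1 (emb (runit x))" and ?g = "\<lambda>m. e 2 (emb m)"
    and ?h = "\<lambda>u. e 0 (emb (runit (uleg P u)))" and ?k = "\<lambda>v. e 0 (emb (runit (eps (cleg P v))))"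
  have f0: "emb (runit x) \<in> flev 0" if "x \<in> uleg P ` Unt P" for x
    using bij_betwE[OF flev0_bij] that by blast
  have f1: "emb (runit x) \<in> flev (Suc 0)" if "x \<in> X" for x
    using bij_betwE[OF flev1_bij] that by simp
  have d2: "dface Y 2 i (?g m) = e 1 (dface fcosym 2 i (emb m))" if "m \<in> M" for i m
    using df[of "emb m" 1 i] emb_flev2[OF that] by (simp add: numeral_2_eq_2)
  have d3: "dface Y 3 i (e 3 w) = e 2 (dface fcosym 3 i w)" if "w \<in> flev 3" for i w
    using df[of w 2 i] that by (simp add: numeral_3_eq_3 numeral_2_eq_2)
  have "iso_cf P (cf_of_cosym Y)"
  proof (rule iso_cfI[where f = ?f and g = ?g and h = ?h and k = ?k])
    fix \<alpha> \<beta> assume "(\<alpha>, \<beta>) \<in> left_comps P"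
    then have "\<alpha> \<in> M" "\<beta> \<in> M" "prd \<alpha> = lam \<beta>" by (auto simp: left_comps_def)
    then obtain \<alpha>' \<beta>' where as: "As \<alpha> \<beta> \<alpha>' \<beta>'"
      using assoc_ex by blast
    obtain w where w: "w \<in> flev 3" and d: "dface fcosym 3 3 w = emb \<alpha>" "dface fcosym 3 (Suc 0) w = emb \<beta>"
      "dface fcosym 3 0 w = emb \<alpha>'" "dface fcosym 3 2 w = emb \<beta>'" by (rule As_flev3[OF as])
    have "e 3 w \<in> lev Y 3" using bij_betwE[OF eb] w by blast
    from assoc_cf_of_cosym[OF Ysegal this]
    have "assoc (cf_of_cosym Y) (?g \<alpha>, ?g \<beta>) = (?g \<alpha>', ?g \<beta>')"
      by (simp add: d3[OF w] d)
    then show "assoc (cf_of_cosym Y) (?g \<alpha>, ?g \<beta>) = map_prod ?g ?g (assoc P (\<alpha>, \<beta>))"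
      using as by (simp add: As_def)
  next
    have th: "theta Y 2 1 (?g m) = e 2 (theta fcosym 2 1 (emb m))" if "m \<in> M" for m
      unfolding theta_def
      by (rule en) (use emb_flev2[OF that] in \<open>auto simp: transp_map_def Phi_def transpose_def\<close>)
    show "\<forall>m\<in>M. lleg (cf_of_cosym Y) (?g m) = ?f (lam m) \<and> rleg (cf_of_cosym Y) (?g m) = ?f (rho m) \<and>
           pleg (cf_of_cosym Y) (?g m) = ?f (prd m) \<and> braid (cf_of_cosym Y) (?g m) = ?g (\<sigma> m)"
      using th by (simp add: cf_of_cosym_def d2 emb_dface emb_theta)
  next
    show "\<forall>u\<in>Unt P. uleg (cf_of_cosym Y) (?h u) = ?f (uleg P u)"
    proof
      fix u assume u: "u \<in> Unt P"
      have "sdegen Y 0 0 (?h u) = e 1 (sdegen fcosym 0 0 (emb (runit (uleg P u))))"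
        unfolding sdegen_def using en[of "degen_map 0 0" 0 1] f0[of "uleg P u"] u
        by (simp add: degen_map_def Phi_def)
      then show "uleg (cf_of_cosym Y) (?h u) = ?f (uleg P u)"
        by (simp add: cf_of_cosym_def emb_unit[OF u])
    qed
    show "\<forall>v\<in>Cou P. cleg (cf_of_cosym Y) (?k v) = ?f (cleg P v)"
    proof
      fix v assume v: "v \<in> Cou P"
      then have "eps (cleg P v) \<in> uleg P ` Unt P" using bij_betwE[OF counit_bij] by blast
      moreover have "extra_degen_map 0 \<in> Phi 0 1"
        by (auto simp: extra_degen_map_def compose_def Phi_def cyc_map_def degen_map_def)
      ultimately have "sdegen Y 0 1 (?k v) = e 1 (sdegen fcosym 0 1 (emb (runit (eps (cleg P v)))))"
        unfolding sdegen_def using en[of "extra_degen_map 0" 0 1] f0 by simp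
      then show "cleg (cf_of_cosym Y) (?k v) = ?f (cleg P v)"
        using emb_counit[OF v] by (simp add: cf_of_cosym_def)
    qed
    show "bij_betw ?f X (Ob (cf_of_cosym Y))"
      using bij_betw_trans[OF flev1_bij eb] by (simp add: cf_of_cosym_def comp_def)
    show "bij_betw ?g M (Mul (cf_of_cosym Y))"
      using bij_betw_trans[OF flev2_bij eb] by (simp add: cf_of_cosym_def comp_def)
    have b0: "bij_betw (\<lambda>x. e 0 (emb (runit x))) (uleg P ` Unt P) (lev Y 0)"
      using bij_betw_trans[OF flev0_bij eb] by (simp add: comp_def)
    have "bij_betw (uleg P) (Unt P) (uleg P ` Unt P)" using uleg_inj by (simp add: bij_betw_def)
    from bij_betw_trans[OF this b0] show "bij_betw ?h (Unt P) (Unt (cf_of_cosym Y))"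
      by (simp add: cf_of_cosym_def comp_def)
    from bij_betw_trans[OF counit_bij b0] show "bij_betw ?k (Cou P) (Cou (cf_of_cosym Y))"
      by (simp add: cf_of_cosym_def comp_def)
  qed
  with Y that show ?thesis by blast
qed

end

section \<open>The correspondence on isomorphism classes\<close>

lemma cosym_via_fcosym:
  assumes "X \<in> two_segal_cosyms"
  shows "cosym_iso_via (segal_cosym.phi X) X (seed.fcosym (Mul (cf_of_cosym X))
    (cf_pseudomonoid.t (cf_of_cosym X)) (cf_pseudomonoid.As (cf_of_cosym X)))"
proof -
  interpret segal_cosym X by unfold_locales (rule assms)
  show ?thesis
    unfolding cosym_iso_via_def using phi_bij phi_act by (auto simp: cf.fcosym_def)
qed

text \<open>Both cosymmetric sets are isomorphic to the Kan extensions of their pseudomonoids, and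
  an isomorphism of pseudomonoids induces one of Kan extensions.\<close>

lemma iso_cosym_of_iso_cf:
  assumes X: "X \<in> two_segal_cosyms" and Y: "Y \<in> two_segal_cosyms"
    and iso: "iso_cf (cf_of_cosym X) (cf_of_cosym Y)"
  shows "iso_cosym X Y"
proof -
  interpret x: segal_cosym X by unfold_locales (rule X)
  interpret y: segal_cosym Y by unfold_locales (rule Y)
  obtain f g h k where "cf_isomorphism (cf_of_cosym X) (cf_of_cosym Y) f g h k"
    using iso unfolding iso_cf_def cf_isomorphism_def cf_isomorphism_axioms_def
    using x.cf.cf_pseudomonoid_axioms y.cf.cf_pseudomonoid_axioms by blast
  then interpret cf_isomorphism "cf_of_cosym X" "cf_of_cosym Y" f g h k .
  have "cosym_iso_via (\<lambda>n z F. g (z F)) x.cf.fcosym y.cf.fcosym"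
    unfolding cosym_iso_via_def using flev_bij by (simp add: x.cf.fcosym_def y.cf.fcosym_def)
  note c = cosym_iso_via_comp[OF cosym_via_fcosym[OF X] this]
  have "cosymmetric_set Y" using Y by (simp add: two_segal_cosyms_def)
  from cosym_iso_via_comp[OF c cosym_iso_via_inv[OF this cosym_via_fcosym[OF Y]]]
  show ?thesis unfolding iso_cosym_via by blast
qed

lemma iso_cf_of_iso_cosym:
  assumes X: "X \<in> two_segal_cosyms" and Y: "Y \<in> two_segal_cosyms" and iso: "iso_cosym X Y"
  shows "iso_cf (cf_of_cosym X) (cf_of_cosym Y)"
proof -
  interpret x: segal_cosym X by unfold_locales (rule X)
  interpret y: segal_cosym Y by unfold_locales (rule Y)
  obtain h where b: "\<And>n. bij_betw (h n) (lev X n) (lev Y n)"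
    and n: "\<And>m n f x. f \<in> Phi m n \<Longrightarrow> x \<in> lev X m \<Longrightarrow> h n (act X m n f x) = act Y m n f (h m x)"
    using iso unfolding iso_cosym_def by blast
  have ap: "h n (x.ap m n fs z) = y.ap m n fs (h m z)"
    if "z \<in> lev X m" "length fs = Suc m" "set fs \<subseteq> {..n}" for m n fs z
    unfolding x.ap_def y.ap_def by (rule n[OF x.list_in_Phi]) (use that in auto)
  have hin: "h n z \<in> lev Y n" if "z \<in> lev X n" for n z using bij_betwE[OF b] that by blast
  show ?thesis
  proof (rule iso_cfI[where f = "h 1" and g = "h 2" and h = "h 0" and k = "h 0"])
    fix \<alpha> \<beta> assume "(\<alpha>, \<beta>) \<in> left_comps (cf_of_cosym X)"
    then have "\<alpha> \<in> lev X 2" "\<beta> \<in> lev X 2" "pleg x.P \<alpha> = lleg x.P \<beta>"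
      by (auto simp: left_comps_def x.cf_sel)
    then show "assoc (cf_of_cosym Y) (h 2 \<alpha>, h 2 \<beta>) = map_prod (h 2) (h 2) (assoc (cf_of_cosym X) (\<alpha>, \<beta>))"
      by (rule x.assocE) (simp add: ap hin y.assoc_eq)
  qed (use b in \<open>simp_all add: x.cf_sel y.cf_sel x.faces y.faces x.degens y.degens ap\<close>)
qed

theorem corollary4p2:
  assumes "infinite (UNIV :: 'a set)"
  shows "(\<forall>X \<in> (two_segal_cosyms :: 'a cosym set). cf_of_cosym X \<in> comm_frob_pseudomonoids) \<and>
         (\<forall>X Y :: 'a cosym. (X, Y) \<in> cosym_iso_rel \<longrightarrow> (cf_of_cosym X, cf_of_cosym Y) \<in> cf_iso_rel) \<and>
         bij_betw (\<lambda>C. \<Union>X\<in>C. cf_iso_rel `` {cf_of_cosym X})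
           ((two_segal_cosyms :: 'a cosym set) // cosym_iso_rel)
           ((comm_frob_pseudomonoids :: 'a cf_pseudomonoid set) // cf_iso_rel)"
proof -
  have cf: "cf_of_cosym X \<in> comm_frob_pseudomonoids" if "X \<in> two_segal_cosyms" for X :: "'a cosym"
    using segal_cosym.cf_of_cosym_cf[OF segal_cosym.intro[OF that]] .
  have iff: "(cf_of_cosym X, cf_of_cosym Y) \<in> cf_iso_rel \<longleftrightarrow> (X, Y) \<in> cosym_iso_rel"
    if "X \<in> two_segal_cosyms" "Y \<in> two_segal_cosyms" for X Y :: "'a cosym"
    using that cf iso_cf_of_iso_cosym iso_cosym_of_iso_cf by (auto simp: cf_iso_rel_def cosym_iso_rel_def)
  have resp: "(cf_of_cosym X, cf_of_cosym Y) \<in> cf_iso_rel" if "(X, Y) \<in> cosym_iso_rel" for X Y :: "'a cosym"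
    using that iff by (auto simp: cosym_iso_rel_def)
  let ?F = "\<lambda>C. \<Union>X\<in>C. cf_iso_rel `` {cf_of_cosym X}"
  have cong: "(\<lambda>X :: 'a cosym. cf_iso_rel `` {cf_of_cosym X}) respects cosym_iso_rel"
    using equiv_class_eq[OF equiv_cf_iso_rel resp] by (auto simp: congruent_def)
  have F: "?F (cosym_iso_rel `` {X}) = cf_iso_rel `` {cf_of_cosym X}"
    if "X \<in> two_segal_cosyms" for X :: "'a cosym"
    by (rule UN_equiv_class[OF equiv_cosym_iso_rel cong that])
  have "bij_betw ?F ((two_segal_cosyms :: 'a cosym set) // cosym_iso_rel)
      ((comm_frob_pseudomonoids :: 'a cf_pseudomonoid set) // cf_iso_rel)"
    unfolding bij_betw_def
  proof (intro conjI equalityI subsetI)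
    show "inj_on ?F ((two_segal_cosyms :: 'a cosym set) // cosym_iso_rel)"
    proof (rule inj_onI)
      fix C D :: "'a cosym set"
      assume C: "C \<in> two_segal_cosyms // cosym_iso_rel" and D: "D \<in> two_segal_cosyms // cosym_iso_rel"
        and e: "?F C = ?F D"
      obtain X Y where X: "X \<in> two_segal_cosyms" "C = cosym_iso_rel `` {X}"
        and Y: "Y \<in> two_segal_cosyms" "D = cosym_iso_rel `` {Y}"
        using C D by (auto elim!: quotientE)
      have "cf_iso_rel `` {cf_of_cosym X} = cf_iso_rel `` {cf_of_cosym Y}"
        using e F[OF X(1)] F[OF Y(1)] X(2) Y(2) by simp
      then have "(cf_of_cosym X, cf_of_cosym Y) \<in> cf_iso_rel"
        using eq_equiv_class[OF _ equiv_cf_iso_rel cf[OF Y(1)]] by blast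
      then have "(X, Y) \<in> cosym_iso_rel" using iff X Y by blast
      then show "C = D" using equiv_class_eq[OF equiv_cosym_iso_rel] X Y by simp
    qed
  next
    fix D assume "D \<in> ?F ` ((two_segal_cosyms :: 'a cosym set) // cosym_iso_rel)"
    then obtain C where C: "C \<in> (two_segal_cosyms :: 'a cosym set) // cosym_iso_rel" "D = ?F C" by blast
    obtain X :: "'a cosym" where X: "X \<in> two_segal_cosyms" "C = cosym_iso_rel `` {X}"
      using C(1) by (rule quotientE)
    show "D \<in> comm_frob_pseudomonoids // cf_iso_rel"
      using F[OF X(1)] cf[OF X(1)] C(2) X(2) by (simp add: quotientI)
  next
    fix D :: "'a cf_pseudomonoid set" assume "D \<in> comm_frob_pseudomonoids // cf_iso_rel"
    then obtain P where P: "P \<in> comm_frob_pseudomonoids" and D: "D = cf_iso_rel `` {P}" by (rule quotientE)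
    interpret cf_pseudomonoid P by unfold_locales (rule P)
    obtain Y :: "'a cosym" where Y: "Y \<in> two_segal_cosyms" "iso_cf P (cf_of_cosym Y)"
      by (rule cosym_of_cf[OF assms])
    then have "(P, cf_of_cosym Y) \<in> cf_iso_rel" using P cf by (simp add: cf_iso_rel_def)
    then have "D = ?F (cosym_iso_rel `` {Y})"
      using F[OF Y(1)] equiv_class_eq[OF equiv_cf_iso_rel] D by simp
    then show "D \<in> ?F ` (two_segal_cosyms // cosym_iso_rel)"
      using quotientI[OF Y(1)] by blast
  qed
  with cf resp show ?thesis by blast
qed

end
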